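(* Suppose that $M$ is a weight $\mathfrak L$-module having shadow. Then for each $\beta\in R_{re}^\times$, one of the following happens: (i) $(\beta+\mathbb Z\delta)\cap R\subseteq R^{ln}$; (ii) $(\beta+\mathbb Z\delta)\cap R\subseteq R^{in}$; (iii) there exist $m\in\mathbb Z$ and $t\in\{0,1,-1\}$ such that for $\gamma:=\beta+m\delta$, $$(\gamma+\mathbb Z^{\geq1}\delta)\cap R\subseteq R^{in},\quad(\gamma+\mathbb Z^{\leq0}\delta)\cap R\subseteq R^{ln},\quad(-\gamma+\mathbb Z^{\geq t}\delta)\cap R\subseteq R^{in},\quad(-\gamma+\mathbb Z^{\leq t-1}\delta)\cap R\subseteq R^{ln};$$ (iv) there exist $m\in\mathbb Z$ and $t\in\{0,1,-1\}$ such that for $\eta:=\beta+m\delta$, $$(\eta+\mathbb Z^{\leq-1}\delta)\cap R\subseteq R^{in},\quad(\eta+\mathbb Z^{\geq0}\delta)\cap R\subseteq R^{ln},\quad(-\eta+\mathbb Z^{\leq -t}\delta)\cap R\subseteq R^{in},\quad(-\eta+\mathbb Z^{\geq1-t}\delta)\cap R\subseteq R^{ln}.$$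
   Context: **The algebra.** Ground field $\mathbb C$. Let $k,\ell$ be positive integers and let $\mathfrak L=\mathfrak L_0\oplus\mathfrak L_1$ be the twisted affine Lie superalgebra of one of the types $A(2k-1,2\ell-1)^{(2)}$ with $(k,\ell)\ne(1,1)$, $A(2k,2\ell)^{(4)}$, $A(2k,2\ell-1)^{(2)}$, $D(k+1,\ell)^{(2)}$, built from a finite-dimensional Lie superalgebra $\mathfrak g$ and an automorphism $\sigma$ of order $n$ as follows. $A$-types: $\mathfrak g=A(p,q)$ with $(p,q)=(2k-1,2\ell-1),(2k,2\ell),(2k,2\ell-1)$ and $n=2,4,2$ respectively, where $A(p,q)=\mathfrak{sl}(p+1,q+1)$ if $p\neq q$, and $A(p,p)=\mathfrak{sl}(p+1,p+1)$ modulo scalar matrices; $\sigma$ is (induced by) $\begin{pmatrix}A&B\\C&D\end{pmatrix}\mapsto\begin{pmatrix}-J_1A^tJ_1^{-1}&J_1C^tJ_2^{-1}\\-J_2B^tJ_1^{-1}&-J_2D^tJ_2^{-1}\end{pmatrix}$, where $J_1$ (size $p+1$) and $J_2$ (size $q+1$) are supported on the antidiagonal with $(J_a)_{r,N+1-r}=(-1)^r$ ($N$ the size), except: for $A(2k-1,2\ell-1)$ the entries of $J_1$ with $r\le k$ are $(-1)^{r+1}$; for $A(2k,2\ell)$ the entry of $J_2$ with $r=\ell+1$ is $\sqrt{-1}$ and those with $r\ge \ell+2$ are $(-1)^{r+1}$. $D$-type: $\mathfrak g=\mathfrak{osp}(2k+2,2\ell)$, all matrices $\begin{pmatrix}x&y&m&n'\\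 z&-x^t&p'&q'\\ -q'^t&-n'^t&r&s\\ p'^t&m^t&u&-r^t\end{pmatrix}$ with $x$ of size $(k+1)\times(k+1)$, $m$ of size $(k+1)\times \ell$, $r$ of size $\ell\times\ell$, $y,z$ skew-symmetric, $s,u$ symmetric; $n=2$ and $\sigma(X)=HXH^{-1}$, $H$ the permutation matrix exchanging the indices $k+1$ and $2k+2$. Let $\mathfrak t_1,\mathfrak t_2\subseteq\mathfrak g_0$ be the ideals of even matrices supported in the upper-left, resp. lower-right, diagonal block (traceless in the $A$-types), and $\mathfrak d_a$ the set of diagonal matrices in $\mathfrak t_a$. Let $\zeta_n$ be a primitive $n$-th root of unity, ${}^{[r]}\mathfrak g$ the $\zeta_n^r$-eigenspace of $\sigma$, and $\kappa$ the nondegenerate supersymmetric invariant even bilinear form on $\mathfrak g$ (the supertrace form). Then $\mathfrak L=\bigoplus_{r=0}^{n-1}({}^{[r]}\mathfrak g\otimes t^r\mathbb C[t^{\pm n}])\oplus\mathbb Cc\oplus\mathbb Cd$ with $c,d$ even and $[x\otimes t^a+rc+sd,\,y\otimes t^b+r'c+s'd]=[x,y]\otimes t^{a+b}+a\kappa(x,y)\delta_{a+b,0}c+sb\,y\otimes t^b-s'a\,x\otimes t^a$. Put $\mathfrak h_a=(({}^{[0]}\mathfrak g\cap\mathfrak d_a)\otimes1)\oplus\mathbb Cc\oplus\mathbb Cd$; $\mathfrak h=\mathfrak h_1+\mathfrak h_2$ is the standard Cartan subalgebra of $\mathfrak L$. **Roots.** $\mathfrak L^\alpha=\{x\in\mathfrak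 L: [h,x]=\alpha(h)x\ \forall h\in\mathfrak h\}$; $R$ (containing $0$) is the set of $\alpha\in\mathfrak h^*$ with $\mathfrak L^\alpha\ne0$. The form $(x\otimes t^a+rc+sd,\,y\otimes t^b+r'c+s'd)=\delta_{a+b,0}\kappa(x,y)+rs'+sr'$ is nondegenerate invariant supersymmetric, nondegenerate on $\mathfrak h$, and is transferred to $\mathfrak h^*$. $R_{re}^\times=\{\alpha\in R:(\alpha,\alpha)\neq0\}$ (nonzero real roots), $R_{im}=\{\alpha\in R:(\alpha,R)=0\}$ (imaginary roots). $\delta\in\mathfrak h^*$ is given by $\delta(d)=1$, $\delta(c)=0$, $\delta(({}^{[0]}\mathfrak g\cap\mathfrak d_a)\otimes1)=0$; $R_{im}$ generates $\mathbb Z\delta$; $\dim\mathfrak L^\alpha=1$ for $\alpha\in R\setminus R_{im}$. **Shadow.** A weight $\mathfrak L$-module is one with $M=\bigoplus_{\lambda\in\mathfrak h^*}M^\lambda$, $M^\lambda=\{v: hv=\lambda(h)v\ \forall h\in\mathfrak h\}$; $\mathrm{supp}(M)=\{\lambda: M^\lambda\neq0\}$. $R^{in}$ (resp. $R^{ln}$) is the set of $\alpha\in R_{re}^\times$ such that nonzero $x\in\mathfrak L^\alpha$ act injectively (resp. locally nilpotently) on $M$. Put $\mathfrak B_M=\{\alpha\in\mathrm{span}_{\mathbb Z}R: \{j\in\mathbb Z^{>0}:\lambda+j\alpha\in\mathrm{supp}(M)\}\text{ is finite for all }\lambda\in\mathrm{supp}(M)\}$ and $\mathfrak C_M=\{\alpha\in\mathrm{span}_{\mathbb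 Z}R:\alpha+\mathrm{supp}(M)\subseteq\mathrm{supp}(M)\}$. $M$ has shadow if (s1) $R_{re}^\times=R^{in}\cup R^{ln}$ and (s2) $R^{ln}=\mathfrak B_M\cap R_{re}^\times$ and $R^{in}=\mathfrak C_M\cap R_{re}^\times$. *)

theory Defs
  imports
    "Jordan_Normal_Form.Gauss_Jordan_Elimination"
    "HOL-Algebra.QuotRing"
begin

text \<open>
  Lie superalgebras are represented by \<^typ>\<open>(complex, 'a) module\<close> records: the field
  \<^const>\<open>mult\<close> is the superbracket, and the field \<^const>\<open>one\<close> plays no role. Matrix indices start
  at \<open>0\<close>.
\<close>

section \<open>The finite-dimensional superalgebras and their automorphisms\<close>

text \<open>
  \<open>A_odd_odd k l\<close>, \<open>A_even_even k l\<close>, \<open>A_even_odd k l\<close> and \<open>D_type k l\<close> stand for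
  \<open>A(2k-1,2l-1)\<^sup>(\<^sup>2\<^sup>)\<close>, \<open>A(2k,2l)\<^sup>(\<^sup>4\<^sup>)\<close>, \<open>A(2k,2l-1)\<^sup>(\<^sup>2\<^sup>)\<close> and \<open>D(k+1,l)\<^sup>(\<^sup>2\<^sup>)\<close>.
\<close>

datatype affine_type =
    A_odd_odd nat nat
  | A_even_even nat nat
  | A_even_odd nat nat
  | D_type nat nat

fun admissible :: "affine_type \<Rightarrow> bool" where
  "admissible (A_odd_odd k l) \<longleftrightarrow> k \<ge> 1 \<and> l \<ge> 1 \<and> (k, l) \<noteq> (1, 1)"
| "admissible (A_even_even k l) \<longleftrightarrow> k \<ge> 1 \<and> l \<ge> 1"
| "admissible (A_even_odd k l) \<longleftrightarrow> k \<ge> 1 \<and> l \<ge> 1"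
| "admissible (D_type k l) \<longleftrightarrow> k \<ge> 1 \<and> l \<ge> 1"

fun size1 :: "affine_type \<Rightarrow> nat" where
  "size1 (A_odd_odd k l) = 2 * k"
| "size1 (A_even_even k l) = 2 * k + 1"
| "size1 (A_even_odd k l) = 2 * k + 1"
| "size1 (D_type k l) = 2 * k + 2"

fun size2 :: "affine_type \<Rightarrow> nat" where
  "size2 (A_odd_odd k l) = 2 * l"
| "size2 (A_even_even k l) = 2 * l + 1"
| "size2 (A_even_odd k l) = 2 * l"
| "size2 (D_type k l) = 2 * l"

definition msize :: "affine_type \<Rightarrow> nat" where
  "msize T = size1 T + size2 T"

fun sigma_order :: "affine_type \<Rightarrow> nat" where
  "sigma_order (A_odd_odd k l) = 2"
| "sigma_order (A_even_even k l) = 4"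
| "sigma_order (A_even_odd k l) = 2"
| "sigma_order (D_type k l) = 2"

definition even_part :: "nat \<Rightarrow> complex mat \<Rightarrow> complex mat" where
  "even_part p X =
     mat (dim_row X) (dim_col X) (\<lambda>(i, j). if (i < p) = (j < p) then X $$ (i, j) else 0)"

definition odd_part :: "nat \<Rightarrow> complex mat \<Rightarrow> complex mat" where
  "odd_part p X =
     mat (dim_row X) (dim_col X) (\<lambda>(i, j). if (i < p) = (j < p) then 0 else X $$ (i, j))"

text \<open>The bilinear extension of \<open>[X, Y] = X Y - (-1)\<^bsup>|X||Y|\<^esup> Y X\<close>.\<close>

definition super_bracket :: "nat \<Rightarrow> complex mat \<Rightarrow> complex mat \<Rightarrow> complex mat" where
  "super_bracket p X Y = X * Y -
     (even_part p Y * X + odd_part p Y * even_part p X - odd_part p Y * odd_part p X)"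

definition supertrace :: "nat \<Rightarrow> complex mat \<Rightarrow> complex" where
  "supertrace p X = (\<Sum>i<dim_row X. if i < p then X $$ (i, i) else - (X $$ (i, i)))"

definition sl_super :: "nat \<Rightarrow> nat \<Rightarrow> complex mat set" where
  "sl_super p q = {X \<in> carrier_mat (p + q) (p + q). supertrace p X = 0}"

text \<open>\<open>osp_super a b\<close> is \<open>osp(2a, 2b)\<close>.\<close>

definition osp_super :: "nat \<Rightarrow> nat \<Rightarrow> complex mat set" where
  "osp_super a b =
     {four_block_mat
        (four_block_mat x y z (- x\<^sup>T))
        (four_block_mat m n' p' q')
        (four_block_mat (- q'\<^sup>T) (- n'\<^sup>T) p'\<^sup>T m\<^sup>T)
        (four_block_mat r s u (- r\<^sup>T))
      | x y z m n' p' q' r s u.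
        x \<in> carrier_mat a a \<and> y \<in> carrier_mat a a \<and> z \<in> carrier_mat a a \<and>
        m \<in> carrier_mat a b \<and> n' \<in> carrier_mat a b \<and> p' \<in> carrier_mat a b \<and> q' \<in> carrier_mat a b \<and>
        r \<in> carrier_mat b b \<and> s \<in> carrier_mat b b \<and> u \<in> carrier_mat b b \<and>
        y\<^sup>T = - y \<and> z\<^sup>T = - z \<and> s\<^sup>T = s \<and> u\<^sup>T = u}"

fun matrix_set :: "affine_type \<Rightarrow> complex mat set" where
  "matrix_set (D_type k l) = osp_super (k + 1) l"
| "matrix_set T = sl_super (size1 T) (size2 T)"

definition matrix_superalgebra :: "affine_type \<Rightarrow> (complex, complex mat) module" where
  "matrix_superalgebra T =
     (module_mat TYPE(complex) (msize T) (msize T))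
       \<lparr>carrier := matrix_set T, mult := super_bracket (size1 T)\<rparr>"

text \<open>
  The ideal factored out: the scalar matrices for \<open>A(p,p)\<close>, and the zero ideal in all other cases.
\<close>

fun scalar_ideal :: "affine_type \<Rightarrow> complex mat set" where
  "scalar_ideal (D_type k l) = {0\<^sub>m (msize (D_type k l)) (msize (D_type k l))}"
| "scalar_ideal T =
     (if size1 T = size2 T then {c \<cdot>\<^sub>m 1\<^sub>m (msize T) | c. True} else {0\<^sub>m (msize T) (msize T)})"

definition quotient_module ::
  "(complex, 'a, 'm) module_scheme \<Rightarrow> 'a set \<Rightarrow> (complex, 'a set) module" where
  "quotient_module L I = ring.extend (L Quot I)
     (module.fields (\<lambda>a C. \<Union>x\<in>C. I +>\<^bsub>L\<^esub> (a \<odot>\<^bsub>L\<^esub> x)))"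

definition fin_superalgebra :: "affine_type \<Rightarrow> (complex, complex mat set) module" where
  "fin_superalgebra T = quotient_module (matrix_superalgebra T) (scalar_ideal T)"

definition matrix_class :: "affine_type \<Rightarrow> complex mat \<Rightarrow> complex mat set" where
  "matrix_class T X = scalar_ideal T +>\<^bsub>matrix_superalgebra T\<^esub> X"

text \<open>
  \<open>fin_parity T 0\<close> and \<open>fin_parity T 1\<close> are the even and the odd part.
\<close>

definition fin_parity :: "affine_type \<Rightarrow> nat \<Rightarrow> complex mat set set" where
  "fin_parity T i = matrix_class T `
     {X \<in> matrix_set T. if i = 0 then odd_part (size1 T) X = 0\<^sub>m (msize T) (msize T)
                        else even_part (size1 T) X = 0\<^sub>m (msize T) (msize T)}"

text \<open>The supertrace form; it does not depend on the representatives.\<close>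

definition kappa :: "affine_type \<Rightarrow> complex mat set \<Rightarrow> complex mat set \<Rightarrow> complex" where
  "kappa T C D = the_elem ((\<lambda>(X, Y). supertrace (size1 T) (X * Y)) ` (C \<times> D))"

text \<open>
  The \<open>N \<times> N\<close> matrix supported on the antidiagonal whose entry in row \<open>r\<close> is \<open>f r\<close>, where here
  rows are counted from \<open>1\<close>.
\<close>

definition antidiagonal :: "nat \<Rightarrow> (nat \<Rightarrow> complex) \<Rightarrow> complex mat" where
  "antidiagonal N f = mat N N (\<lambda>(i, j). if i + j + 1 = N then f (i + 1) else 0)"

definition twisted_neg_supertranspose ::
  "complex mat \<Rightarrow> complex mat \<Rightarrow> complex mat \<Rightarrow> complex mat" where
  "twisted_neg_supertranspose J1 J2 X =
     (case split_block X (dim_row J1) (dim_row J1) of (A, B, C, D) \<Rightarrow>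
        four_block_mat
          (- (J1 * A\<^sup>T * the (mat_inverse J1))) (J1 * C\<^sup>T * the (mat_inverse J2))
          (- (J2 * B\<^sup>T * the (mat_inverse J1))) (- (J2 * D\<^sup>T * the (mat_inverse J2))))"

fun sigma_mat :: "affine_type \<Rightarrow> complex mat \<Rightarrow> complex mat" where
  "sigma_mat (A_odd_odd k l) = twisted_neg_supertranspose
     (antidiagonal (2 * k) (\<lambda>r. if r \<le> k then (- 1) ^ (r + 1) else (- 1) ^ r))
     (antidiagonal (2 * l) (\<lambda>r. (- 1) ^ r))"
| "sigma_mat (A_even_even k l) = twisted_neg_supertranspose
     (antidiagonal (2 * k + 1) (\<lambda>r. (- 1) ^ r))
     (antidiagonal (2 * l + 1)
        (\<lambda>r. if r = l + 1 then \<i> else if r \<ge> l + 2 then (- 1) ^ (r + 1) else (- 1) ^ r))"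
| "sigma_mat (A_even_odd k l) = twisted_neg_supertranspose
     (antidiagonal (2 * k + 1) (\<lambda>r. (- 1) ^ r))
     (antidiagonal (2 * l) (\<lambda>r. (- 1) ^ r))"
| "sigma_mat (D_type k l) =
     (let H = swaprows_mat (msize (D_type k l)) k (2 * k + 1)
      in (\<lambda>X. H * X * the (mat_inverse H)))"

text \<open>
  The automorphism induced on cosets is \<open>C \<mapsto> sigma_mat T ` C\<close>.
  \<open>fin_eigenspace T \<zeta> r\<close> is its \<open>\<zeta>\<^sup>r\<close>-eigenspace.
\<close>

definition fin_eigenspace :: "affine_type \<Rightarrow> complex \<Rightarrow> nat \<Rightarrow> complex mat set set" where
  "fin_eigenspace T \<zeta> r =
     {C \<in> carrier (fin_superalgebra T). sigma_mat T ` C = (\<zeta> ^ r) \<odot>\<^bsub>fin_superalgebra T\<^esub> C}"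

definition primitive_root_of_unity :: "nat \<Rightarrow> complex \<Rightarrow> bool" where
  "primitive_root_of_unity n \<zeta> \<longleftrightarrow> \<zeta> ^ n = 1 \<and> (\<forall>m. 0 < m \<and> m < n \<longrightarrow> \<zeta> ^ m \<noteq> 1)"

text \<open>
  The ideals \<open>\<tt>\<^sub>1\<close> and \<open>\<tt>\<^sub>2\<close>, at the level of matrices, for the index sets \<open>S\<close> of the first and the
  second diagonal block. In the A-types the vanishing of the supertrace makes their elements
  traceless.
\<close>

definition block_ideal :: "affine_type \<Rightarrow> nat set \<Rightarrow> complex mat set" where
  "block_ideal T S =
     {X \<in> matrix_set T. \<forall>i<msize T. \<forall>j<msize T. X $$ (i, j) \<noteq> 0 \<longrightarrow> i \<in> S \<and> j \<in> S}"

definition block_diagonals :: "affine_type \<Rightarrow> nat set \<Rightarrow> complex mat set set" where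
  "block_diagonals T S = matrix_class T ` {X \<in> block_ideal T S. diagonal_mat X}"


section \<open>The twisted affine superalgebras\<close>

text \<open>
  \<open>\<Sum>\<^sub>a f a \<otimes> t\<^sup>a + r c + s d\<close> is represented by the triple \<open>(f, r, s)\<close>; \<open>E a\<close> is the space of
  admissible coefficients of \<open>t\<^sup>a\<close>.
\<close>

definition affinization ::
  "(complex, 'g, 'm) module_scheme \<Rightarrow> ('g \<Rightarrow> 'g \<Rightarrow> complex) \<Rightarrow> (int \<Rightarrow> 'g set) \<Rightarrow>
   (complex, (int \<Rightarrow> 'g) \<times> complex \<times> complex) module" where
  "affinization G \<kappa> E =
     \<lparr>carrier = {(f, r, s). (\<forall>a. f a \<in> E a) \<and> finite {a. f a \<noteq> \<zero>\<^bsub>G\<^esub>}},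
      mult = (\<lambda>(f, r, s) (g, r', s').
        (\<lambda>b. (\<Oplus>\<^bsub>G\<^esub>a\<in>{a. f a \<noteq> \<zero>\<^bsub>G\<^esub>}. f a \<otimes>\<^bsub>G\<^esub> g (b - a))
               \<oplus>\<^bsub>G\<^esub> ((s * of_int b) \<odot>\<^bsub>G\<^esub> g b) \<ominus>\<^bsub>G\<^esub> ((s' * of_int b) \<odot>\<^bsub>G\<^esub> f b),
         \<Sum>a\<in>{a. f a \<noteq> \<zero>\<^bsub>G\<^esub>}. of_int a * \<kappa> (f a) (g (- a)),
         0)),
      one = undefined,
      zero = (\<lambda>_. \<zero>\<^bsub>G\<^esub>, 0, 0),
      add = (\<lambda>(f, r, s) (g, r', s'). (\<lambda>a. f a \<oplus>\<^bsub>G\<^esub> g a, r + r', s + s')),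
      smult = (\<lambda>z (f, r, s). (\<lambda>a. z \<odot>\<^bsub>G\<^esub> f a, z * r, z * s))\<rparr>"

definition affinization_form ::
  "(complex, 'g, 'm) module_scheme \<Rightarrow> ('g \<Rightarrow> 'g \<Rightarrow> complex) \<Rightarrow>
   (int \<Rightarrow> 'g) \<times> complex \<times> complex \<Rightarrow> (int \<Rightarrow> 'g) \<times> complex \<times> complex \<Rightarrow> complex" where
  "affinization_form G \<kappa> = (\<lambda>(f, r, s) (g, r', s').
     (\<Sum>a\<in>{a. f a \<noteq> \<zero>\<^bsub>G\<^esub>}. \<kappa> (f a) (g (- a))) + r * s' + s * r')"

type_synonym aff = "(int \<Rightarrow> complex mat set) \<times> complex \<times> complex"

definition affine :: "affine_type \<Rightarrow> complex \<Rightarrow> (complex, aff) module" where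
  "affine T \<zeta> = affinization (fin_superalgebra T) (kappa T)
     (\<lambda>a. fin_eigenspace T \<zeta> (nat (a mod int (sigma_order T))))"

definition affine_form :: "affine_type \<Rightarrow> aff \<Rightarrow> aff \<Rightarrow> complex" where
  "affine_form T = affinization_form (fin_superalgebra T) (kappa T)"

definition affine_parity :: "affine_type \<Rightarrow> complex \<Rightarrow> nat \<Rightarrow> aff set" where
  "affine_parity T \<zeta> i =
     {(f, r, s) \<in> carrier (affine T \<zeta>). (\<forall>a. f a \<in> fin_parity T i) \<and> (i = 0 \<or> r = 0 \<and> s = 0)}"

definition partial_cartan :: "affine_type \<Rightarrow> complex \<Rightarrow> nat set \<Rightarrow> aff set" where
  "partial_cartan T \<zeta> S =
     {(\<lambda>a. if a = 0 then C else \<zero>\<^bsub>fin_superalgebra T\<^esub>, r, s)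
      | C r s. C \<in> fin_eigenspace T \<zeta> 0 \<inter> block_diagonals T S}"

definition cartan :: "affine_type \<Rightarrow> complex \<Rightarrow> aff set" where
  "cartan T \<zeta> = partial_cartan T \<zeta> {..<size1 T} <+>\<^bsub>affine T \<zeta>\<^esub> partial_cartan T \<zeta> {size1 T..<msize T}"


section \<open>Roots\<close>

text \<open>
  An element of the dual of \<open>H\<close> is represented by the function that is linear on \<open>H\<close> and \<open>0\<close>
  elsewhere.
\<close>

definition dual_space ::
  "(complex, 'l, 'm) module_scheme \<Rightarrow> 'l set \<Rightarrow> ('l \<Rightarrow> complex) set" where
  "dual_space L H =
     {\<alpha>. (\<forall>h\<in>H. \<forall>h'\<in>H. \<alpha> (h \<oplus>\<^bsub>L\<^esub> h') = \<alpha> h + \<alpha> h') \<and>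
         (\<forall>z. \<forall>h\<in>H. \<alpha> (z \<odot>\<^bsub>L\<^esub> h) = z * \<alpha> h) \<and>
         (\<forall>x. x \<notin> H \<longrightarrow> \<alpha> x = 0)}"

definition root_space ::
  "(complex, 'l, 'm) module_scheme \<Rightarrow> 'l set \<Rightarrow> ('l \<Rightarrow> complex) \<Rightarrow> 'l set" where
  "root_space L H \<alpha> = {x \<in> carrier L. \<forall>h\<in>H. h \<otimes>\<^bsub>L\<^esub> x = \<alpha> h \<odot>\<^bsub>L\<^esub> x}"

definition root_set ::
  "(complex, 'l, 'm) module_scheme \<Rightarrow> 'l set \<Rightarrow> ('l \<Rightarrow> complex) set" where
  "root_set L H = {\<alpha> \<in> dual_space L H. root_space L H \<alpha> \<noteq> {\<zero>\<^bsub>L\<^esub>}}"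

text \<open>
  The form transferred to the dual of \<open>H\<close> along \<open>t \<mapsto> B t\<close>, which is bijective because \<open>B\<close> is
  nondegenerate on \<open>H\<close>.
\<close>

definition dual_vector :: "('l \<Rightarrow> 'l \<Rightarrow> complex) \<Rightarrow> 'l set \<Rightarrow> ('l \<Rightarrow> complex) \<Rightarrow> 'l" where
  "dual_vector B H \<alpha> = (THE t. t \<in> H \<and> (\<forall>h\<in>H. B t h = \<alpha> h))"

definition dual_form ::
  "('l \<Rightarrow> 'l \<Rightarrow> complex) \<Rightarrow> 'l set \<Rightarrow> ('l \<Rightarrow> complex) \<Rightarrow> ('l \<Rightarrow> complex) \<Rightarrow> complex" where
  "dual_form B H \<alpha> \<beta> = B (dual_vector B H \<alpha>) (dual_vector B H \<beta>)"

definition int_span :: "('l \<Rightarrow> complex) set \<Rightarrow> ('l \<Rightarrow> complex) set" where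
  "int_span A = {(\<lambda>h. \<Sum>\<alpha>\<in>F. of_int (c \<alpha>) * \<alpha> h) | F c. finite F \<and> F \<subseteq> A}"

definition roots :: "affine_type \<Rightarrow> complex \<Rightarrow> (aff \<Rightarrow> complex) set" where
  "roots T \<zeta> = root_set (affine T \<zeta>) (cartan T \<zeta>)"

definition real_roots :: "affine_type \<Rightarrow> complex \<Rightarrow> (aff \<Rightarrow> complex) set" where
  "real_roots T \<zeta> = {\<alpha> \<in> roots T \<zeta>. dual_form (affine_form T) (cartan T \<zeta>) \<alpha> \<alpha> \<noteq> 0}"

definition delta :: "affine_type \<Rightarrow> complex \<Rightarrow> aff \<Rightarrow> complex" where
  "delta T \<zeta> = (\<lambda>(f, r, s). if (f, r, s) \<in> cartan T \<zeta> then s else 0)"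

definition delta_shift :: "affine_type \<Rightarrow> complex \<Rightarrow> (aff \<Rightarrow> complex) \<Rightarrow> int \<Rightarrow> aff \<Rightarrow> complex" where
  "delta_shift T \<zeta> \<beta> m = (\<lambda>h. \<beta> h + of_int m * delta T \<zeta> h)"

text \<open>\<open>delta_string T \<zeta> \<beta> J\<close> is \<open>\<beta> + J \<delta>\<close>.\<close>

definition delta_string ::
  "affine_type \<Rightarrow> complex \<Rightarrow> (aff \<Rightarrow> complex) \<Rightarrow> int set \<Rightarrow> (aff \<Rightarrow> complex) set" where
  "delta_string T \<zeta> \<beta> J = delta_shift T \<zeta> \<beta> ` J"


section \<open>Weight modules and shadow\<close>

text \<open>
  A module is a type \<^typ>\<open>'v\<close> with scalar multiplication \<open>scl\<close> and action \<open>act\<close>. No grading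
  of the module is required.
\<close>

definition lie_module ::
  "(complex, 'l, 'm) module_scheme \<Rightarrow> (nat \<Rightarrow> 'l set) \<Rightarrow>
   (complex \<Rightarrow> 'v \<Rightarrow> 'v::ab_group_add) \<Rightarrow> ('l \<Rightarrow> 'v \<Rightarrow> 'v) \<Rightarrow> bool" where
  "lie_module L P scl act \<longleftrightarrow>
     vector_space scl \<and>
     (\<forall>x\<in>carrier L. Vector_Spaces.linear scl scl (act x)) \<and>
     (\<forall>x\<in>carrier L. \<forall>y\<in>carrier L. \<forall>v. act (x \<oplus>\<^bsub>L\<^esub> y) v = act x v + act y v) \<and>
     (\<forall>z. \<forall>x\<in>carrier L. \<forall>v. act (z \<odot>\<^bsub>L\<^esub> x) v = scl z (act x v)) \<and>
     (\<forall>i\<in>{0, 1}. \<forall>j\<in>{0, 1}. \<forall>x\<in>P i. \<forall>y\<in>P j. \<forall>v.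
        act (x \<otimes>\<^bsub>L\<^esub> y) v = act x (act y v) - scl ((- 1) ^ (i * j)) (act y (act x v)))"

definition weight_space ::
  "'l set \<Rightarrow> (complex \<Rightarrow> 'v \<Rightarrow> 'v) \<Rightarrow> ('l \<Rightarrow> 'v \<Rightarrow> 'v) \<Rightarrow> ('l \<Rightarrow> complex) \<Rightarrow> 'v set" where
  "weight_space H scl act \<mu> = {v. \<forall>h\<in>H. act h v = scl (\<mu> h) v}"

text \<open>Every vector is in a unique way a finite sum of weight vectors: the sum is direct and exhausts M.\<close>

definition weight_decomposition ::
  "(complex, 'l, 'm) module_scheme \<Rightarrow> 'l set \<Rightarrow>
   (complex \<Rightarrow> 'v \<Rightarrow> 'v::ab_group_add) \<Rightarrow> ('l \<Rightarrow> 'v \<Rightarrow> 'v) \<Rightarrow> bool" where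
  "weight_decomposition L H scl act \<longleftrightarrow>
     (\<forall>v. \<exists>!w. (\<forall>\<mu>\<in>dual_space L H. w \<mu> \<in> weight_space H scl act \<mu>) \<and>
               (\<forall>\<mu>. \<mu> \<notin> dual_space L H \<longrightarrow> w \<mu> = 0) \<and>
               finite {\<mu>. w \<mu> \<noteq> 0} \<and> v = (\<Sum>\<mu>\<in>{\<mu>. w \<mu> \<noteq> 0}. w \<mu>))"

definition weight_module ::
  "affine_type \<Rightarrow> complex \<Rightarrow> (complex \<Rightarrow> 'v \<Rightarrow> 'v::ab_group_add) \<Rightarrow> (aff \<Rightarrow> 'v \<Rightarrow> 'v) \<Rightarrow> bool" where
  "weight_module T \<zeta> scl act \<longleftrightarrow>
     lie_module (affine T \<zeta>) (affine_parity T \<zeta>) scl act \<and>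
     weight_decomposition (affine T \<zeta>) (cartan T \<zeta>) scl act"

definition weight_support ::
  "affine_type \<Rightarrow> complex \<Rightarrow> (complex \<Rightarrow> 'v \<Rightarrow> 'v::ab_group_add) \<Rightarrow> (aff \<Rightarrow> 'v \<Rightarrow> 'v) \<Rightarrow>
   (aff \<Rightarrow> complex) set" where
  "weight_support T \<zeta> scl act =
     {\<mu> \<in> dual_space (affine T \<zeta>) (cartan T \<zeta>). weight_space (cartan T \<zeta>) scl act \<mu> \<noteq> {0}}"

definition R_in :: "affine_type \<Rightarrow> complex \<Rightarrow> (aff \<Rightarrow> 'v \<Rightarrow> 'v) \<Rightarrow> (aff \<Rightarrow> complex) set" where
  "R_in T \<zeta> act =
     {\<alpha> \<in> real_roots T \<zeta>. \<forall>x\<in>root_space (affine T \<zeta>) (cartan T \<zeta>) \<alpha>.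
        x \<noteq> \<zero>\<^bsub>affine T \<zeta>\<^esub> \<longrightarrow> inj (act x)}"

definition R_ln :: "affine_type \<Rightarrow> complex \<Rightarrow> (aff \<Rightarrow> 'v \<Rightarrow> 'v::ab_group_add) \<Rightarrow> (aff \<Rightarrow> complex) set" where
  "R_ln T \<zeta> act =
     {\<alpha> \<in> real_roots T \<zeta>. \<forall>x\<in>root_space (affine T \<zeta>) (cartan T \<zeta>) \<alpha>.
        x \<noteq> \<zero>\<^bsub>affine T \<zeta>\<^esub> \<longrightarrow> (\<forall>v. \<exists>n. (act x ^^ n) v = 0)}"

definition B_set ::
  "affine_type \<Rightarrow> complex \<Rightarrow> (complex \<Rightarrow> 'v \<Rightarrow> 'v::ab_group_add) \<Rightarrow> (aff \<Rightarrow> 'v \<Rightarrow> 'v) \<Rightarrow>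
   (aff \<Rightarrow> complex) set" where
  "B_set T \<zeta> scl act =
     {\<alpha> \<in> int_span (roots T \<zeta>). \<forall>\<mu>\<in>weight_support T \<zeta> scl act.
        finite {j::int. j > 0 \<and> (\<lambda>h. \<mu> h + of_int j * \<alpha> h) \<in> weight_support T \<zeta> scl act}}"

definition C_set ::
  "affine_type \<Rightarrow> complex \<Rightarrow> (complex \<Rightarrow> 'v \<Rightarrow> 'v::ab_group_add) \<Rightarrow> (aff \<Rightarrow> 'v \<Rightarrow> 'v) \<Rightarrow>
   (aff \<Rightarrow> complex) set" where
  "C_set T \<zeta> scl act =
     {\<alpha> \<in> int_span (roots T \<zeta>). \<forall>\<mu>\<in>weight_support T \<zeta> scl act.
        (\<lambda>h. \<alpha> h + \<mu> h) \<in> weight_support T \<zeta> scl act}"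

definition has_shadow ::
  "affine_type \<Rightarrow> complex \<Rightarrow> (complex \<Rightarrow> 'v \<Rightarrow> 'v::ab_group_add) \<Rightarrow> (aff \<Rightarrow> 'v \<Rightarrow> 'v) \<Rightarrow> bool" where
  "has_shadow T \<zeta> scl act \<longleftrightarrow>
     real_roots T \<zeta> = R_in T \<zeta> act \<union> R_ln T \<zeta> act \<and>
     R_ln T \<zeta> act = B_set T \<zeta> scl act \<inter> real_roots T \<zeta> \<and>
     R_in T \<zeta> act = C_set T \<zeta> scl act \<inter> real_roots T \<zeta>"

end

theory Submission
  imports Defs
begin

text \<open>
  Call a pair \<open>(n, x)\<close> of integers a \<^emph>\<open>translation\<close> if adding \<open>n\<beta> + x\<delta>\<close> maps the support of \<open>M\<close>
  into itself. Translations form a monoid. If the support is empty then all real roots are in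
  \<open>R\<^sup>l\<^sup>n\<close>; otherwise the shadow property says that a real root is in \<open>R\<^sup>i\<^sup>n\<close> iff it translates the
  support into itself, and no positive multiple of a root of \<open>R\<^sup>l\<^sup>n\<close> does, because that would give an
  infinite ray in the support. Hence \<open>R\<^sup>i\<^sup>n\<close> is convex on each of the strings \<open>\<plusminus>\<beta> + \<int>\<delta>\<close>. If
  neither \<open>\<alpha>\<close> nor \<open>-\<alpha>\<close> is in \<open>R\<^sup>i\<^sup>n\<close>, where \<open>\<alpha> = \<beta> + a\<delta>\<close>, then both act locally nilpotently, and
  \<open>sl\<^sub>2\<close>-theory makes the support stable under the reflection in \<open>\<alpha>\<close>. On translations this
  reflection is \<open>(n, x) \<mapsto> (-n, x - 2na)\<close>.

  The rest is elementary (\<open>threshold_alternatives\<close>). Let \<open>a < b\<close> be neighbours in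
  \<open>{a. \<beta> + a\<delta> \<in> R}\<close> with \<open>\<beta> + a\<delta>\<close> in \<open>R\<^sup>i\<^sup>n\<close> and \<open>\<beta> + b\<delta>\<close> not. If \<open>-\<beta> - b\<delta>\<close> is in \<open>R\<^sup>i\<^sup>n\<close>, the
  sum of the two roots in \<open>R\<^sup>i\<^sup>n\<close> is the translation \<open>(0, a - b)\<close>; if not, reflecting in \<open>\<beta> + b\<delta>\<close> gives
  \<open>(0, 2(a - b))\<close>. In both cases everything to the left is in \<open>R\<^sup>i\<^sup>n\<close>, and by convexity nothing to the
  right is. The product of the reflections in two distinct roots of the string would carry
  \<open>(1, a)\<close> arbitrarily far to the right, which contradicts convexity. So at most one root of the string can
  be reflected in, and the thresholds of the strings of \<open>\<beta>\<close> and \<open>-\<beta>\<close> are in the same gap or in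
  neighbouring ones.

  The argument uses three facts about real roots \<open>\<alpha>\<close>: \<open>-\<alpha>\<close> is a real root, all roots in
  \<open>\<alpha> + \<int>\<delta>\<close> are real, and there are root vectors \<open>x, y\<close> for \<open>\<alpha>, -\<alpha>\<close> of the same parity
  such that \<open>h = [x, y]\<close> is in the Cartan subalgebra with \<open>\<alpha>(h) \<noteq> 0 = \<delta>(h)\<close>
  (\<open>real_root_pair\<close>, \<open>real_root_string\<close>). To find them, let \<open>X \<otimes> t\<^sup>a\<close> be a nonzero component of a root
  vector for \<open>\<alpha>\<close>, and let \<open>X\<^sup>*\<close> be the conjugate transpose with the sign of the upper right block
  changed. The map \<open>X \<mapsto> X\<^sup>*\<close> is antilinear, commutes with \<open>\<sigma>\<close> and preserves the matrix superalgebra,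
  so \<open>X\<^sup>* \<otimes> t\<^sup>-\<^sup>a\<close> is a root vector for \<open>-\<alpha>\<close>. Once \<open>X\<close> is cut down to its odd part or to one
  diagonal block, \<open>str (X X\<^sup>*) \<noteq> 0\<close>, \<open>W = [X, X\<^sup>*]\<close> is a diagonal matrix fixed by \<open>\<sigma>\<close>, and
  \<open>str (W Y) = \<alpha>(Y) str (X X\<^sup>*)\<close> for all \<open>Y\<close> in the Cartan subalgebra. So, up to a scalar and a
  central term, \<open>W\<close> is the vector that represents \<open>\<alpha>\<close>, and \<open>\<alpha>(W) \<noteq> 0\<close> because
  \<open>(\<alpha>, \<alpha>) \<noteq> 0\<close> (\<open>fin_root_pair\<close>).
\<close>

section \<open>Thresholds of reflective cones\<close>

lemma consecutive_change:
  fixes a b :: int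
  assumes "a \<in> A" "b \<in> A" "a < b" "P a" "\<not> P b"
  obtains a' b' where "a' \<in> A" "b' \<in> A" "a' < b'" "P a'" "\<not> P b'" "\<And>x. x \<in> A \<Longrightarrow> x \<le> a' \<or> b' \<le> x"
proof -
  define b' where "b' = Min {x \<in> A. a < x \<and> x \<le> b \<and> \<not> P x}"
  have fin: "finite {x \<in> A. a < x \<and> x \<le> b \<and> \<not> P x}"
    by (rule finite_subset[of _ "{a..b}"]) auto
  have "b' \<in> {x \<in> A. a < x \<and> x \<le> b \<and> \<not> P x}"
    unfolding b'_def by (rule Min_in[OF fin]) (use assms in auto)
  then have b': "b' \<in> A" "a < b'" "b' \<le> b" "\<not> P b'" by auto
  have b'_min: "P x" if "x \<in> A" "a < x" "x < b'" for x
    using Min_le[OF fin, of x] that b' unfolding b'_def[symmetric] by fastforce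
  define a' where "a' = Max {x \<in> A. a \<le> x \<and> x < b'}"
  have fin': "finite {x \<in> A. a \<le> x \<and> x < b'}"
    by (rule finite_subset[of _ "{a..b'}"]) auto
  have "a' \<in> {x \<in> A. a \<le> x \<and> x < b'}"
    unfolding a'_def by (rule Max_in[OF fin']) (use assms b' in auto)
  then have a': "a' \<in> A" "a \<le> a'" "a' < b'" by auto
  have "x \<le> a'" if "x \<in> A" "x < b'" for x
    using Max_ge[OF fin', of x] that a' unfolding a'_def[symmetric] by force
  then have "x \<le> a' \<or> b' \<le> x" if "x \<in> A" for x using that by force
  moreover have "P a'" using b'_min[of a'] a' assms by force
  ultimately show thesis using that a' b' by blast
qed

text \<open>
  For a real root \<open>\<beta>\<close>, \<open>c n x\<close> will say that \<open>n\<beta> + x\<delta>\<close> translates the support into itself, and \<open>A\<close>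
  will be the set of all \<open>a\<close> such that \<open>\<beta> + a\<delta>\<close> is a root.
\<close>

locale reflective_cone =
  fixes c :: "int \<Rightarrow> int \<Rightarrow> bool" and A :: "int set"
  assumes add: "\<And>n x n' x'. c n x \<Longrightarrow> c n' x' \<Longrightarrow> c (n + n') (x + x')"
    and zero: "c 0 0"
    and saturated: "\<And>a N. a \<in> A \<Longrightarrow> N \<ge> 1 \<Longrightarrow> c N (N * a) \<Longrightarrow> c 1 a"
    and saturated_neg: "\<And>a N. a \<in> A \<Longrightarrow> N \<ge> 1 \<Longrightarrow> c (- N) (- (N * a)) \<Longrightarrow> c (- 1) (- a)"
    and reflect: "\<And>a n x. a \<in> A \<Longrightarrow> \<not> c 1 a \<Longrightarrow> \<not> c (- 1) (- a) \<Longrightarrow> c n x \<Longrightarrow> c (- n) (x - 2 * n * a)"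
begin

lemma scale:
  assumes "c n x" "N \<ge> 0"
  shows "c (N * n) (N * x)"
  using \<open>N \<ge> 0\<close>
proof (induction N rule: int_ge_induct)
  case base
  then show ?case using zero by simp
next
  case (step N)
  then have "c (N * n + n) (N * x + x)" using add \<open>c n x\<close> by blast
  then show ?case by (simp add: algebra_simps)
qed

text \<open>
  The point \<open>(n, a)\<close> lies on the segment from \<open>(n, x)\<close> to \<open>(n, z)\<close>; its multiple by the length of
  that segment is a nonnegative integer combination of the end points.
\<close>

lemma combine:
  assumes "c n x" "c n z" "x \<le> a" "a \<le> z"
  shows "c ((z - x) * n) ((z - x) * a)"
proof -
  have "c ((z - a) * n + (a - x) * n) ((z - a) * x + (a - x) * z)"
    using assms by (intro add scale) auto
  then show ?thesis by (simp add: algebra_simps)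
qed

lemma convex:
  assumes "c 1 x" "c 1 z" "x \<le> a" "a \<le> z" "a \<in> A"
  shows "c 1 a"
  using combine[OF assms(1-4)] saturated[OF \<open>a \<in> A\<close>, of "z - x"] assms
  by (cases "x = z") auto

lemma convex_neg:
  assumes "c (- 1) x" "c (- 1) z" "x \<le> - a" "- a \<le> z" "a \<in> A"
  shows "c (- 1) (- a)"
  using combine[OF assms(1-4)] saturated_neg[OF \<open>a \<in> A\<close>, of "z - x"] assms
  by (cases "x = z") auto

lemma shift: "c n x \<Longrightarrow> c 0 s \<Longrightarrow> N \<ge> 0 \<Longrightarrow> c n (x + N * s)"
  using add[of n x "N * 0" "N * s"] scale[of 0 s N] by simp

text \<open>
  All conclusions are read off at a pair of neighbours in \<open>A\<close> between which \<open>c 1\<close> changes from true to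
  false. The gap between them may be longer than one; \<open>m\<close> is chosen at its left end or at its right
  end so that one step in \<open>t\<close> moves the threshold of \<open>c (- 1)\<close> past the whole gap.
\<close>

lemma descending_threshold:
  assumes "a0 \<in> A" "b0 \<in> A" "a0 < b0" "c 1 a0" "\<not> c 1 b0"
  shows "\<exists>m. \<exists>t\<in>{0, 1, -1}. \<forall>j\<in>A.
    (j \<le> m - 1 \<longrightarrow> c 1 j) \<and> (j \<ge> m \<longrightarrow> \<not> c 1 j) \<and>
    (- j \<le> - m - t \<longrightarrow> c (- 1) (- j)) \<and> (- j \<ge> - m + 1 - t \<longrightarrow> \<not> c (- 1) (- j))"
proof -
  obtain a b where ab: "a \<in> A" "b \<in> A" "a < b" "c 1 a" "\<not> c 1 b"
    and gap: "\<And>x. x \<in> A \<Longrightarrow> x \<le> a \<or> b \<le> x"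
    using consecutive_change[of a0 A b0 "c 1"] assms by blast
  have above: "\<not> c 1 x" if "x \<in> A" "x \<ge> b" for x
    using convex[of a x b] ab that by auto
  have below: "c 1 x" if "x \<in> A" "x \<le> a" "c 0 s" "s < 0" for x s
  proof -
    have "(a - x) * s \<le> (a - x) * (- 1)"
      using that by (intro mult_left_mono) auto
    then have "a + (a - x) * s \<le> x" by simp
    then show ?thesis
      using convex[of "a + (a - x) * s" a x] shift[of 1 a s "a - x"] ab that by auto
  qed
  have no_up: "\<not> c 0 s" if "s > 0" for s
  proof
    assume s: "c 0 s"
    have "(b - a) * 1 \<le> (b - a) * s"
      using that ab by (intro mult_left_mono) auto
    then have "b \<le> a + (b - a) * s" by simp
    then show False
      using convex[of a "a + (b - a) * s" b] shift[of 1 a s "b - a"] s ab by auto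
  qed
  show ?thesis
  proof (cases "c (- 1) (- b)")
    case True
    have s: "c 0 (a - b)" using add[OF \<open>c 1 a\<close> True] by simp
    have right: "c (- 1) (- x)" if "x \<in> A" "x \<ge> b" for x
    proof -
      have "(x - b) * (a - b) \<le> (x - b) * (- 1)"
        using that ab by (intro mult_left_mono) auto
      then have "- b + (x - b) * (a - b) \<le> - x" by simp
      then show ?thesis
        using convex_neg[of "- b + (x - b) * (a - b)" "- b" x] shift[OF True s, of "x - b"] True that by auto
    qed
    have left: "\<not> c (- 1) (- x)" if "x < a" for x
      using add[OF \<open>c 1 a\<close>, of "- 1" "- x"] no_up[of "a - x"] that by auto
    \<comment> \<open>whether the root opposite to the left end of the gap belongs to the cone shifts the threshold by one\<close>
    define t :: int where "t = (if c (- 1) (- a) then - 1 else 0)"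
    have "(j \<le> (a + 1) - 1 \<longrightarrow> c 1 j) \<and> (j \<ge> a + 1 \<longrightarrow> \<not> c 1 j) \<and>
        (- j \<le> - (a + 1) - t \<longrightarrow> c (- 1) (- j)) \<and> (- j \<ge> - (a + 1) + 1 - t \<longrightarrow> \<not> c (- 1) (- j))"
      if "j \<in> A" for j
    proof (intro conjI impI)
      show "c 1 j" if "j \<le> (a + 1) - 1"
        using below[OF \<open>j \<in> A\<close> _ s] that ab by auto
      show "\<not> c 1 j" if "j \<ge> a + 1"
        using above[OF \<open>j \<in> A\<close>] gap[OF \<open>j \<in> A\<close>] that by auto
      show "c (- 1) (- j)" if "- j \<le> - (a + 1) - t"
        using that right[OF \<open>j \<in> A\<close>] gap[OF \<open>j \<in> A\<close>]
        by (cases "j = a") (auto simp: t_def split: if_splits)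
      show "\<not> c (- 1) (- j)" if "- j \<ge> - (a + 1) + 1 - t"
        using that left[of j] by (cases "j = a") (auto simp: t_def split: if_splits)
    qed
    moreover have "t \<in> {0, 1, -1}" by (auto simp: t_def)
    ultimately show ?thesis by blast
  next
    case False
    have r: "c (- 1) (a - 2 * b)" using reflect[OF \<open>b \<in> A\<close> \<open>\<not> c 1 b\<close> False \<open>c 1 a\<close>] by simp
    have s: "c 0 (2 * a - 2 * b)" using add[OF \<open>c 1 a\<close> r] by (simp add: algebra_simps)
    have left: "\<not> c (- 1) (- x)" if "x \<le> b" for x
      using convex_neg[OF r, of "- x" b] that ab False by auto
    have right: "c (- 1) (- x)" if "x \<in> A" "x > b" for x
    proof (rule ccontr)
      assume x: "\<not> c (- 1) (- x)"
      \<comment> \<open>the product of the reflections at \<open>b\<close> and \<open>x\<close> moves \<open>(1, a)\<close> upwards\<close>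
      have up: "c 1 (a + int k * (2 * (x - b)))" for k
      proof (induction k)
        case (Suc k)
        from reflect[OF \<open>b \<in> A\<close> \<open>\<not> c 1 b\<close> False this]
        have "c (- 1) (a + int k * (2 * (x - b)) - 2 * b)" by simp
        from reflect[OF \<open>x \<in> A\<close> _ x this] above that
        show ?case by (simp add: algebra_simps)
      qed (use ab in simp)
      have "(b - a) * 1 \<le> (b - a) * (2 * (x - b))"
        using that ab by (intro mult_left_mono) auto
      then have "b \<le> a + (b - a) * (2 * (x - b))" by simp
      then show False
        using convex[OF \<open>c 1 a\<close> up[of "nat (b - a)"], of b] ab by auto
    qed
    have "(j \<le> b - 1 \<longrightarrow> c 1 j) \<and> (j \<ge> b \<longrightarrow> \<not> c 1 j) \<and>
        (- j \<le> - b - 1 \<longrightarrow> c (- 1) (- j)) \<and> (- j \<ge> - b + 1 - 1 \<longrightarrow> \<not> c (- 1) (- j))"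
      if "j \<in> A" for j
      using below[OF that _ s] gap[OF that] above[OF that] left[of j] right[OF that] ab by auto
    then show ?thesis by blast
  qed
qed

text \<open>
  The substitution \<open>\<delta> \<mapsto> - \<delta>\<close>, which exchanges the two directions of a threshold.
\<close>

lemma reversed: "reflective_cone (\<lambda>n x. c n (- x)) (uminus ` A)"
proof
  show "c (n + n') (- (x + x'))" if "c n (- x)" "c n' (- x')" for n x n' x'
    using add[OF that] by simp
  show "c (- n) (- (x - 2 * n * d))"
    if d: "d \<in> uminus ` A" "\<not> c 1 (- d)" "\<not> c (- 1) (- (- d))" "c n (- x)" for d n x
    using reflect[of "- d", OF _ _ _ d(4)] d by (auto simp: algebra_simps)
  show "c 1 (- d)" if "d \<in> uminus ` A" "N \<ge> 1" "c N (- (N * d))" for d N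
    using saturated[of "- d" N] that by auto
  show "c (- 1) (- (- d))" if "d \<in> uminus ` A" "N \<ge> 1" "c (- N) (- (- (N * d)))" for d N
    using saturated_neg[of "- d" N] that by auto
qed (use zero in simp)

end

lemma (in reflective_cone) threshold_alternatives:
  obtains "\<forall>a\<in>A. \<not> c 1 a" | "\<forall>a\<in>A. c 1 a"
  | m t where "t \<in> {0, 1, -1}"
      "\<forall>j\<in>A. (j \<ge> m + 1 \<longrightarrow> c 1 j) \<and> (j \<le> m \<longrightarrow> \<not> c 1 j) \<and>
        (- j \<ge> - m + t \<longrightarrow> c (- 1) (- j)) \<and> (- j \<le> - m + t - 1 \<longrightarrow> \<not> c (- 1) (- j))"
  | m t where "t \<in> {0, 1, -1}"
      "\<forall>j\<in>A. (j \<le> m - 1 \<longrightarrow> c 1 j) \<and> (j \<ge> m \<longrightarrow> \<not> c 1 j) \<and>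
        (- j \<le> - m - t \<longrightarrow> c (- 1) (- j)) \<and> (- j \<ge> - m + 1 - t \<longrightarrow> \<not> c (- 1) (- j))"
proof (cases "(\<forall>a\<in>A. \<not> c 1 a) \<or> (\<forall>a\<in>A. c 1 a)")
  case True
  then show thesis using that(1,2) by blast
next
  case False
  then obtain a b where ab: "a \<in> A" "b \<in> A" "c 1 a" "\<not> c 1 b" by blast
  show thesis
  proof (cases "a < b")
    case True
    from descending_threshold[OF ab(1,2) True ab(3,4)]
    show thesis by (elim exE bexE) (rule that(4))
  next
    case False
    interpret rev: reflective_cone "\<lambda>n x. c n (- x)" "uminus ` A" by (rule reversed)
    have "a \<noteq> b" using ab by auto
    with False have less: "- a < - b" by simp
    have "c 1 (- (- a))" "\<not> c 1 (- (- b))" using ab by simp_all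
    from rev.descending_threshold[OF imageI[OF ab(1)] imageI[OF ab(2)] less this]
    obtain m t where mt: "t \<in> {0, 1, -1}" "\<forall>j\<in>uminus ` A.
      (j \<le> m - 1 \<longrightarrow> c 1 (- j)) \<and> (j \<ge> m \<longrightarrow> \<not> c 1 (- j)) \<and>
      (- j \<le> - m - t \<longrightarrow> c (- 1) (- (- j))) \<and> (- j \<ge> - m + 1 - t \<longrightarrow> \<not> c (- 1) (- (- j)))" by (elim exE bexE) blast
    show thesis
    proof (rule that(3)[where t = t and m = "- m"])
      show "\<forall>j\<in>A. (j \<ge> - m + 1 \<longrightarrow> c 1 j) \<and> (j \<le> - m \<longrightarrow> \<not> c 1 j) \<and>
        (- j \<ge> - (- m) + t \<longrightarrow> c (- 1) (- j)) \<and> (- j \<le> - (- m) + t - 1 \<longrightarrow> \<not> c (- 1) (- j))"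
      proof
        fix j assume "j \<in> A"
        then have "- j \<in> uminus ` A" by simp
        from mt(2)[rule_format, OF this]
        show "(j \<ge> - m + 1 \<longrightarrow> c 1 j) \<and> (j \<le> - m \<longrightarrow> \<not> c 1 j) \<and>
          (- j \<ge> - (- m) + t \<longrightarrow> c (- 1) (- j)) \<and> (- j \<le> - (- m) + t - 1 \<longrightarrow> \<not> c (- 1) (- j))"
          by (simp add: minus_le_iff le_minus_iff) linarith?
      qed
    qed (fact mt(1))
  qed
qed

section \<open>Reflections from \<open>sl\<^sub>2\<close>-triples\<close>

text \<open>
  \<open>V k\<close> is the space of weight \<open>\<mu> + k\<alpha>\<close>, and \<open>m\<close> is the value of \<open>\<mu>\<close> on the coroot. From \<open>v\<close> go up
  with \<open>e\<close> to a highest vector \<open>w\<close> in some \<open>V k\<close>; the string below \<open>w\<close> is nonzero in exactly \<open>N + 1\<close>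
  places, and the usual formula for \<open>e f\<^sup>j\<^sup>+\<^sup>1 w\<close> gives \<open>m = N - 2k\<close>. The reflected place \<open>-m\<close> lies
  \<open>N - k\<close> steps below \<open>w\<close>, which is inside the string if \<open>m \<ge> 0\<close>.
\<close>

lemma sl2_reflect_half:
  fixes scl :: "complex \<Rightarrow> 'v \<Rightarrow> 'v::ab_group_add"
  assumes "vector_space scl"
    and e: "Vector_Spaces.linear scl scl e" and f: "Vector_Spaces.linear scl scl f"
    and eV: "\<And>k v. v \<in> V k \<Longrightarrow> e v \<in> V (k + 1)" and fV: "\<And>k v. v \<in> V k \<Longrightarrow> f v \<in> V (k - 1)"
    and comm: "\<And>k v. v \<in> V k \<Longrightarrow> e (f v) = f (e v) + scl (m + 2 * of_int k) v"
    and e_nil: "\<And>v. \<exists>n. (e ^^ n) v = 0" and f_nil: "\<And>v. \<exists>n. (f ^^ n) v = 0"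
    and v: "v \<in> V (0::int)" "v \<noteq> 0"
  shows "\<exists>d::int. m = of_int d \<and> (d \<ge> 0 \<longrightarrow> (\<exists>u\<in>V (- d). u \<noteq> 0))"
proof -
  interpret vs: vector_space scl by fact
  interpret e: Vector_Spaces.linear scl scl e by fact
  interpret f: Vector_Spaces.linear scl scl f by fact
  define k where "k = (LEAST n. (e ^^ n) v = 0) - 1"
  have least: "(e ^^ (LEAST n. (e ^^ n) v = 0)) v = 0" using e_nil by (rule LeastI_ex)
  have pos: "(LEAST n. (e ^^ n) v = 0) > 0" using least v by (cases "LEAST n. (e ^^ n) v = 0") auto
  define w where "w = (e ^^ k) v"
  have w0: "w \<noteq> 0" unfolding w_def k_def
    using not_less_Least[of "(LEAST n. (e ^^ n) v = 0) - 1" "\<lambda>n. (e ^^ n) v = 0"] pos by simp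
  have ew: "e w = 0"
  proof -
    have "e w = (e ^^ Suc k) v" by (simp add: w_def)
    then show ?thesis using least pos by (simp add: k_def)
  qed
  have wV: "w \<in> V (int k)"
  proof -
    have "(e ^^ j) v \<in> V (int j)" for j
      by (induction j) (use v eV in \<open>auto simp: add.commute[of 1]\<close>)
    then show ?thesis by (simp add: w_def)
  qed
  define M where "M = m + 2 * of_nat k"
  have uV: "(f ^^ j) w \<in> V (int k - int j)" for j
  proof (induction j)
    case (Suc j)
    then show ?case using fV[OF Suc] by (simp add: algebra_simps)
  qed (use wV in simp)
  have ef: "e ((f ^^ Suc j) w) = scl (of_nat (Suc j) * (M - of_nat j)) ((f ^^ j) w)" for j
  proof (induction j)
    case 0
    show ?case using comm[OF wV] ew by (simp add: M_def f.zero)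
  next
    case (Suc j)
    have "e ((f ^^ Suc (Suc j)) w) = f (e ((f ^^ Suc j) w)) + scl (m + 2 * of_int (int k - int (Suc j))) ((f ^^ Suc j) w)"
      using comm[OF uV[of "Suc j"]] by simp
    also have "\<dots> = scl (of_nat (Suc j) * (M - of_nat j)) ((f ^^ Suc j) w) + scl (m + 2 * of_int (int k - int (Suc j))) ((f ^^ Suc j) w)"
      by (simp only: Suc f.scale) simp
    also have "\<dots> = scl (of_nat (Suc j) * (M - of_nat j) + (m + 2 * of_int (int k - int (Suc j)))) ((f ^^ Suc j) w)"
      by (simp only: vs.scale_left_distrib)
    also have "of_nat (Suc j) * (M - of_nat j) + (m + 2 * of_int (int k - int (Suc j))) = of_nat (Suc (Suc j)) * (M - of_nat (Suc j))"
      by (simp add: M_def algebra_simps)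
    finally show ?case .
  qed
  define N where "N = (LEAST n. (f ^^ n) w = 0) - 1"
  have leastf: "(f ^^ (LEAST n. (f ^^ n) w = 0)) w = 0" using f_nil by (rule LeastI_ex)
  have posf: "(LEAST n. (f ^^ n) w = 0) > 0" using leastf w0 by (cases "LEAST n. (f ^^ n) w = 0") auto
  have N1: "(f ^^ Suc N) w = 0" using leastf posf by (simp add: N_def del: funpow.simps)
  have N0: "(f ^^ j) w \<noteq> 0" if "j \<le> N" for j
    using not_less_Least[of j "\<lambda>n. (f ^^ n) w = 0"] posf that by (auto simp: N_def)
  have "scl (of_nat (Suc N) * (M - of_nat N)) ((f ^^ N) w) = 0"
    using ef[of N] N1 e.zero by simp
  then have "M = of_nat N" using N0[of N] by (simp del: of_nat_Suc)
  then have m: "m = of_int (int N - 2 * int k)" by (simp add: M_def algebra_simps)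
  have "\<exists>u\<in>V (- (int N - 2 * int k)). u \<noteq> 0" if "int N - 2 * int k \<ge> 0"
    using uV[of "N - k"] N0[of "N - k"] that by (auto simp: of_nat_diff algebra_simps)
  then show ?thesis using m by blast
qed

text \<open>
  If \<open>m < 0\<close>, exchange the roles of \<open>e\<close> and \<open>f\<close>.
\<close>

lemma sl2_reflect:
  fixes scl :: "complex \<Rightarrow> 'v \<Rightarrow> 'v::ab_group_add"
  assumes "vector_space scl"
    and e: "Vector_Spaces.linear scl scl e" and f: "Vector_Spaces.linear scl scl f"
    and eV: "\<And>k v. v \<in> V k \<Longrightarrow> e v \<in> V (k + 1)" and fV: "\<And>k v. v \<in> V k \<Longrightarrow> f v \<in> V (k - 1)"
    and comm: "\<And>k v. v \<in> V k \<Longrightarrow> e (f v) = f (e v) + scl (m + 2 * of_int k) v"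
    and e_nil: "\<And>v. \<exists>n. (e ^^ n) v = 0" and f_nil: "\<And>v. \<exists>n. (f ^^ n) v = 0"
    and v: "v \<in> V (0::int)" "v \<noteq> 0"
  shows "\<exists>d::int. m = of_int d \<and> (\<exists>u\<in>V (- d). u \<noteq> 0)"
proof -
  interpret vs: vector_space scl by fact
  obtain d where d: "m = of_int d" "d \<ge> 0 \<longrightarrow> (\<exists>u\<in>V (- d). u \<noteq> 0)"
    using sl2_reflect_half[OF assms] by blast
  show ?thesis
  proof (cases "d \<ge> 0")
    case True
    then show ?thesis using d by blast
  next
    case False
    have "\<exists>d'::int. - m = of_int d' \<and> (d' \<ge> 0 \<longrightarrow> (\<exists>u\<in>V (- (- d')). u \<noteq> 0))"
    proof (rule sl2_reflect_half[where V = "\<lambda>k. V (- k)" and e = f and f = e, OF assms(1) f e])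
      show "f (e w) = e (f w) + scl (- m + 2 * of_int k) w" if "w \<in> V (- k)" for k w
      proof -
        have "scl (- m + 2 * of_int k) w = - scl (m + 2 * of_int (- k)) w"
          by (subst vs.scale_minus_left[symmetric]) simp
        then show ?thesis using comm[OF that] by simp
      qed
      show "f w \<in> V (- (k + 1))" if "w \<in> V (- k)" for k w
        using fV[OF that] by (simp add: minus_diff_commute)
      show "e w \<in> V (- (k - 1))" if "w \<in> V (- k)" for k w
        using eV[OF that] by (simp add: algebra_simps)
    qed (use assms in simp_all)
    then obtain d' :: int where "- m = of_int d'" "d' \<ge> 0 \<longrightarrow> (\<exists>u\<in>V d'. u \<noteq> 0)" by auto
    moreover from this d have "of_int d' = (of_int (- d) :: complex)" by simp
    then have "d' = - d" using of_int_eq_iff by blast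
    ultimately show ?thesis using d False by auto
  qed
qed

section \<open>The matrix superalgebras and their automorphisms, entrywise\<close>

abbreviation "mats T \<equiv> carrier_mat (msize T) (msize T)"
abbreviation "zmat T \<equiv> 0\<^sub>m (msize T) (msize T)"
abbreviation "str T \<equiv> supertrace (size1 T)"
abbreviation "sbr T \<equiv> super_bracket (size1 T)"
abbreviation "fin T \<equiv> fin_superalgebra T"
abbreviation "aff_dual T \<zeta> \<equiv> dual_space (affine T \<zeta>) (cartan T \<zeta>)"
abbreviation "aff_root_space T \<zeta> \<equiv> root_space (affine T \<zeta>) (cartan T \<zeta>)"

fun orthosymplectic :: "affine_type \<Rightarrow> bool" where
  "orthosymplectic (D_type k l) = True"
| "orthosymplectic T = False"

text \<open>
  In the A-types the reversal of both blocks, along which \<open>\<sigma>\<close> transposes; in the D-type the pairing of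
  indices by the two bilinear forms that define \<open>osp\<close>.
\<close>

fun dual_index :: "affine_type \<Rightarrow> nat \<Rightarrow> nat" where
  "dual_index (D_type k l) i =
     (if i < k + 1 then i + (k + 1) else if i < 2 * k + 2 then i - (k + 1)
      else if i < 2 * k + 2 + l then i + l else i - l)"
| "dual_index T i = (if i < size1 T then size1 T - 1 - i else size1 T + msize T - 1 - i)"

fun swap_index :: "affine_type \<Rightarrow> nat \<Rightarrow> nat" where
  "swap_index (D_type k l) i = (if i = k then 2 * k + 1 else if i = 2 * k + 1 then k else i)"
| "swap_index T i = i"

text \<open>
  In the A-types the entry of \<open>J\<^sub>1\<close> or \<open>J\<^sub>2\<close> in row \<open>i\<close>; in the D-type the signs in the matrices of the
  symmetric and of the symplectic form.
\<close>

fun phase :: "affine_type \<Rightarrow> nat \<Rightarrow> complex" where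
  "phase (A_odd_odd k l) i =
     (if i < 2 * k then (if i + 1 \<le> k then (- 1) ^ (i + 2) else (- 1) ^ (i + 1)) else (- 1) ^ (i - 2 * k + 1))"
| "phase (A_even_even k l) i =
     (if i < 2 * k + 1 then (- 1) ^ (i + 1)
      else let r = i - (2 * k + 1) + 1 in
        if r = l + 1 then \<i> else if r \<ge> l + 2 then (- 1) ^ (r + 1) else (- 1) ^ r)"
| "phase (A_even_odd k l) i = (if i < 2 * k + 1 then (- 1) ^ (i + 1) else (- 1) ^ (i - (2 * k + 1) + 1))"
| "phase (D_type k l) i = (if i < 2 * k + 2 + l then 1 else - 1)"

text \<open>
  In the A-types this is \<open>\<sigma>\<close>, and in the D-type its fixed points are the elements of \<open>osp\<close>. So both cases
  reduce to transposition along an involution of the indices, with unimodular factors.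
\<close>

definition twist :: "affine_type \<Rightarrow> complex mat \<Rightarrow> complex mat" where
  "twist T X = mat (msize T) (msize T) (\<lambda>(i, j).
     (if i < size1 T \<and> size1 T \<le> j then 1 else - 1) * phase T i * cnj (phase T j)
       * X $$ (dual_index T j, dual_index T i))"

lemma msize_pos: "admissible T \<Longrightarrow> 0 < size1 T \<and> size1 T < msize T"
  by (cases T) (auto simp: msize_def)

lemma dual_index_less [simp]: "i < msize T \<Longrightarrow> dual_index T i < msize T"
  by (cases T) (auto simp: msize_def)

lemma dual_index_block [simp]: "dual_index T i < size1 T \<longleftrightarrow> i < size1 T" if "i < msize T"
  using that by (cases T) (auto simp: msize_def)

lemma dual_index_dual_index [simp]: "i < msize T \<Longrightarrow> dual_index T (dual_index T i) = i"
  by (cases T) (auto simp: msize_def)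

lemma swap_index_less [simp]: "i < msize T \<Longrightarrow> swap_index T i < msize T"
  by (cases T) (auto simp: msize_def)

lemma swap_index_block [simp]: "swap_index T i < size1 T \<longleftrightarrow> i < size1 T"
  by (cases T) (auto simp: msize_def)

lemma swap_index_swap_index [simp]: "swap_index T (swap_index T i) = i"
  by (cases T) auto

lemma cmod_phase [simp]: "cmod (phase T i) = 1"
  by (cases T) (auto simp: Let_def norm_power)

lemma phase_cnj [simp]: "phase T i * cnj (phase T i) = 1"
  by (simp flip: complex_norm_square)

lemma index_mult_sum:
  assumes "A \<in> carrier_mat nr n" "B \<in> carrier_mat n nc" "i < nr" "j < nc"
  shows "(A * B) $$ (i, j) = (\<Sum>k<n. A $$ (i, k) * B $$ (k, j))"
  using assms by (auto simp: scalar_prod_def lessThan_atLeast0 intro!: sum.cong)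

text \<open>
  Any two-sided inverse is the one computed by Gauss-Jordan elimination.
\<close>

lemma the_mat_inverse:
  fixes A :: "'a::field mat"
  assumes "A \<in> carrier_mat n n" "B \<in> carrier_mat n n" "A * B = 1\<^sub>m n" "B * A = 1\<^sub>m n"
  shows "the (mat_inverse A) = B"
proof -
  have "A \<in> Units (ring_mat TYPE('a) n ())"
    using assms by (auto simp: Units_def ring_mat_def)
  then obtain C where C: "mat_inverse A = Some C"
    using mat_inverse(1)[OF assms(1), of "()"] by (cases "mat_inverse A") auto
  from mat_inverse(2)[OF assms(1) C] have "C * A = 1\<^sub>m n" "C \<in> carrier_mat n n" by auto
  then have "C * (A * B) = B"
    using assms by (subst assoc_mult_mat[symmetric, of _ n n _ n _ n]) auto
  then show ?thesis using C assms \<open>C \<in> carrier_mat n n\<close> by simp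
qed

definition antidiagonal_inverse :: "nat \<Rightarrow> (nat \<Rightarrow> complex) \<Rightarrow> complex mat" where
  "antidiagonal_inverse N f = mat N N (\<lambda>(i, j). if i + j + 1 = N then cnj (f (j + 1)) else 0)"

lemma antidiagonal_carrier [simp]:
  "antidiagonal N f \<in> carrier_mat N N" "antidiagonal_inverse N f \<in> carrier_mat N N"
  "dim_row (antidiagonal N f) = N" "dim_col (antidiagonal N f) = N"
  "dim_row (antidiagonal_inverse N f) = N" "dim_col (antidiagonal_inverse N f) = N"
  by (auto simp: antidiagonal_def antidiagonal_inverse_def)

lemma antidiagonal_mult:
  assumes "M \<in> carrier_mat N nc" "i < N" "j < nc"
  shows "(antidiagonal N f * M) $$ (i, j) = f (i + 1) * M $$ (N - 1 - i, j)"
proof -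
  have "(antidiagonal N f * M) $$ (i, j) = (\<Sum>k<N. antidiagonal N f $$ (i, k) * M $$ (k, j))"
    using assms by (intro index_mult_sum) auto
  also have "\<dots> = (\<Sum>k<N. if k = N - 1 - i then f (i + 1) * M $$ (k, j) else 0)"
    using assms by (intro sum.cong) (auto simp: antidiagonal_def)
  also have "\<dots> = f (i + 1) * M $$ (N - 1 - i, j)"
    using assms by (simp add: sum.delta)
  finally show ?thesis .
qed

lemma mult_antidiagonal_inverse:
  assumes "M \<in> carrier_mat nr N" "i < nr" "j < N"
  shows "(M * antidiagonal_inverse N f) $$ (i, j) = M $$ (i, N - 1 - j) * cnj (f (j + 1))"
proof -
  have "(M * antidiagonal_inverse N f) $$ (i, j) = (\<Sum>k<N. M $$ (i, k) * antidiagonal_inverse N f $$ (k, j))"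
    using assms by (intro index_mult_sum) auto
  also have "\<dots> = (\<Sum>k<N. if k = N - 1 - j then M $$ (i, k) * cnj (f (j + 1)) else 0)"
    using assms by (intro sum.cong) (auto simp: antidiagonal_inverse_def)
  also have "\<dots> = M $$ (i, N - 1 - j) * cnj (f (j + 1))"
    using assms by (simp add: sum.delta)
  finally show ?thesis .
qed

lemma mat_inverse_antidiagonal:
  assumes "\<And>r. cmod (f r) = 1"
  shows "the (mat_inverse (antidiagonal N f)) = antidiagonal_inverse N f"
proof (rule the_mat_inverse)
  have unit: "f r * cnj (f r) = 1" for r
    using assms[of r] by (simp flip: complex_norm_square)
  show "antidiagonal N f * antidiagonal_inverse N f = 1\<^sub>m N"
    by (rule eq_matI) (auto simp: antidiagonal_mult[where nc = N] antidiagonal_inverse_def unit simp del: index_mult_mat(1))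
  show "antidiagonal_inverse N f * antidiagonal N f = 1\<^sub>m N"
  proof (rule eq_matI)
    fix i j assume ij: "i < dim_row (1\<^sub>m N :: complex mat)" "j < dim_col (1\<^sub>m N :: complex mat)"
    have "(antidiagonal_inverse N f * antidiagonal N f) $$ (i, j) =
      (\<Sum>k<N. antidiagonal_inverse N f $$ (i, k) * antidiagonal N f $$ (k, j))"
      using ij by (intro index_mult_sum) auto
    also have "\<dots> = (\<Sum>k<N. if k = N - 1 - i then cnj (f (k + 1)) * (if i = j then f (k + 1) else 0) else 0)"
      using ij by (intro sum.cong) (auto simp: antidiagonal_def antidiagonal_inverse_def)
    also have "\<dots> = 1\<^sub>m N $$ (i, j)"
      using ij unit by (simp add: sum.delta mult.commute)
    finally show "(antidiagonal_inverse N f * antidiagonal N f) $$ (i, j) = 1\<^sub>m N $$ (i, j)" .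
  qed auto
qed auto

lemma twisted_neg_supertranspose_carrier:
  assumes "\<And>r. cmod (f r) = 1" "\<And>r. cmod (g r) = 1"
  shows "twisted_neg_supertranspose (antidiagonal N1 f) (antidiagonal N2 g) X \<in> carrier_mat (N1 + N2) (N1 + N2)"
proof -
  obtain A B C D where split: "split_block X N1 N1 = (A, B, C, D)"
    by (cases "split_block X N1 N1") auto
  show ?thesis
    unfolding twisted_neg_supertranspose_def antidiagonal_carrier split prod.case
      mat_inverse_antidiagonal[of f, OF assms(1)] mat_inverse_antidiagonal[of g, OF assms(2)]
    by (intro four_block_carrier_mat carrier_matI) simp_all
qed

lemma twisted_neg_supertranspose_index:
  assumes "X \<in> carrier_mat (N1 + N2) (N1 + N2)" "\<And>r. cmod (f r) = 1" "\<And>r. cmod (g r) = 1"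
    and "i < N1 + N2" "j < N1 + N2"
  shows "twisted_neg_supertranspose (antidiagonal N1 f) (antidiagonal N2 g) X $$ (i, j) =
    (if i < N1 \<and> N1 \<le> j then 1 else - 1)
      * (if i < N1 then f (i + 1) else g (i - N1 + 1))
      * cnj (if j < N1 then f (j + 1) else g (j - N1 + 1))
      * X $$ (if j < N1 then N1 - 1 - j else N1 + (N1 + N2) - 1 - j,
              if i < N1 then N1 - 1 - i else N1 + (N1 + N2) - 1 - i)"
    (is "?L $$ (i, j) = ?R")
proof -
  obtain A B C D where split: "split_block X N1 N1 = (A, B, C, D)"
    by (cases "split_block X N1 N1") auto
  have car: "A \<in> carrier_mat N1 N1" "B \<in> carrier_mat N1 N2" "C \<in> carrier_mat N2 N1" "D \<in> carrier_mat N2 N2"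
    using split_block[OF split, of N2 N2] assms by auto
  have X: "X = four_block_mat A B C D"
    using split_block[OF split, of N2 N2] assms by auto
  have L: "?L = four_block_mat
      (- (antidiagonal N1 f * A\<^sup>T * antidiagonal_inverse N1 f)) (antidiagonal N1 f * C\<^sup>T * antidiagonal_inverse N2 g)
      (- (antidiagonal N2 g * B\<^sup>T * antidiagonal_inverse N1 f)) (- (antidiagonal N2 g * D\<^sup>T * antidiagonal_inverse N2 g))"
    unfolding twisted_neg_supertranspose_def
    by (simp add: split mat_inverse_antidiagonal assms)
  have prod: "(antidiagonal Na a * M\<^sup>T * antidiagonal_inverse Nb b) $$ (i', j') = a (i' + 1) * M $$ (Nb - 1 - j', Na - 1 - i') * cnj (b (j' + 1))"
    if "M \<in> carrier_mat Nb Na" "i' < Na" "j' < Nb" for Na Nb a b M i' j'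
  proof -
    have "antidiagonal Na a * M\<^sup>T \<in> carrier_mat Na Nb"
      using that by (intro mult_carrier_mat[of _ _ Na]) auto
    then show ?thesis
      using that by (simp add: mult_antidiagonal_inverse[where nr = Na] antidiagonal_mult[where nc = Nb] del: index_mult_mat(1))
  qed
  show "?L $$ (i, j) = ?R"
    unfolding L using assms(4,5) car
    by (auto simp: X prod not_less add.commute[of N2 N1] simp del: index_mult_mat(1))
qed

lemma twisted_neg_supertranspose_eq_twist:
  assumes T: "size1 T = N1" "msize T = N1 + N2" "\<not> orthosymplectic T"
    and unit: "\<And>r. cmod (f r) = 1" "\<And>r. cmod (g r) = 1"
    and phase: "\<And>i. phase T i = (if i < N1 then f (i + 1) else g (i - N1 + 1))"
    and X: "X \<in> carrier_mat (N1 + N2) (N1 + N2)"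
  shows "twisted_neg_supertranspose (antidiagonal N1 f) (antidiagonal N2 g) X = twist T X"
proof (rule eq_matI)
  have dual: "dual_index T i = (if i < N1 then N1 - 1 - i else N1 + (N1 + N2) - 1 - i)" for i
    using T by (cases T) (auto simp: msize_def)
  fix i j assume "i < dim_row (twist T X)" "j < dim_col (twist T X)"
  then have "i < N1 + N2" "j < N1 + N2" by (simp_all add: twist_def T)
  then show "twisted_neg_supertranspose (antidiagonal N1 f) (antidiagonal N2 g) X $$ (i, j) = twist T X $$ (i, j)"
    by (simp only: twisted_neg_supertranspose_index[OF X unit] twist_def T dual phase index_mat split)
qed (use twisted_neg_supertranspose_carrier[of f g N1 N2 X] unit in \<open>auto simp: twist_def T\<close>)

lemma sigma_mat_eq_twist:
  assumes "\<not> orthosymplectic T" "X \<in> mats T"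
  shows "sigma_mat T X = twist T X"
proof (cases T)
  case (A_odd_odd k l)
  show ?thesis
    unfolding A_odd_odd sigma_mat.simps
    by (rule twisted_neg_supertranspose_eq_twist)
      (use assms A_odd_odd in \<open>auto simp: msize_def norm_power\<close>)
next
  case (A_even_even k l)
  show ?thesis
    unfolding A_even_even sigma_mat.simps
    by (rule twisted_neg_supertranspose_eq_twist)
      (use assms A_even_even in \<open>auto simp: msize_def norm_power Let_def\<close>)
next
  case (A_even_odd k l)
  show ?thesis
    unfolding A_even_odd sigma_mat.simps
    by (rule twisted_neg_supertranspose_eq_twist)
      (use assms A_even_odd in \<open>auto simp: msize_def norm_power\<close>)
qed (use assms in simp)

lemma sigma_mat_eq_swap:
  assumes "orthosymplectic T" "X \<in> mats T"
  shows "sigma_mat T X = mat (msize T) (msize T) (\<lambda>(i, j). X $$ (swap_index T i, swap_index T j))"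
proof (cases T)
  case (D_type k l)
  define n where "n = msize T"
  define H where "H = (swaprows_mat n k (2 * k + 1) :: complex mat)"
  have n: "k < n" "2 * k + 1 < n" by (auto simp: n_def D_type msize_def)
  have H: "H \<in> carrier_mat n n" "H * H = 1\<^sub>m n"
    unfolding H_def using swaprows_mat_inv[OF n] by auto
  have H_index: "H $$ (i, j) = (if j = swap_index T i then 1 else 0)" if "i < n" "j < n" for i j
    using that by (auto simp: H_def D_type)
  have H_index': "H $$ (i, j) = (if i = swap_index T j then 1 else 0)" if "i < n" "j < n" for i j
    using that by (auto simp: H_def D_type)
  have X: "X \<in> carrier_mat n n" using assms by (simp add: n_def)
  have left: "(H * X) $$ (i, j) = X $$ (swap_index T i, j)" if "i < n" "j < n" for i j
  proof -
    have "(H * X) $$ (i, j) = (\<Sum>m<n. H $$ (i, m) * X $$ (m, j))"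
      using that by (intro index_mult_sum[OF H(1) X])
    also have "\<dots> = (\<Sum>m<n. if m = swap_index T i then X $$ (m, j) else 0)"
      using that by (intro sum.cong) (auto simp: H_index)
    finally show ?thesis using that by (simp add: sum.delta n_def)
  qed
  have "(H * X * H) $$ (i, j) = X $$ (swap_index T i, swap_index T j)" if "i < n" "j < n" for i j
  proof -
    have "(H * X * H) $$ (i, j) = (\<Sum>m<n. (H * X) $$ (i, m) * H $$ (m, j))"
      using that by (intro index_mult_sum[OF mult_carrier_mat[OF H(1) X] H(1)])
    also have "\<dots> = (\<Sum>m<n. if m = swap_index T j then X $$ (swap_index T i, m) else 0)"
      using that by (intro sum.cong) (auto simp: left H_index' simp del: index_mult_mat(1))
    finally show ?thesis using that by (simp add: sum.delta n_def)
  qed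
  moreover have "sigma_mat T X = H * X * H"
    using the_mat_inverse[OF H(1) H(1) H(2) H(2)] by (simp add: D_type H_def n_def Let_def)
  ultimately show ?thesis
    using H(1) X by (intro eq_matI) (auto simp: n_def simp del: index_mult_mat(1))
qed (use assms in simp_all)

lemma twist_eqD:
  assumes "twist T X = X" "i < msize T" "j < msize T"
  shows "X $$ (i, j) = (if i < size1 T \<and> size1 T \<le> j then 1 else - 1) * phase T i * cnj (phase T j)
    * X $$ (dual_index T j, dual_index T i)"
  by (subst (1) assms(1)[symmetric], unfold twist_def) (use assms in simp)

lemma osp_index_cases:
  fixes i k l :: nat
  assumes "i < 2 * k + 2 + 2 * l"
  obtains i' where "i = i'" "i' < k + 1" | i' where "i = k + 1 + i'" "i' < k + 1"
  | i' where "i = 2 * k + 2 + i'" "i' < l" | i' where "i = 2 * k + 2 + l + i'" "i' < l"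
proof -
  consider "i < k + 1" | "k + 1 \<le> i" "i < 2 * k + 2" | "2 * k + 2 \<le> i" "i < 2 * k + 2 + l" | "2 * k + 2 + l \<le> i"
    by linarith
  then show thesis
  proof cases
    case 1 then show ?thesis using that(1) by simp
  next
    case 2 then show ?thesis using that(2)[of "i - (k + 1)"] by simp
  next
    case 3 then show ?thesis using that(3)[of "i - (2 * k + 2)"] by simp
  next
    case 4 then show ?thesis using that(4)[of "i - (2 * k + 2 + l)"] assms by simp
  qed
qed

lemma osp_super_imp_twist_fixed:
  assumes "X \<in> osp_super (k + 1) l"
  shows "X \<in> carrier_mat (msize (D_type k l)) (msize (D_type k l)) \<and> twist (D_type k l) X = X"
proof -
  obtain x y z m n' p' q' r s u where X: "X = four_block_mat
        (four_block_mat x y z (- x\<^sup>T)) (four_block_mat m n' p' q')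
        (four_block_mat (- q'\<^sup>T) (- n'\<^sup>T) p'\<^sup>T m\<^sup>T) (four_block_mat r s u (- r\<^sup>T))"
    and car: "x \<in> carrier_mat (k + 1) (k + 1)" "y \<in> carrier_mat (k + 1) (k + 1)" "z \<in> carrier_mat (k + 1) (k + 1)"
      "m \<in> carrier_mat (k + 1) l" "n' \<in> carrier_mat (k + 1) l" "p' \<in> carrier_mat (k + 1) l" "q' \<in> carrier_mat (k + 1) l"
      "r \<in> carrier_mat l l" "s \<in> carrier_mat l l" "u \<in> carrier_mat l l"
    and sym: "y\<^sup>T = - y" "z\<^sup>T = - z" "s\<^sup>T = s" "u\<^sup>T = u"
    using assms unfolding osp_super_def by blast
  have y: "y $$ (i, j) = - y $$ (j, i)" if "i < k + 1" "j < k + 1" for i j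
    using arg_cong[OF sym(1), of "\<lambda>M. M $$ (j, i)"] that car by simp
  have z: "z $$ (i, j) = - z $$ (j, i)" if "i < k + 1" "j < k + 1" for i j
    using arg_cong[OF sym(2), of "\<lambda>M. M $$ (j, i)"] that car by simp
  have s: "s $$ (i, j) = s $$ (j, i)" if "i < l" "j < l" for i j
    using arg_cong[OF sym(3), of "\<lambda>M. M $$ (j, i)"] that car by simp
  have u: "u $$ (i, j) = u $$ (j, i)" if "i < l" "j < l" for i j
    using arg_cong[OF sym(4), of "\<lambda>M. M $$ (j, i)"] that car by simp
  have dims: "dim_row x = k + 1" "dim_col x = k + 1" "dim_row y = k + 1" "dim_col y = k + 1"
    "dim_row z = k + 1" "dim_col z = k + 1" "dim_row m = k + 1" "dim_col m = l"
    "dim_row n' = k + 1" "dim_col n' = l" "dim_row p' = k + 1" "dim_col p' = l"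
    "dim_row q' = k + 1" "dim_col q' = l" "dim_row r = l" "dim_col r = l"
    "dim_row s = l" "dim_col s = l" "dim_row u = l" "dim_col u = l"
    using car by auto
  have carX: "X \<in> carrier_mat (2 * k + 2 + 2 * l) (2 * k + 2 + 2 * l)"
    unfolding X carrier_mat_def by (simp add: dims)
  have entry: "twist (D_type k l) X $$ (i, j) = X $$ (i, j)"
    if i: "i < 2 * k + 2 + 2 * l" and j: "j < 2 * k + 2 + 2 * l" for i j
  proof -
    show ?thesis
      using i j
      by (cases rule: osp_index_cases[OF i]; cases rule: osp_index_cases[OF j])
        (auto simp: twist_def msize_def X dims intro: y[symmetric] z[symmetric] s u)
  qed
  show ?thesis
  proof (intro conjI eq_matI)
    show "X \<in> carrier_mat (msize (D_type k l)) (msize (D_type k l))"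
      using carX by (simp add: msize_def)
    show "twist (D_type k l) X $$ (i, j) = X $$ (i, j)" if "i < dim_row X" "j < dim_col X" for i j
      using that carX by (intro entry) auto
  qed (use carX in \<open>simp_all add: twist_def msize_def\<close>)
qed

text \<open>
  The ten blocks in the definition of \<open>osp\<close> are read off from \<open>X\<close>; the symmetry forces the remaining
  entries.
\<close>

lemma twist_fixed_imp_osp_super:
  assumes T: "T = D_type k l" and X: "X \<in> mats T" and fixed: "twist T X = X"
  shows "X \<in> osp_super (k + 1) l"
proof -
  define a where "a = k + 1"
  define P where "P = 2 * k + 2"
  have n: "msize T = P + 2 * l" by (simp add: T msize_def P_def)
  define x where "x = mat a a (\<lambda>(i, j). X $$ (i, j))"
  define y where "y = mat a a (\<lambda>(i, j). X $$ (i, j + a))"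
  define z where "z = mat a a (\<lambda>(i, j). X $$ (i + a, j))"
  define m where "m = mat a l (\<lambda>(i, j). X $$ (i, j + P))"
  define n' where "n' = mat a l (\<lambda>(i, j). X $$ (i, j + P + l))"
  define p' where "p' = mat a l (\<lambda>(i, j). X $$ (i + a, j + P))"
  define q' where "q' = mat a l (\<lambda>(i, j). X $$ (i + a, j + P + l))"
  define r where "r = mat l l (\<lambda>(i, j). X $$ (i + P, j + P))"
  define s where "s = mat l l (\<lambda>(i, j). X $$ (i + P, j + P + l))"
  define u where "u = mat l l (\<lambda>(i, j). X $$ (i + P + l, j + P))"
  note defs = x_def y_def z_def m_def n'_def p'_def q'_def r_def s_def u_def
  have e: "X $$ (i, j) = (if i < P \<and> P \<le> j then 1 else - 1) * phase T i * cnj (phase T j)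
    * X $$ (dual_index T j, dual_index T i)" if "i < P + 2 * l" "j < P + 2 * l" for i j
    using twist_eqD[OF fixed, of i j] that n by (simp add: T P_def)
  have "X = four_block_mat
        (four_block_mat x y z (- x\<^sup>T)) (four_block_mat m n' p' q')
        (four_block_mat (- q'\<^sup>T) (- n'\<^sup>T) p'\<^sup>T m\<^sup>T) (four_block_mat r s u (- r\<^sup>T))" (is "X = ?F")
  proof (rule eq_matI)
    fix i j assume "i < dim_row ?F" "j < dim_col ?F"
    then have i: "i < 2 * k + 2 + 2 * l" and j: "j < 2 * k + 2 + 2 * l"
      by (simp_all add: defs a_def P_def)
    show "X $$ (i, j) = ?F $$ (i, j)"
      using e[of i j] i j
      by (cases rule: osp_index_cases[OF i]; cases rule: osp_index_cases[OF j])
        (auto simp: defs T a_def P_def add.commute add.left_commute)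
  qed (use X n in \<open>auto simp: defs a_def P_def\<close>)
  moreover have "y\<^sup>T = - y"
  proof (rule eq_matI)
    fix i j assume ij: "i < dim_row (- y)" "j < dim_col (- y)"
    then show "y\<^sup>T $$ (i, j) = (- y) $$ (i, j)"
      using e[of j "i + a"] by (auto simp: y_def T a_def P_def)
  qed (auto simp: y_def)
  moreover have "z\<^sup>T = - z"
  proof (rule eq_matI)
    fix i j assume ij: "i < dim_row (- z)" "j < dim_col (- z)"
    then show "z\<^sup>T $$ (i, j) = (- z) $$ (i, j)"
      using e[of "j + a" i] by (auto simp: z_def T a_def P_def)
  qed (auto simp: z_def)
  moreover have "s\<^sup>T = s"
  proof (rule eq_matI)
    fix i j assume ij: "i < dim_row s" "j < dim_col s"
    then show "s\<^sup>T $$ (i, j) = s $$ (i, j)"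
      using e[of "j + P" "i + P + l"] by (auto simp: s_def T a_def P_def)
  qed (auto simp: s_def)
  moreover have "u\<^sup>T = u"
  proof (rule eq_matI)
    fix i j assume ij: "i < dim_row u" "j < dim_col u"
    then show "u\<^sup>T $$ (i, j) = u $$ (i, j)"
      using e[of "j + P + l" "i + P"] by (auto simp: u_def T a_def P_def)
  qed (auto simp: u_def)
  moreover have "x \<in> carrier_mat a a \<and> y \<in> carrier_mat a a \<and> z \<in> carrier_mat a a \<and>
        m \<in> carrier_mat a l \<and> n' \<in> carrier_mat a l \<and> p' \<in> carrier_mat a l \<and> q' \<in> carrier_mat a l \<and>
        r \<in> carrier_mat l l \<and> s \<in> carrier_mat l l \<and> u \<in> carrier_mat l l"
    by (auto simp: defs)
  ultimately show ?thesis
    unfolding osp_super_def a_def[symmetric] by blast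
qed

lemma matrix_set_orthosymplectic:
  assumes "orthosymplectic T"
  shows "matrix_set T = {X \<in> mats T. twist T X = X}"
proof (cases T)
  case (D_type k l)
  then show ?thesis
    using osp_super_imp_twist_fixed[of _ k l] twist_fixed_imp_osp_super[OF D_type]
    by auto
qed (use assms in simp_all)

lemma matrix_set_special_linear:
  "\<not> orthosymplectic T \<Longrightarrow>
    matrix_set T = {X \<in> mats T. str T X = 0}"
  by (cases T) (auto simp: sl_super_def msize_def)

section \<open>Finite root vectors and their superadjoints\<close>

definition mask :: "nat \<Rightarrow> (bool \<Rightarrow> bool \<Rightarrow> bool) \<Rightarrow> complex mat \<Rightarrow> complex mat" where
  "mask p Q X = mat (dim_row X) (dim_col X) (\<lambda>(i, j). if Q (i < p) (j < p) then X $$ (i, j) else 0)"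

text \<open>
  The sign makes this commute with the twist on the odd blocks, and it makes the pairing
  \<open>str (X X\<^sup>*)\<close> positive there.
\<close>

definition superadjoint :: "nat \<Rightarrow> complex mat \<Rightarrow> complex mat" where
  "superadjoint p X =
     mat (dim_col X) (dim_row X) (\<lambda>(i, j). (if i < p \<and> p \<le> j then - 1 else 1) * cnj (X $$ (j, i)))"

definition cartan_mats :: "affine_type \<Rightarrow> complex mat set" where
  "cartan_mats T = {Y \<in> matrix_set T. diagonal_mat Y \<and> sigma_mat T Y = Y}"

text \<open>
  The coefficient of \<open>t\<^sup>a\<close> in a root vector, for \<open>z = \<zeta>\<^sup>a\<close>; \<open>w\<close> is the restriction of the root to the
  finite part of the Cartan subalgebra. The zero diagonal singles out a representative modulo
  scalar matrices.
\<close>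

definition fin_root_vector :: "affine_type \<Rightarrow> complex \<Rightarrow> (complex mat \<Rightarrow> complex) \<Rightarrow> complex mat \<Rightarrow> bool" where
  "fin_root_vector T z w X \<longleftrightarrow> X \<in> matrix_set T \<and> sigma_mat T X = z \<cdot>\<^sub>m X \<and>
     (\<forall>i<msize T. X $$ (i, i) = 0) \<and>
     (\<forall>Y\<in>cartan_mats T. \<forall>i<msize T. \<forall>j<msize T. (Y $$ (i, i) - Y $$ (j, j)) * X $$ (i, j) = w Y * X $$ (i, j))"

definition homogeneous :: "affine_type \<Rightarrow> nat \<Rightarrow> complex mat \<Rightarrow> bool" where
  "homogeneous T i X \<longleftrightarrow>
     (if i = 0 then odd_part (size1 T) X = zmat T else even_part (size1 T) X = zmat T)"

lemma sum_dual_index: "(\<Sum>i<msize T. f (dual_index T i)) = (\<Sum>i<msize T. f i)"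
  by (rule sum.reindex_bij_witness[of _ "dual_index T" "dual_index T"]) auto

lemma sum_swap_index: "(\<Sum>i<msize T. f (swap_index T i)) = (\<Sum>i<msize T. f i)"
  by (rule sum.reindex_bij_witness[of _ "swap_index T" "swap_index T"]) auto

lemma index_block_le [simp]:
  "i < msize T \<Longrightarrow> size1 T \<le> dual_index T i \<longleftrightarrow> size1 T \<le> i"
  "size1 T \<le> swap_index T i \<longleftrightarrow> size1 T \<le> i"
  using dual_index_block[of i T] swap_index_block[of T i] by linarith+

lemma twist_carrier [simp]: "twist T X \<in> mats T"
  "dim_row (twist T X) = msize T" "dim_col (twist T X) = msize T"
  by (simp_all add: twist_def)

lemma matrix_set_carrier: "X \<in> matrix_set T \<Longrightarrow> X \<in> mats T"
  using matrix_set_orthosymplectic[of T] matrix_set_special_linear[of T] by blast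

lemma sigma_mat_carrier:
  "X \<in> mats T \<Longrightarrow> sigma_mat T X \<in> mats T"
  using sigma_mat_eq_swap[of T X] sigma_mat_eq_twist[of T X] by (cases "orthosymplectic T") auto

lemma swap_index_special_linear [simp]: "\<not> orthosymplectic T \<Longrightarrow> swap_index T i = i"
  by (cases T) auto

lemma phase_mult_cnj: "phase T i * (cnj (phase T i) * x) = x"
  using phase_cnj[of T i] by (simp flip: mult.assoc)

text \<open>
  The entries at dual indices lie in the same block and cancel.
\<close>

lemma supertrace_antisymmetric:
  assumes "X \<in> mats T"
    and anti: "\<And>i. i < msize T \<Longrightarrow> X $$ (dual_index T i, dual_index T i) = - X $$ (i, i)"
  shows "str T X = 0"
proof -
  let ?f = "\<lambda>i. if i < size1 T then X $$ (i, i) else - X $$ (i, i)"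
  have "(\<Sum>i<msize T. ?f i) = (\<Sum>i<msize T. ?f (dual_index T i))"
    by (rule sum_dual_index[symmetric])
  also have "\<dots> = - (\<Sum>i<msize T. ?f i)"
    unfolding sum_negf[symmetric] by (intro sum.cong) (auto simp: anti)
  finally show ?thesis using assms(1) by (simp add: supertrace_def)
qed

lemma twist_fixed_diagonal:
  assumes "twist T X = X" "i < msize T"
  shows "X $$ (dual_index T i, dual_index T i) = - X $$ (i, i)"
  using twist_eqD[OF assms(1,2,2)] by auto

lemma supertrace_matrix_set: "X \<in> matrix_set T \<Longrightarrow> str T X = 0"
  using matrix_set_orthosymplectic[of T] matrix_set_special_linear[of T]
  by (cases "orthosymplectic T") (auto intro: supertrace_antisymmetric twist_fixed_diagonal)

lemma matrix_setI:
  assumes "X \<in> mats T" "orthosymplectic T \<Longrightarrow> twist T X = X"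
    and "str T X = 0"
  shows "X \<in> matrix_set T"
  using assms matrix_set_orthosymplectic[of T] matrix_set_special_linear[of T]
  by (cases "orthosymplectic T") auto

lemma supertrace_zero_diagonal:
  "(\<And>i. i < dim_row X \<Longrightarrow> X $$ (i, i) = 0) \<Longrightarrow> supertrace p X = 0"
  by (auto simp: supertrace_def intro!: sum.neutral)

lemma mask_carrier [simp]: "X \<in> carrier_mat n n \<Longrightarrow> mask p Q X \<in> carrier_mat n n"
  by (simp add: mask_def)

lemma superadjoint_carrier [simp]: "X \<in> carrier_mat n n \<Longrightarrow> superadjoint p X \<in> carrier_mat n n"
  by (simp add: superadjoint_def)

lemma twist_mask:
  assumes "X \<in> mats T" "\<And>a b. Q a b = Q b a"
  shows "twist T (mask (size1 T) Q X) = mask (size1 T) Q (twist T X)"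
  using assms by (intro eq_matI) (auto simp: twist_def mask_def)

lemma sigma_mask:
  assumes X: "X \<in> mats T" and Q: "\<And>a b. Q a b = Q b a"
  shows "sigma_mat T (mask (size1 T) Q X) = mask (size1 T) Q (sigma_mat T X)"
proof (cases "orthosymplectic T")
  case True
  show ?thesis
    using X unfolding sigma_mat_eq_swap[OF True X] sigma_mat_eq_swap[OF True mask_carrier[OF X]]
    by (intro eq_matI) (auto simp: mask_def)
next
  case False
  show ?thesis
    using X False by (simp add: sigma_mat_eq_twist twist_mask[OF X Q])
qed

lemma twist_superadjoint:
  assumes X: "X \<in> mats T"
  shows "twist T (superadjoint (size1 T) X) = superadjoint (size1 T) (twist T X)"
  using assms by (intro eq_matI) (auto simp: twist_def superadjoint_def)

lemma sigma_superadjoint: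
  assumes X: "X \<in> mats T"
  shows "sigma_mat T (superadjoint (size1 T) X) = superadjoint (size1 T) (sigma_mat T X)"
proof (cases "orthosymplectic T")
  case True
  show ?thesis
    using X unfolding sigma_mat_eq_swap[OF True X] sigma_mat_eq_swap[OF True superadjoint_carrier[OF X]]
    by (intro eq_matI) (auto simp: superadjoint_def not_less[symmetric] simp del: not_less)
next
  case False
  show ?thesis
    using X False by (simp add: sigma_mat_eq_twist twist_superadjoint[OF X])
qed

text \<open>
  In all types the diagonal matrices fixed by \<open>\<sigma>\<close> are described by the same two symmetries. In the A-types
  the swap is trivial and vanishing of the supertrace is automatic; in the D-type the first symmetry
  is membership in \<open>osp\<close>.
\<close>

lemma cartan_mats_iff:
  "Y \<in> cartan_mats T \<longleftrightarrow> Y \<in> mats T \<and> diagonal_mat Y \<and>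
     (\<forall>i<msize T. Y $$ (dual_index T i, dual_index T i) = - Y $$ (i, i) \<and>
       Y $$ (swap_index T i, swap_index T i) = Y $$ (i, i))" (is "_ \<longleftrightarrow> ?R")
proof -
  have twist: "twist T Y = Y \<longleftrightarrow> (\<forall>i<msize T. Y $$ (dual_index T i, dual_index T i) = - Y $$ (i, i))"
    if Y: "Y \<in> mats T" "diagonal_mat Y"
  proof
    assume "twist T Y = Y"
    then show "\<forall>i<msize T. Y $$ (dual_index T i, dual_index T i) = - Y $$ (i, i)"
      using twist_fixed_diagonal by blast
  next
    assume R: "\<forall>i<msize T. Y $$ (dual_index T i, dual_index T i) = - Y $$ (i, i)"
    have "twist T Y $$ (i, j) = Y $$ (i, j)" if ij: "i < msize T" "j < msize T" for i j
    proof (cases "i = j")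
      case True
      then show ?thesis using R ij by (auto simp: twist_def)
    next
      case False
      then have "dual_index T j \<noteq> dual_index T i"
        using ij dual_index_dual_index by metis
      then show ?thesis using False Y ij by (auto simp: twist_def diagonal_mat_def)
    qed
    then show "twist T Y = Y" using Y by (intro eq_matI) auto
  qed
  have swap: "sigma_mat T Y = Y \<longleftrightarrow> (\<forall>i<msize T. Y $$ (swap_index T i, swap_index T i) = Y $$ (i, i))"
    if Y: "Y \<in> mats T" "diagonal_mat Y" and T: "orthosymplectic T"
  proof
    assume "sigma_mat T Y = Y"
    then show "\<forall>i<msize T. Y $$ (swap_index T i, swap_index T i) = Y $$ (i, i)"
      using sigma_mat_eq_swap[OF T Y(1)] by (metis (no_types, lifting) index_mat(1) case_prod_conv)
  next
    assume R: "\<forall>i<msize T. Y $$ (swap_index T i, swap_index T i) = Y $$ (i, i)"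
    have "Y $$ (swap_index T i, swap_index T j) = Y $$ (i, j)" if ij: "i < msize T" "j < msize T" for i j
    proof (cases "i = j")
      case False
      then have "swap_index T i \<noteq> swap_index T j"
        using swap_index_swap_index by metis
      then show ?thesis using False Y ij by (auto simp: diagonal_mat_def)
    qed (use R ij in simp)
    then show "sigma_mat T Y = Y" unfolding sigma_mat_eq_swap[OF T Y(1)]
      using Y by (intro eq_matI) auto
  qed
  show ?thesis
  proof (cases "orthosymplectic T")
    case True
    then show ?thesis
      using twist swap by (auto simp: cartan_mats_def matrix_set_orthosymplectic)
  next
    case False
    then show ?thesis
      using twist by (auto simp: cartan_mats_def matrix_set_special_linear sigma_mat_eq_twist supertrace_antisymmetric)
  qed
qed

text \<open>
  Cutting out blocks symmetrically commutes with \<open>\<sigma>\<close>. Membership in \<open>sl\<close> is not lost because the diagonal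
  is zero.
\<close>

lemma fin_root_vector_mask:
  assumes X: "fin_root_vector T z w X" and Q: "\<And>a b. Q a b = Q b a"
  shows "fin_root_vector T z w (mask (size1 T) Q X)"
proof -
  have car: "X \<in> mats T"
    using X matrix_set_carrier by (auto simp: fin_root_vector_def)
  have "mask (size1 T) Q X \<in> matrix_set T"
  proof (rule matrix_setI)
    show "twist T (mask (size1 T) Q X) = mask (size1 T) Q X" if "orthosymplectic T"
      using X that by (simp add: twist_mask[OF car Q] fin_root_vector_def matrix_set_orthosymplectic)
    show "str T (mask (size1 T) Q X) = 0"
      using X car by (intro supertrace_zero_diagonal) (auto simp: mask_def fin_root_vector_def)
  qed (use car in simp)
  moreover have "sigma_mat T (mask (size1 T) Q X) = z \<cdot>\<^sub>m mask (size1 T) Q X"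
  proof -
    have "sigma_mat T (mask (size1 T) Q X) = mask (size1 T) Q (z \<cdot>\<^sub>m X)"
      using X by (simp add: sigma_mask[OF car Q] fin_root_vector_def)
    then show ?thesis by (auto simp: mask_def intro!: eq_matI)
  qed
  ultimately show ?thesis
    using X car unfolding fin_root_vector_def by (auto simp: mask_def)
qed

lemma fin_root_vector_superadjoint:
  assumes X: "fin_root_vector T z w X"
  shows "fin_root_vector T (cnj z) (\<lambda>Y. - w Y) (superadjoint (size1 T) X)"
proof -
  have car: "X \<in> mats T"
    using X matrix_set_carrier by (auto simp: fin_root_vector_def)
  have "superadjoint (size1 T) X \<in> matrix_set T"
  proof (rule matrix_setI)
    show "twist T (superadjoint (size1 T) X) = superadjoint (size1 T) X" if "orthosymplectic T"
      using X that by (simp add: twist_superadjoint[OF car] fin_root_vector_def matrix_set_orthosymplectic)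
    show "str T (superadjoint (size1 T) X) = 0"
      using X car by (intro supertrace_zero_diagonal) (auto simp: superadjoint_def fin_root_vector_def)
  qed (use car in simp)
  moreover have "sigma_mat T (superadjoint (size1 T) X) = cnj z \<cdot>\<^sub>m superadjoint (size1 T) X"
  proof -
    have "sigma_mat T (superadjoint (size1 T) X) = superadjoint (size1 T) (z \<cdot>\<^sub>m X)"
      using X by (simp add: sigma_superadjoint[OF car] fin_root_vector_def)
    then show ?thesis using car by (auto simp: superadjoint_def intro!: eq_matI)
  qed
  moreover have "(Y $$ (i, i) - Y $$ (j, j)) * superadjoint (size1 T) X $$ (i, j) = - w Y * superadjoint (size1 T) X $$ (i, j)"
    if "Y \<in> cartan_mats T" "i < msize T" "j < msize T" for Y i j
  proof (cases "X $$ (j, i) = 0")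
    case True
    then show ?thesis using car that by (simp add: superadjoint_def)
  next
    case False
    then have "Y $$ (j, j) - Y $$ (i, i) = w Y"
      using X that unfolding fin_root_vector_def by auto
    then have "Y $$ (i, i) - Y $$ (j, j) = - w Y" by (simp add: algebra_simps)
    then show ?thesis by simp
  qed
  ultimately show ?thesis
    using X car unfolding fin_root_vector_def by (auto simp: superadjoint_def)
qed

text \<open>
  Since \<open>\<sigma>\<close> multiplies \<open>X\<close> by a scalar of modulus one and all phases are unimodular, the absolute values of
  the entries have the symmetries of the index maps.
\<close>

lemma cmod_fin_root_vector:
  assumes X: "fin_root_vector T z w X" and z: "cmod z = 1" and ij: "i < msize T" "j < msize T"
  shows "cmod (X $$ (dual_index T j, dual_index T i)) = cmod (X $$ (i, j))"
    and "cmod (X $$ (swap_index T i, swap_index T j)) = cmod (X $$ (i, j))"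
proof -
  have X': "X \<in> matrix_set T" "X \<in> mats T" "sigma_mat T X = z \<cdot>\<^sub>m X"
    using X matrix_set_carrier by (auto simp: fin_root_vector_def)
  have twist: "cmod (twist T X $$ (i, j)) = cmod (X $$ (dual_index T j, dual_index T i))"
    using ij by (simp add: twist_def norm_mult)
  have sigma: "cmod (sigma_mat T X $$ (i, j)) = cmod (X $$ (i, j))"
    using ij X' z by (simp add: norm_mult)
  show "cmod (X $$ (dual_index T j, dual_index T i)) = cmod (X $$ (i, j))"
    using twist sigma X' by (cases "orthosymplectic T") (auto simp: matrix_set_orthosymplectic sigma_mat_eq_twist)
  show "cmod (X $$ (swap_index T i, swap_index T j)) = cmod (X $$ (i, j))"
  proof (cases "orthosymplectic T")
    case True
    have "sigma_mat T X $$ (i, j) = X $$ (swap_index T i, swap_index T j)"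
      using X'(2) ij True by (simp add: sigma_mat_eq_swap)
    then show ?thesis using sigma by simp
  qed simp
qed

lemma coroot_cartan:
  assumes "i < msize T" "dual_index T i \<noteq> i" "swap_index T i = i" "swap_index T (dual_index T i) = dual_index T i"
  shows "mat (msize T) (msize T) (\<lambda>(r, c). if r = c then if r = i then 1 else if r = dual_index T i then - 1 else 0 else 0)
    \<in> cartan_mats T"
proof -
  have "dual_index T r = i \<longleftrightarrow> r = dual_index T i" "dual_index T r = dual_index T i \<longleftrightarrow> r = i" if "r < msize T" for r
    using that assms(1) dual_index_dual_index by metis+
  moreover have "swap_index T r = i \<longleftrightarrow> r = i" "swap_index T r = dual_index T i \<longleftrightarrow> r = dual_index T i" for r
    using assms(3,4) swap_index_swap_index by metis+
  ultimately show ?thesis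
    using assms by (auto simp: cartan_mats_iff diagonal_mat_def)
qed

text \<open>
  Coroots separate all indices of a block except the two that the swap in the D-type exchanges: there
  both coordinates vanish on the Cartan subalgebra. In the A-types an index fixed by duality is the
  middle of its block, so a block contains at most one.
\<close>

lemma cartan_separates:
  assumes ij: "i < msize T" "j < msize T" "i \<noteq> j" "i < size1 T \<longleftrightarrow> j < size1 T"
    and eq: "\<And>Y. Y \<in> cartan_mats T \<Longrightarrow> Y $$ (i, i) = Y $$ (j, j)"
  shows "orthosymplectic T \<and> j = dual_index T i \<and> i < size1 T"
proof -
  let ?good = "\<lambda>i. dual_index T i \<noteq> i \<and> swap_index T i = i \<and> swap_index T (dual_index T i) = dual_index T i"
  have "\<not> ?good i"
    using eq[OF coroot_cartan[of i T]] ij by (auto split: if_splits)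
  moreover have "\<not> ?good j"
    using eq[OF coroot_cartan[of j T]] ij by (auto split: if_splits)
  ultimately show ?thesis
    using ij by (cases T) (auto simp: msize_def split: if_splits)
qed

lemma super_bracket_index:
  assumes X: "X \<in> carrier_mat n n" and Y: "Y \<in> carrier_mat n n" and ij: "i < n" "j < n"
  shows "super_bracket p X Y $$ (i, j) = (\<Sum>k<n. X $$ (i, k) * Y $$ (k, j)
    - (if (i < p) \<noteq> (k < p) \<and> (k < p) \<noteq> (j < p) then - 1 else 1) * (Y $$ (i, k) * X $$ (k, j)))"
proof -
  have car: "even_part p X \<in> carrier_mat n n" "odd_part p X \<in> carrier_mat n n"
    "even_part p Y \<in> carrier_mat n n" "odd_part p Y \<in> carrier_mat n n"
    using X Y by (auto simp: even_part_def odd_part_def)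
  have "super_bracket p X Y $$ (i, j) = (X * Y) $$ (i, j) -
     ((even_part p Y * X) $$ (i, j) + (odd_part p Y * even_part p X) $$ (i, j) - (odd_part p Y * odd_part p X) $$ (i, j))"
    using X Y car ij unfolding super_bracket_def by (simp del: index_mult_mat(1))
  also have "\<dots> = (\<Sum>k<n. X $$ (i, k) * Y $$ (k, j) - (even_part p Y $$ (i, k) * X $$ (k, j)
      + odd_part p Y $$ (i, k) * even_part p X $$ (k, j) - odd_part p Y $$ (i, k) * odd_part p X $$ (k, j)))"
    using index_mult_sum[OF X Y ij] index_mult_sum[OF car(3) X ij] index_mult_sum[OF car(4) car(1) ij]
      index_mult_sum[OF car(4) car(2) ij]
    by (simp add: sum.distrib sum_subtractf del: index_mult_mat(1))
  also have "\<dots> = (\<Sum>k<n. X $$ (i, k) * Y $$ (k, j)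
    - (if (i < p) \<noteq> (k < p) \<and> (k < p) \<noteq> (j < p) then - 1 else 1) * (Y $$ (i, k) * X $$ (k, j)))"
    using X Y ij by (intro sum.cong) (auto simp: even_part_def odd_part_def)
  finally show ?thesis .
qed

lemma super_bracket_carrier [simp]:
  "X \<in> carrier_mat n n \<Longrightarrow> Y \<in> carrier_mat n n \<Longrightarrow> super_bracket p X Y \<in> carrier_mat n n"
  by (auto simp: super_bracket_def even_part_def odd_part_def)

lemma cnj_mult_cmod: "x * cnj x = of_real ((cmod x)\<^sup>2)"
  using complex_norm_square[of x] by simp

text \<open>
  The sign of the superadjoint and the sign in the superbracket combine to one sign per entry, which is
  symmetric after multiplication by the sign in the supertrace.
\<close>

lemma bracket_superadjoint_diagonal:
  assumes Z: "Z \<in> carrier_mat n n" and i: "i < n"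
  shows "super_bracket p Z (superadjoint p Z) $$ (i, i) = (\<Sum>k<n. of_real
    ((if k < p \<and> p \<le> i then - 1 else 1) * ((cmod (Z $$ (i, k)))\<^sup>2 - (cmod (Z $$ (k, i)))\<^sup>2)))"
  unfolding super_bracket_index[OF Z superadjoint_carrier[OF Z] i i]
  using Z i by (intro sum.cong refl)
    (auto simp: superadjoint_def cnj_mult_cmod mult.commute[of "cnj _"] not_less)

lemma supertrace_superadjoint:
  assumes Z: "Z \<in> carrier_mat n n"
  shows "supertrace p (Z * superadjoint p Z) =
    (\<Sum>i<n. \<Sum>k<n. of_real ((if p \<le> i \<and> p \<le> k then - 1 else 1) * (cmod (Z $$ (i, k)))\<^sup>2))"
proof -
  have "(Z * superadjoint p Z) $$ (i, i) = (\<Sum>k<n. Z $$ (i, k) * superadjoint p Z $$ (k, i))" if "i < n" for i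
    using index_mult_sum[OF Z superadjoint_carrier[OF Z] that that] .
  then have "supertrace p (Z * superadjoint p Z) =
      (\<Sum>i<n. if i < p then \<Sum>k<n. Z $$ (i, k) * superadjoint p Z $$ (k, i)
         else - (\<Sum>k<n. Z $$ (i, k) * superadjoint p Z $$ (k, i)))"
    using Z unfolding supertrace_def by (intro sum.cong) auto
  also have "\<dots> = (\<Sum>i<n. \<Sum>k<n. of_real ((if p \<le> i \<and> p \<le> k then - 1 else 1) * (cmod (Z $$ (i, k)))\<^sup>2))"
    using Z by (intro sum.cong refl) 
      (auto simp: superadjoint_def cnj_mult_cmod not_less sum_negf[symmetric] intro!: sum.cong)
  finally show ?thesis .
qed

lemma supertrace_mult_diagonal:
  assumes "W \<in> carrier_mat n n" "Y \<in> carrier_mat n n" "diagonal_mat Y"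
  shows "supertrace p (W * Y) = (\<Sum>i<n. (if i < p then 1 else - 1) * (W $$ (i, i) * Y $$ (i, i)))"
proof -
  have "(W * Y) $$ (i, i) = W $$ (i, i) * Y $$ (i, i)" if "i < n" for i
  proof -
    have "(W * Y) $$ (i, i) = (\<Sum>k<n. W $$ (i, k) * Y $$ (k, i))"
      by (rule index_mult_sum[OF assms(1,2) that that])
    also have "\<dots> = (\<Sum>k<n. if k = i then W $$ (i, i) * Y $$ (i, i) else 0)"
      using assms that by (intro sum.cong) (auto simp: diagonal_mat_def)
    finally show ?thesis using that by (simp add: sum.delta)
  qed
  then show ?thesis
    using assms unfolding supertrace_def by (intro sum.cong) (auto simp del: index_mult_mat(1))
qed

text \<open>
  This is invariance of the supertrace form, \<open>str ([Z, Z\<^sup>*] Y) = str ([Y, Z] Z\<^sup>*)\<close>, computed on entries.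
\<close>

lemma supertrace_bracket_superadjoint:
  assumes Z: "Z \<in> carrier_mat n n" and Y: "Y \<in> carrier_mat n n" "diagonal_mat Y"
    and weight: "\<And>i j. i < n \<Longrightarrow> j < n \<Longrightarrow> (Y $$ (i, i) - Y $$ (j, j)) * Z $$ (i, j) = w * Z $$ (i, j)"
  shows "supertrace p (super_bracket p Z (superadjoint p Z) * Y) = w * supertrace p (Z * superadjoint p Z)"
proof -
  define q :: "nat \<Rightarrow> nat \<Rightarrow> complex" where "q i k = (if p \<le> i \<and> p \<le> k then - 1 else 1)" for i k
  define N :: "nat \<Rightarrow> nat \<Rightarrow> complex" where "N i k = of_real ((cmod (Z $$ (i, k)))\<^sup>2)" for i k
  have N: "(Y $$ (i, i) - Y $$ (k, k)) * N i k = w * N i k" if "i < n" "k < n" for i k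
    using weight[OF that] by (cases "Z $$ (i, k) = 0") (auto simp: N_def)
  have "supertrace p (super_bracket p Z (superadjoint p Z) * Y) =
      (\<Sum>i<n. (if i < p then 1 else - 1) * (super_bracket p Z (superadjoint p Z) $$ (i, i) * Y $$ (i, i)))"
    using Z by (intro supertrace_mult_diagonal Y) simp
  also have "\<dots> = (\<Sum>i<n. \<Sum>k<n. q i k * (N i k - N k i) * Y $$ (i, i))"
  proof (intro sum.cong refl)
    fix i assume "i \<in> {..<n}"
    then have i: "i < n" by simp
    show "(if i < p then 1 else - 1) * (super_bracket p Z (superadjoint p Z) $$ (i, i) * Y $$ (i, i)) =
      (\<Sum>k<n. q i k * (N i k - N k i) * Y $$ (i, i))"
      unfolding bracket_superadjoint_diagonal[OF Z i] sum_distrib_right sum_distrib_left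
      by (intro sum.cong) (auto simp: q_def N_def algebra_simps)
  qed
  also have "\<dots> = (\<Sum>i<n. \<Sum>k<n. q i k * N i k * Y $$ (i, i)) - (\<Sum>i<n. \<Sum>k<n. q i k * N k i * Y $$ (i, i))"
    by (simp add: algebra_simps sum_subtractf)
  also have "(\<Sum>i<n. \<Sum>k<n. q i k * N k i * Y $$ (i, i)) = (\<Sum>i<n. \<Sum>k<n. q i k * N i k * Y $$ (k, k))"
    by (subst sum.swap) (simp add: q_def conj_commute)
  also have "(\<Sum>i<n. \<Sum>k<n. q i k * N i k * Y $$ (i, i)) - (\<Sum>i<n. \<Sum>k<n. q i k * N i k * Y $$ (k, k))
      = (\<Sum>i<n. \<Sum>k<n. q i k * ((Y $$ (i, i) - Y $$ (k, k)) * N i k))"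
    by (simp add: algebra_simps sum_subtractf)
  also have "\<dots> = w * (\<Sum>i<n. \<Sum>k<n. q i k * N i k)"
    unfolding sum_distrib_left by (intro sum.cong refl) (simp add: N)
  also have "(\<Sum>i<n. \<Sum>k<n. q i k * N i k) = supertrace p (Z * superadjoint p Z)"
    unfolding supertrace_superadjoint[OF Z] by (auto simp: q_def N_def intro!: sum.cong)
  finally show ?thesis .
qed

text \<open>
  The lower right block contributes negatively to \<open>str (Z Z\<^sup>*)\<close>, everything else positively.
\<close>

lemma supertrace_superadjoint_nonzero:
  assumes Z: "Z \<in> carrier_mat n n" "Z \<noteq> 0\<^sub>m n n"
    and Q: "(\<forall>i<n. \<forall>j<n. Z $$ (i, j) \<noteq> 0 \<longrightarrow> p \<le> i \<and> p \<le> j) \<or> (\<forall>i<n. \<forall>j<n. Z $$ (i, j) \<noteq> 0 \<longrightarrow> i < p \<or> j < p)"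
  shows "supertrace p (Z * superadjoint p Z) \<noteq> 0"
proof -
  define N where "N = (\<Sum>i<n. \<Sum>k<n. (cmod (Z $$ (i, k)))\<^sup>2)"
  have "N \<noteq> 0"
  proof
    assume "N = 0"
    then have "\<forall>i<n. \<forall>k<n. Z $$ (i, k) = 0"
      by (simp add: N_def sum_nonneg_eq_0_iff sum_nonneg)
    then show False using Z by auto
  qed
  from Q have "supertrace p (Z * superadjoint p Z) = of_real N \<or> supertrace p (Z * superadjoint p Z) = - of_real N"
  proof
    assume Q: "\<forall>i<n. \<forall>j<n. Z $$ (i, j) \<noteq> 0 \<longrightarrow> p \<le> i \<and> p \<le> j"
    then have "supertrace p (Z * superadjoint p Z) = - of_real N"
      unfolding supertrace_superadjoint[OF Z(1)] N_def of_real_sum sum_negf[symmetric]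
      by (intro sum.cong refl) auto
    then show ?thesis ..
  next
    assume Q: "\<forall>i<n. \<forall>j<n. Z $$ (i, j) \<noteq> 0 \<longrightarrow> i < p \<or> j < p"
    then have "Z $$ (i, j) = 0" if "i < n" "j < n" "p \<le> i" "p \<le> j" for i j
      using that by (meson not_less)
    then have "supertrace p (Z * superadjoint p Z) = of_real N"
      unfolding supertrace_superadjoint[OF Z(1)] N_def of_real_sum
      by (intro sum.cong refl) auto
    then show ?thesis ..
  qed
  then show ?thesis using \<open>N \<noteq> 0\<close> by auto
qed

text \<open>
  The bracket has weight zero and, as \<open>Z\<close> is homogeneous, it is even. So an off-diagonal entry can be
  nonzero only where \<open>cartan_separates\<close> fails, namely at dual indices in the D-type; there it
  vanishes by the skew symmetry in \<open>osp\<close>. The symmetries of the diagonal are those of the absolute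
  values of the entries of \<open>Z\<close>.
\<close>

lemma bracket_superadjoint_cartan:
  assumes Z: "fin_root_vector T z w Z" and z: "cmod z = 1"
    and hom: "(\<forall>i<msize T. \<forall>j<msize T. Z $$ (i, j) \<noteq> 0 \<longrightarrow> (i < size1 T \<longleftrightarrow> j < size1 T)) \<or>
      (\<forall>i<msize T. \<forall>j<msize T. Z $$ (i, j) \<noteq> 0 \<longrightarrow> (i < size1 T \<longleftrightarrow> \<not> j < size1 T))"
  shows "sbr T Z (superadjoint (size1 T) Z) \<in> cartan_mats T"
proof -
  define n p where "n = msize T" and "p = size1 T"
  define W where "W = super_bracket p Z (superadjoint p Z)"
  have Z': "Z \<in> carrier_mat n n" "Z \<in> matrix_set T"
    using Z matrix_set_carrier by (auto simp: fin_root_vector_def n_def)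
  have W: "W \<in> carrier_mat n n" using Z' by (simp add: W_def)
  have "W $$ (i, j) = 0" if ij: "i < n" "j < n" "i \<noteq> j" for i j
  proof (rule ccontr)
    assume nz: "W $$ (i, j) \<noteq> 0"
    have sum: "W $$ (i, j) = (\<Sum>k<n. Z $$ (i, k) * superadjoint p Z $$ (k, j)
      - (if (i < p) \<noteq> (k < p) \<and> (k < p) \<noteq> (j < p) then - 1 else 1) * (superadjoint p Z $$ (i, k) * Z $$ (k, j)))"
      unfolding W_def by (rule super_bracket_index) (use Z' ij in auto)
    with nz obtain k where k: "k < n" "Z $$ (i, k) * superadjoint p Z $$ (k, j)
      - (if (i < p) \<noteq> (k < p) \<and> (k < p) \<noteq> (j < p) then - 1 else 1) * (superadjoint p Z $$ (i, k) * Z $$ (k, j)) \<noteq> 0"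
      by (metis (no_types, lifting) lessThan_iff sum.neutral)
    then have support: "Z $$ (i, k) \<noteq> 0 \<and> Z $$ (j, k) \<noteq> 0 \<or> Z $$ (k, i) \<noteq> 0 \<and> Z $$ (k, j) \<noteq> 0"
      using ij Z' by (auto simp: superadjoint_def split: if_splits)
    moreover from this have block: "i < p \<longleftrightarrow> j < p"
      using hom ij k(1) unfolding n_def p_def by blast
    moreover have "Y $$ (i, i) = Y $$ (j, j)" if "Y \<in> cartan_mats T" for Y
    proof -
      have weight: "Y $$ (a, a) - Y $$ (b, b) = w Y" if "a < n" "b < n" "Z $$ (a, b) \<noteq> 0" for a b
        using Z that \<open>Y \<in> cartan_mats T\<close> unfolding fin_root_vector_def n_def by auto
      from support show ?thesis
      proof
        assume "Z $$ (i, k) \<noteq> 0 \<and> Z $$ (j, k) \<noteq> 0"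
        then have "Y $$ (i, i) - Y $$ (k, k) = Y $$ (j, j) - Y $$ (k, k)"
          using weight ij k(1) by metis
        then show ?thesis by simp
      next
        assume "Z $$ (k, i) \<noteq> 0 \<and> Z $$ (k, j) \<noteq> 0"
        then have "Y $$ (k, k) - Y $$ (i, i) = Y $$ (k, k) - Y $$ (j, j)"
          using weight ij k(1) by metis
        then show ?thesis by simp
      qed
    qed
    ultimately have D: "orthosymplectic T" "j = dual_index T i" "i < p"
      using cartan_separates[of i T j] ij by (auto simp: n_def p_def)
    have dual_j: "dual_index T j = i" using D ij by (simp add: n_def)
    have jp: "j < p" using D block by simp
    have twist: "twist T Z = Z" using Z' D by (simp add: matrix_set_orthosymplectic)
    have phase1: "phase T r = 1" if "r < p" for r
      using that D(1) by (cases T) (auto simp: p_def)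
    \<comment> \<open>in the first block all phases of \<open>osp\<close> are one\<close>
    have Zk: "cnj (Z $$ (dual_index T k, i)) * Z $$ (dual_index T k, j) = cnj (Z $$ (j, k)) * Z $$ (i, k)" if k: "k < n" for k
      using twist_eqD[OF twist, of "dual_index T k" i] twist_eqD[OF twist, of "dual_index T k" j] k ij D jp dual_j
        phase_cnj[of T "dual_index T k"]
      by (simp add: n_def p_def[symmetric] phase1 algebra_simps phase_mult_cnj)
    have "W $$ (i, j) = (\<Sum>k<n. Z $$ (i, k) * cnj (Z $$ (j, k)) - cnj (Z $$ (k, i)) * Z $$ (k, j))"
      unfolding sum using ij D(3) jp Z' by (intro sum.cong) (auto simp: superadjoint_def)
    also have "\<dots> = (\<Sum>k<n. Z $$ (i, k) * cnj (Z $$ (j, k))) - (\<Sum>k<n. cnj (Z $$ (k, i)) * Z $$ (k, j))"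
      by (rule sum_subtractf)
    also have "(\<Sum>k<n. cnj (Z $$ (k, i)) * Z $$ (k, j)) =
        (\<Sum>k<n. cnj (Z $$ (dual_index T k, i)) * Z $$ (dual_index T k, j))"
      unfolding n_def by (rule sum_dual_index[symmetric])
    also have "\<dots> = (\<Sum>k<n. Z $$ (i, k) * cnj (Z $$ (j, k)))"
      using Zk by (intro sum.cong) (auto simp: mult.commute)
    finally show False using nz by simp
  qed
  then have "diagonal_mat W" using W by (auto simp: diagonal_mat_def)
  moreover have "W $$ (dual_index T i, dual_index T i) = - W $$ (i, i) \<and> W $$ (swap_index T i, swap_index T i) = W $$ (i, i)"
    if i: "i < n" for i
  proof
    let ?e = "\<lambda>i k. if k < p \<and> p \<le> i then - 1 else 1"
    let ?N = "\<lambda>i k. (cmod (Z $$ (i, k)))\<^sup>2"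
    have Wii: "W $$ (i, i) = (\<Sum>k<n. of_real (?e i k * (?N i k - ?N k i)))" if "i < n" for i
      unfolding W_def by (rule bracket_superadjoint_diagonal[OF Z'(1) that])
    have "W $$ (dual_index T i, dual_index T i) =
      (\<Sum>k<n. of_real (?e (dual_index T i) (dual_index T k) *
        (?N (dual_index T i) (dual_index T k) - ?N (dual_index T k) (dual_index T i))))"
      unfolding Wii[OF dual_index_less[of i T, folded n_def, OF i]] n_def by (rule sum_dual_index[symmetric])
    also have "\<dots> = - W $$ (i, i)"
      unfolding Wii[OF i] sum_negf[symmetric] using i
      by (intro sum.cong) (auto simp: cmod_fin_root_vector(1)[OF Z z] n_def p_def)
    finally show "W $$ (dual_index T i, dual_index T i) = - W $$ (i, i)" .
    have "W $$ (swap_index T i, swap_index T i) =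
      (\<Sum>k<n. of_real (?e (swap_index T i) (swap_index T k) *
        (?N (swap_index T i) (swap_index T k) - ?N (swap_index T k) (swap_index T i))))"
      unfolding Wii[OF swap_index_less[of i T, folded n_def, OF i]] n_def by (rule sum_swap_index[symmetric])
    also have "\<dots> = W $$ (i, i)"
      unfolding Wii[OF i] using i
      by (intro sum.cong) (auto simp: cmod_fin_root_vector(2)[OF Z z] n_def p_def)
    finally show "W $$ (swap_index T i, swap_index T i) = W $$ (i, i)" .
  qed
  ultimately show ?thesis
    using W unfolding W_def[symmetric, unfolded p_def] cartan_mats_iff by (auto simp: n_def)
qed

lemma homogeneous_parts:
  assumes "X \<in> mats T"
  shows "homogeneous T 0 X \<longleftrightarrow> (\<forall>i<msize T. \<forall>j<msize T. X $$ (i, j) \<noteq> 0 \<longrightarrow> (i < size1 T \<longleftrightarrow> j < size1 T))"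
    and "homogeneous T 1 X \<longleftrightarrow> (\<forall>i<msize T. \<forall>j<msize T. X $$ (i, j) \<noteq> 0 \<longrightarrow> (i < size1 T \<longleftrightarrow> \<not> j < size1 T))"
proof -
  have zero: "A = zmat T \<longleftrightarrow> (\<forall>i<msize T. \<forall>j<msize T. A $$ (i, j) = 0)"
    if "A \<in> mats T" for A :: "complex mat"
    using that by auto
  show "homogeneous T 0 X \<longleftrightarrow> (\<forall>i<msize T. \<forall>j<msize T. X $$ (i, j) \<noteq> 0 \<longrightarrow> (i < size1 T \<longleftrightarrow> j < size1 T))"
    using assms unfolding homogeneous_def by (subst zero) (auto simp: odd_part_def)+
  show "homogeneous T 1 X \<longleftrightarrow> (\<forall>i<msize T. \<forall>j<msize T. X $$ (i, j) \<noteq> 0 \<longrightarrow> (i < size1 T \<longleftrightarrow> \<not> j < size1 T))"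
    using assms unfolding homogeneous_def by (simp, subst zero) (auto simp: even_part_def)+
qed

text \<open>
  \<open>Z\<close> is the part of \<open>X\<close> in the odd blocks or in one diagonal block, whichever contains a given nonzero
  entry of \<open>X\<close>, and \<open>Z'\<close> is its superadjoint.
\<close>

lemma fin_root_pair:
  assumes X: "fin_root_vector T z w X" and z: "cmod z = 1" and nz: "X \<noteq> zmat T"
  obtains Z Z' i where "fin_root_vector T z w Z" "fin_root_vector T (cnj z) (\<lambda>Y. - w Y) Z'"
    "i \<in> {0, 1}" "homogeneous T i Z" "homogeneous T i Z'"
    "sbr T Z Z' \<in> cartan_mats T" "str T (Z * Z') \<noteq> 0"
    "\<And>Y. Y \<in> cartan_mats T \<Longrightarrow>
      str T (sbr T Z Z' * Y) = w Y * str T (Z * Z')"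
proof -
  define n p where "n = msize T" and "p = size1 T"
  have Xcar: "X \<in> carrier_mat n n" using X matrix_set_carrier by (auto simp: fin_root_vector_def n_def)
  have "\<exists>a<n. \<exists>b<n. X $$ (a, b) \<noteq> 0"
  proof (rule ccontr)
    assume "\<not> ?thesis"
    then have "X = 0\<^sub>m n n" using Xcar by (intro eq_matI) auto
    then show False using nz by (simp add: n_def)
  qed
  then obtain a b where ab: "a < n" "b < n" "X $$ (a, b) \<noteq> 0" by blast
  define Q :: "bool \<Rightarrow> bool \<Rightarrow> bool" where
    "Q = (\<lambda>r s. if (a < p) = (b < p) then r = (a < p) \<and> s = (a < p) else r \<noteq> s)"
  define Z where "Z = mask p Q X"
  have Qsym: "Q r s = Q s r" for r s by (auto simp: Q_def)
  have Z: "fin_root_vector T z w Z" unfolding Z_def p_def by (rule fin_root_vector_mask[OF X Qsym])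
  have Zcar: "Z \<in> carrier_mat n n" using Xcar by (simp add: Z_def)
  have Znz: "Z \<noteq> 0\<^sub>m n n"
  proof
    assume "Z = 0\<^sub>m n n"
    then have "Z $$ (a, b) = 0" using ab by simp
    then show False using ab Xcar by (simp add: Z_def mask_def Q_def split: if_splits)
  qed
  define e :: nat where "e = (if (a < p) = (b < p) then 0 else 1)"
  have supp: "(i < p) = (a < p) \<and> (j < p) = (a < p)" if "e = 0" "Z $$ (i, j) \<noteq> 0" "i < n" "j < n" for i j
    using that Xcar by (auto simp: Z_def mask_def Q_def e_def split: if_splits)
  have supp': "(i < p) \<noteq> (j < p)" if "e \<noteq> 0" "Z $$ (i, j) \<noteq> 0" "i < n" "j < n" for i j
    using that Xcar by (auto simp: Z_def mask_def Q_def e_def split: if_splits)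
  have e: "e \<in> {0, 1}" by (simp add: e_def)
  have homogeneousI: "homogeneous T e M"
    if M: "M \<in> carrier_mat n n" and "\<And>i j. i < n \<Longrightarrow> j < n \<Longrightarrow> M $$ (i, j) \<noteq> 0 \<Longrightarrow> Z $$ (i, j) \<noteq> 0 \<or> Z $$ (j, i) \<noteq> 0" for M
  proof (cases "e = 0")
    case True
    then have "\<forall>i<n. \<forall>j<n. M $$ (i, j) \<noteq> 0 \<longrightarrow> (i < p \<longleftrightarrow> j < p)"
      using that(2) supp by metis
    then show ?thesis
      unfolding True homogeneous_parts(1)[OF M[unfolded n_def]] by (simp only: n_def p_def)
  next
    case False
    then have "\<forall>i<n. \<forall>j<n. M $$ (i, j) \<noteq> 0 \<longrightarrow> (i < p \<longleftrightarrow> \<not> j < p)"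
      using that(2) supp' by metis
    moreover have "e = 1" using False e by simp
    ultimately show ?thesis
      using homogeneous_parts(2)[OF M[unfolded n_def]] by (simp only: n_def p_def)
  qed
  have hom: "homogeneous T e Z"
    by (rule homogeneousI[OF Zcar]) simp
  have hom': "homogeneous T e (superadjoint p Z)"
    by (rule homogeneousI) (use Zcar in \<open>auto simp: superadjoint_def\<close>)
  have bracket: "super_bracket p Z (superadjoint p Z) \<in> cartan_mats T"
    unfolding p_def
  proof (rule bracket_superadjoint_cartan[OF Z z])
    show "(\<forall>i<msize T. \<forall>j<msize T. Z $$ (i, j) \<noteq> 0 \<longrightarrow> (i < size1 T \<longleftrightarrow> j < size1 T)) \<or>
      (\<forall>i<msize T. \<forall>j<msize T. Z $$ (i, j) \<noteq> 0 \<longrightarrow> (i < size1 T \<longleftrightarrow> \<not> j < size1 T))"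
      unfolding homogeneous_parts[OF Zcar[unfolded n_def], symmetric] using e hom by auto
  qed
  have nonzero: "supertrace p (Z * superadjoint p Z) \<noteq> 0"
  proof (rule supertrace_superadjoint_nonzero[OF Zcar Znz])
    show "(\<forall>i<n. \<forall>j<n. Z $$ (i, j) \<noteq> 0 \<longrightarrow> p \<le> i \<and> p \<le> j) \<or> (\<forall>i<n. \<forall>j<n. Z $$ (i, j) \<noteq> 0 \<longrightarrow> i < p \<or> j < p)"
    proof (cases "e = 0 \<and> \<not> a < p")
      case True
      then have "p \<le> i \<and> p \<le> j" if "i < n" "j < n" "Z $$ (i, j) \<noteq> 0" for i j
        using supp[of i j] that by auto
      then show ?thesis by blast
    next
      case False
      then have "i < p \<or> j < p" if "i < n" "j < n" "Z $$ (i, j) \<noteq> 0" for i j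
        using supp[of i j] supp'[of i j] that by (cases "e = 0") auto
      then show ?thesis by blast
    qed
  qed
  have pairing: "supertrace p (super_bracket p Z (superadjoint p Z) * Y) = w Y * supertrace p (Z * superadjoint p Z)"
    if Y: "Y \<in> cartan_mats T" for Y
    by (rule supertrace_bracket_superadjoint[OF Zcar])
      (use Z Y in \<open>auto simp: cartan_mats_iff fin_root_vector_def n_def\<close>)
  show thesis
    using that[OF Z fin_root_vector_superadjoint[OF Z] e hom] hom' bracket nonzero pairing
    unfolding p_def by blast
qed

section \<open>Scalar matrices and brackets with diagonal matrices\<close>

lemma msize_eq: "msize T = size1 T + size2 T"
  by (simp add: msize_def)

lemma scalar_idealE:
  assumes "S \<in> scalar_ideal T"
  obtains c where "S = c \<cdot>\<^sub>m 1\<^sub>m (msize T)" "c = 0 \<or> \<not> orthosymplectic T \<and> size1 T = size2 T"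
proof -
  have "zmat T = (0::complex) \<cdot>\<^sub>m 1\<^sub>m (msize T)" by auto
  then show thesis
    using assms that by (cases T) (auto split: if_splits)
qed

lemma scalar_idealI:
  assumes "c = 0 \<or> \<not> orthosymplectic T \<and> size1 T = size2 T"
  shows "c \<cdot>\<^sub>m 1\<^sub>m (msize T) \<in> scalar_ideal T"
proof -
  have "zmat T = (0::complex) \<cdot>\<^sub>m 1\<^sub>m (msize T)" by auto
  then show ?thesis
    using assms by (cases T) auto
qed

lemma scalar_ideal_iff:
  "S \<in> scalar_ideal T \<longleftrightarrow> (\<exists>c. S = c \<cdot>\<^sub>m 1\<^sub>m (msize T) \<and> (c = 0 \<or> \<not> orthosymplectic T \<and> size1 T = size2 T))"
  by (metis scalar_idealE scalar_idealI)

lemma scalar_ideal_carrier [simp]: "S \<in> scalar_ideal T \<Longrightarrow> S \<in> mats T"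
  by (auto simp: scalar_ideal_iff)

lemma scalar_ideal_zero [simp]: "zmat T \<in> scalar_ideal T"
proof -
  have "zmat T = (0::complex) \<cdot>\<^sub>m 1\<^sub>m (msize T)" by auto
  then show ?thesis using scalar_idealI[of 0 T] by simp
qed

lemma scalar_ideal_smult:
  assumes "S \<in> scalar_ideal T" shows "z \<cdot>\<^sub>m S \<in> scalar_ideal T"
proof -
  obtain c where c: "S = c \<cdot>\<^sub>m 1\<^sub>m (msize T)" "c = 0 \<or> \<not> orthosymplectic T \<and> size1 T = size2 T"
    using assms by (rule scalar_idealE)
  have "z \<cdot>\<^sub>m S = (z * c) \<cdot>\<^sub>m 1\<^sub>m (msize T)" using c by auto
  then show ?thesis using c scalar_idealI[of "z * c" T] by auto
qed

lemma scalar_ideal_add: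
  assumes "S \<in> scalar_ideal T" "S' \<in> scalar_ideal T" shows "S + S' \<in> scalar_ideal T"
proof -
  obtain c c' where c: "S = c \<cdot>\<^sub>m 1\<^sub>m (msize T)" "c = 0 \<or> \<not> orthosymplectic T \<and> size1 T = size2 T"
    "S' = c' \<cdot>\<^sub>m 1\<^sub>m (msize T)" "c' = 0 \<or> \<not> orthosymplectic T \<and> size1 T = size2 T"
    using assms scalar_idealE by metis
  have "S + S' = (c + c') \<cdot>\<^sub>m 1\<^sub>m (msize T)" using c by auto
  then show ?thesis using c scalar_idealI[of "c + c'" T] by auto
qed

lemma supertrace_add:
  "X \<in> carrier_mat n n \<Longrightarrow> Y \<in> carrier_mat n n \<Longrightarrow> supertrace p (X + Y) = supertrace p X + supertrace p Y"
  by (auto simp: supertrace_def sum.distrib[symmetric] intro!: sum.cong)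

lemma supertrace_smult: "X \<in> carrier_mat n n \<Longrightarrow> supertrace p (z \<cdot>\<^sub>m X) = z * supertrace p X"
  by (auto simp: supertrace_def sum_distrib_left intro!: sum.cong)

lemma twist_add:
  "X \<in> mats T \<Longrightarrow> Y \<in> mats T \<Longrightarrow> twist T (X + Y) = twist T X + twist T Y"
  by (rule eq_matI) (auto simp: twist_def algebra_simps)

lemma twist_smult: "X \<in> mats T \<Longrightarrow> twist T (z \<cdot>\<^sub>m X) = z \<cdot>\<^sub>m twist T X"
  by (rule eq_matI) (auto simp: twist_def algebra_simps)

lemma sigma_mat_add:
  assumes "X \<in> mats T" "Y \<in> mats T"
  shows "sigma_mat T (X + Y) = sigma_mat T X + sigma_mat T Y"
proof (cases "orthosymplectic T")
  case True
  show ?thesis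
    unfolding sigma_mat_eq_swap[OF True assms(1)] sigma_mat_eq_swap[OF True assms(2)]
      sigma_mat_eq_swap[OF True add_carrier_mat[OF assms(2)], of X]
    using assms by (intro eq_matI) auto
qed (use assms in \<open>simp add: sigma_mat_eq_twist twist_add\<close>)

lemma sigma_mat_smult:
  assumes "X \<in> mats T"
  shows "sigma_mat T (z \<cdot>\<^sub>m X) = z \<cdot>\<^sub>m sigma_mat T X"
proof (cases "orthosymplectic T")
  case True
  show ?thesis
    unfolding sigma_mat_eq_swap[OF True assms(1)] sigma_mat_eq_swap[OF True smult_carrier_mat[OF assms(1)]]
    using assms by (intro eq_matI) auto
qed (use assms in \<open>simp add: sigma_mat_eq_twist twist_smult\<close>)

lemma matrix_set_add:
  assumes "X \<in> matrix_set T" "Y \<in> matrix_set T" shows "X + Y \<in> matrix_set T"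
proof (rule matrix_setI)
  show "twist T (X + Y) = X + Y" if "orthosymplectic T"
    using assms that by (auto simp: matrix_set_orthosymplectic twist_add)
  show "str T (X + Y) = 0"
    using assms matrix_set_carrier by (simp add: supertrace_add[where n = "msize T"] supertrace_matrix_set)
qed (use assms matrix_set_carrier in auto)

lemma matrix_set_smult:
  assumes "X \<in> matrix_set T" shows "z \<cdot>\<^sub>m X \<in> matrix_set T"
proof (rule matrix_setI)
  show "twist T (z \<cdot>\<^sub>m X) = z \<cdot>\<^sub>m X" if "orthosymplectic T"
    using assms that by (auto simp: matrix_set_orthosymplectic twist_smult)
  show "str T (z \<cdot>\<^sub>m X) = 0"
    using assms matrix_set_carrier by (simp add: supertrace_smult[where n = "msize T"] supertrace_matrix_set)
qed (use assms matrix_set_carrier in auto)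

text \<open>
  Nonzero scalar matrices are factored out only if the two blocks have equal size, where the identity has
  supertrace zero.
\<close>

lemma scalar_ideal_matrix_set: "S \<in> scalar_ideal T \<Longrightarrow> S \<in> matrix_set T"
proof (erule scalar_idealE)
  fix c assume S: "S = c \<cdot>\<^sub>m 1\<^sub>m (msize T)" and c: "c = 0 \<or> \<not> orthosymplectic T \<and> size1 T = size2 T"
  show "S \<in> matrix_set T"
  proof (rule matrix_setI)
    show "twist T S = S" if "orthosymplectic T"
      using S c that by (auto simp: twist_def)
    have "str T S = c * (\<Sum>i<msize T. if i < size1 T then 1 else - 1)"
      unfolding S supertrace_def sum_distrib_left by (auto intro!: sum.cong)
    also have "(\<Sum>i<msize T. if i < size1 T then 1 else - 1 :: complex) = (\<Sum>i<size1 T. 1) + (\<Sum>i\<in>{size1 T..<msize T}. - 1)"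
    proof -
      have "{..<msize T} = {..<size1 T} \<union> {size1 T..<msize T}" by (auto simp: msize_eq)
      then show ?thesis by (simp add: sum.union_disjoint ivl_disj_int_one)
    qed
    finally show "str T S = 0" using c by (auto simp: msize_eq)
  qed (use S in auto)
qed

lemma matrix_set_zero [simp]: "zmat T \<in> matrix_set T"
  by (rule scalar_ideal_matrix_set) simp

lemma super_bracket_add:
  assumes "X \<in> carrier_mat n n" "X' \<in> carrier_mat n n" "Y \<in> carrier_mat n n"
  shows "super_bracket p (X + X') Y = super_bracket p X Y + super_bracket p X' Y"
    and "super_bracket p Y (X + X') = super_bracket p Y X + super_bracket p Y X'"
proof -
  have car: "X + X' \<in> carrier_mat n n" using assms by simp
  have dims: "A \<in> carrier_mat n n \<Longrightarrow> B \<in> carrier_mat n n \<Longrightarrow> dim_row (super_bracket p A B) = n \<and> dim_col (super_bracket p A B) = n" for A B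
    using super_bracket_carrier[of A n B p] by (metis carrier_matD)
  show "super_bracket p (X + X') Y = super_bracket p X Y + super_bracket p X' Y"
    by (rule eq_matI)
      (use assms dims car in \<open>auto simp: super_bracket_index[OF car assms(3)] super_bracket_index[OF assms(1) assms(3)]
        super_bracket_index[OF assms(2) assms(3)] sum.distrib[symmetric] algebra_simps intro!: sum.cong\<close>)
  show "super_bracket p Y (X + X') = super_bracket p Y X + super_bracket p Y X'"
    by (rule eq_matI)
      (use assms dims car in \<open>auto simp: super_bracket_index[OF assms(3) car] super_bracket_index[OF assms(3) assms(1)]
        super_bracket_index[OF assms(3) assms(2)] sum.distrib[symmetric] algebra_simps intro!: sum.cong\<close>)
qed

lemma super_bracket_diagonal:
  assumes Y: "Y \<in> carrier_mat n n" "diagonal_mat Y" and X: "X \<in> carrier_mat n n" and ij: "i < n" "j < n"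
  shows "super_bracket p Y X $$ (i, j) = (Y $$ (i, i) - Y $$ (j, j)) * X $$ (i, j)"
    and "super_bracket p X Y $$ (i, j) = (Y $$ (j, j) - Y $$ (i, i)) * X $$ (i, j)"
proof -
  have zero: "Y $$ (a, b) = 0" if "a < n" "b < n" "a \<noteq> b" for a b
    using Y that by (auto simp: diagonal_mat_def)
  have "super_bracket p Y X $$ (i, j) = (\<Sum>k<n. (if k = i then Y $$ (i, i) * X $$ (i, j) else 0) - (if k = j then X $$ (i, j) * Y $$ (j, j) else 0))"
    unfolding super_bracket_index[OF Y(1) X ij] using zero ij by (intro sum.cong) auto
  also have "\<dots> = (Y $$ (i, i) - Y $$ (j, j)) * X $$ (i, j)"
    using ij by (simp add: sum_subtractf sum.delta algebra_simps)
  finally show "super_bracket p Y X $$ (i, j) = (Y $$ (i, i) - Y $$ (j, j)) * X $$ (i, j)" .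
  have "super_bracket p X Y $$ (i, j) = (\<Sum>k<n. (if k = j then X $$ (i, j) * Y $$ (j, j) else 0) - (if k = i then Y $$ (i, i) * X $$ (i, j) else 0))"
    unfolding super_bracket_index[OF X Y(1) ij] using zero ij by (intro sum.cong) auto
  also have "\<dots> = (Y $$ (j, j) - Y $$ (i, i)) * X $$ (i, j)"
    using ij by (simp add: sum_subtractf sum.delta algebra_simps)
  finally show "super_bracket p X Y $$ (i, j) = (Y $$ (j, j) - Y $$ (i, i)) * X $$ (i, j)" .
qed

lemma super_bracket_scalar:
  assumes "X \<in> mats T" "S \<in> scalar_ideal T"
  shows "super_bracket p S X = zmat T" "super_bracket p X S = zmat T"
proof -
  obtain c where S: "S = c \<cdot>\<^sub>m 1\<^sub>m (msize T)" using assms(2) by (rule scalar_idealE)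
  then have "S \<in> mats T" "diagonal_mat S" by (auto simp: diagonal_mat_def)
  note br = super_bracket_diagonal[OF this assms(1)] super_bracket_carrier[OF this(1) assms(1)]
    super_bracket_carrier[OF assms(1) this(1)]
  have const: "S $$ (i, i) = c" if "i < msize T" for i using that by (simp add: S)
  show "super_bracket p S X = zmat T"
    by (rule eq_matI) (use carrier_matD[OF br(3)[of p]] in \<open>auto simp: br const\<close>)
  show "super_bracket p X S = zmat T"
    by (rule eq_matI) (use carrier_matD[OF br(4)[of p]] in \<open>auto simp: br const\<close>)
qed

text \<open>
  Closure of the matrix superalgebra under brackets in the case of a diagonal factor, where the bracket only
  rescales entries.
\<close>

lemma cartan_mats_bracket:
  assumes Y: "Y \<in> cartan_mats T" and X: "X \<in> matrix_set T"
  shows "sbr T Y X \<in> matrix_set T"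
proof -
  have Y': "Y \<in> mats T" "diagonal_mat Y"
    "\<And>i. i < msize T \<Longrightarrow> Y $$ (dual_index T i, dual_index T i) = - Y $$ (i, i)"
    using Y by (auto simp: cartan_mats_iff)
  have X': "X \<in> mats T" using X by (rule matrix_set_carrier)
  note index = super_bracket_diagonal(1)[OF Y'(1,2) X']
  have car: "sbr T Y X \<in> mats T"
    using Y' X' by simp
  show ?thesis
  proof (rule matrix_setI[OF car])
    assume D: "orthosymplectic T"
    then have "twist T X = X" using X by (simp add: matrix_set_orthosymplectic)
    note X_index = twist_eqD[OF this]
    show "twist T (sbr T Y X) = sbr T Y X"
    proof (rule eq_matI)
      fix i j assume "i < dim_row (sbr T Y X)" "j < dim_col (sbr T Y X)"
      then have ij: "i < msize T" "j < msize T" using car by auto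
      have "twist T (sbr T Y X) $$ (i, j) = (Y $$ (i, i) - Y $$ (j, j)) *
        ((if i < size1 T \<and> size1 T \<le> j then 1 else - 1) * phase T i * cnj (phase T j) * X $$ (dual_index T j, dual_index T i))"
        using ij Y'(3) by (simp add: twist_def index algebra_simps)
      then show "twist T (sbr T Y X) $$ (i, j) = sbr T Y X $$ (i, j)"
        using ij X_index[of i j] by (simp add: index)
    qed (use car in auto)
  qed (use car in \<open>auto intro!: supertrace_zero_diagonal simp: index\<close>)
qed

section \<open>Cosets\<close>

lemma matrix_superalgebra_simps [simp]:
  "carrier (matrix_superalgebra T) = matrix_set T"
  "X \<otimes>\<^bsub>matrix_superalgebra T\<^esub> Y = sbr T X Y"
  "X \<oplus>\<^bsub>matrix_superalgebra T\<^esub> Y = X + Y"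
  "z \<odot>\<^bsub>matrix_superalgebra T\<^esub> X = z \<cdot>\<^sub>m X"
  by (simp_all add: matrix_superalgebra_def module_mat_def)

lemma matrix_class_eq: "matrix_class T X = (\<lambda>S. S + X) ` scalar_ideal T"
  by (auto simp: matrix_class_def a_r_coset_def')

lemma fin_superalgebra_simps:
  "carrier (fin_superalgebra T) = matrix_class T ` matrix_set T"
  "\<zero>\<^bsub>fin T\<^esub> = scalar_ideal T"
  "C \<oplus>\<^bsub>fin T\<^esub> D = {X + Y | X Y. X \<in> C \<and> Y \<in> D}"
  "C \<otimes>\<^bsub>fin T\<^esub> D = (\<Union>X\<in>C. \<Union>Y\<in>D. matrix_class T (sbr T X Y))"
  "z \<odot>\<^bsub>fin T\<^esub> C = (\<Union>X\<in>C. matrix_class T (z \<cdot>\<^sub>m X))"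
  by (auto simp: fin_superalgebra_def quotient_module_def ring.defs module.defs FactRing_def A_RCOSETS_def'
      matrix_class_def set_add_def' rcoset_mult_def)

lemma in_matrix_class: "X \<in> mats T \<Longrightarrow> X \<in> matrix_class T X"
  unfolding matrix_class_eq by (rule image_eqI[of _ _ "zmat T"]) auto

lemma uminus_mat_eq_smult: "- X = (- 1 :: complex) \<cdot>\<^sub>m X"
  by (rule eq_matI) auto

lemma minus_scalar_ideal: "S \<in> scalar_ideal T \<Longrightarrow> - S \<in> scalar_ideal T"
  unfolding uminus_mat_eq_smult by (rule scalar_ideal_smult)

lemma matrix_class_add_scalar:
  assumes X: "X \<in> mats T" and S: "S \<in> scalar_ideal T"
  shows "matrix_class T (S + X) = matrix_class T X"
proof -
  have "matrix_class T (S + X) \<subseteq> matrix_class T X" if "X \<in> mats T" "S \<in> scalar_ideal T" for S X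
  proof
    fix M assume "M \<in> matrix_class T (S + X)"
    then obtain S' where S': "S' \<in> scalar_ideal T" "M = S' + (S + X)"
      by (auto simp: matrix_class_eq)
    then have "M = (S' + S) + X"
      using that by (simp add: assoc_add_mat[where nr = "msize T" and nc = "msize T"])
    then show "M \<in> matrix_class T X"
      using scalar_ideal_add[OF S'(1) that(2)] by (auto simp: matrix_class_eq)
  qed
  note sub = this
  have "- S + (S + X) = X"
    using X carrier_matD[OF scalar_ideal_carrier[OF S]] by (intro eq_matI) auto
  moreover have "S + X \<in> mats T" using X by simp
  ultimately have "matrix_class T X \<subseteq> matrix_class T (S + X)"
    using sub[of "S + X" "- S"] minus_scalar_ideal[OF S] by simp
  with sub[OF X S] show ?thesis by blast
qed

lemma matrix_class_eq_iff:
  assumes X: "X \<in> mats T" and Y: "Y \<in> mats T"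
  shows "matrix_class T X = matrix_class T Y \<longleftrightarrow> X - Y \<in> scalar_ideal T"
proof
  assume "matrix_class T X = matrix_class T Y"
  then have "X \<in> matrix_class T Y" using in_matrix_class[OF X] by simp
  then obtain S where S: "S \<in> scalar_ideal T" "X = S + Y" by (auto simp: matrix_class_eq)
  then have "X - Y = S" using Y carrier_matD[OF scalar_ideal_carrier[OF S(1)]] by (intro eq_matI) auto
  then show "X - Y \<in> scalar_ideal T" using S by simp
next
  assume "X - Y \<in> scalar_ideal T"
  moreover have "(X - Y) + Y = X" using X Y by (intro eq_matI) auto
  ultimately show "matrix_class T X = matrix_class T Y"
    using matrix_class_add_scalar[OF Y] by metis
qed

lemma in_matrix_classE:
  assumes "M \<in> matrix_class T X"
  obtains S where "S \<in> scalar_ideal T" "M = S + X"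
  using assms by (auto simp: matrix_class_eq)

lemma class_zero: "\<zero>\<^bsub>fin T\<^esub> = matrix_class T (zmat T)"
proof -
  have "(\<lambda>S. S + zmat T) ` scalar_ideal T = (\<lambda>S. S) ` scalar_ideal T"
    by (intro image_cong right_add_zero_mat scalar_ideal_carrier) simp_all
  then show ?thesis by (simp add: fin_superalgebra_simps(2) matrix_class_eq)
qed

lemma class_add:
  assumes X: "X \<in> mats T" and Y: "Y \<in> mats T"
  shows "matrix_class T X \<oplus>\<^bsub>fin T\<^esub> matrix_class T Y = matrix_class T (X + Y)"
proof -
  have sum: "(S + X) + (S' + Y) = (S + S') + (X + Y)" if "S \<in> scalar_ideal T" "S' \<in> scalar_ideal T" for S S'
    using X Y carrier_matD[OF scalar_ideal_carrier[OF that(1)]] carrier_matD[OF scalar_ideal_carrier[OF that(2)]]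
    by (intro eq_matI) auto
  show ?thesis
  proof (intro equalityI subsetI)
    fix M assume "M \<in> matrix_class T X \<oplus>\<^bsub>fin T\<^esub> matrix_class T Y"
    then obtain S S' where S: "S \<in> scalar_ideal T" "S' \<in> scalar_ideal T" "M = (S + X) + (S' + Y)"
      by (auto simp: fin_superalgebra_simps(3) matrix_class_eq)
    then have "M = (S + S') + (X + Y)" using sum by simp
    then show "M \<in> matrix_class T (X + Y)"
      using scalar_ideal_add[OF S(1,2)] unfolding matrix_class_eq by (rule image_eqI)
  next
    fix M assume "M \<in> matrix_class T (X + Y)"
    then obtain S where S: "S \<in> scalar_ideal T" "M = S + (X + Y)" by (rule in_matrix_classE)
    then have "M = (S + X) + Y"
      using X Y scalar_ideal_carrier[OF S(1)] by (simp only: assoc_add_mat)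
    moreover have "S + X \<in> matrix_class T X" unfolding matrix_class_eq using S(1) by (rule imageI)
    ultimately show "M \<in> matrix_class T X \<oplus>\<^bsub>fin T\<^esub> matrix_class T Y"
      using in_matrix_class[OF Y] unfolding fin_superalgebra_simps(3) by blast
  qed
qed

lemma class_bracket:
  assumes X: "X \<in> mats T" and Y: "Y \<in> mats T"
  shows "matrix_class T X \<otimes>\<^bsub>fin T\<^esub> matrix_class T Y = matrix_class T (sbr T X Y)"
proof -
  have "sbr T M N = sbr T X Y"
    if "M \<in> matrix_class T X" "N \<in> matrix_class T Y" for M N
  proof -
    obtain S S' where S: "S \<in> scalar_ideal T" "M = S + X" "S' \<in> scalar_ideal T" "N = S' + Y"
      using \<open>M \<in> _\<close> \<open>N \<in> _\<close> in_matrix_classE by metis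
    have car: "S \<in> mats T" "S' \<in> mats T" "S' + Y \<in> mats T"
      using S Y by auto
    show ?thesis
      unfolding S super_bracket_add(1)[OF car(1) X car(3)] super_bracket_scalar(1)[OF car(3) S(1)]
        super_bracket_add(2)[OF car(2) Y X] super_bracket_scalar(2)[OF X S(3)]
      using X Y by (simp add: left_add_zero_mat[where nr = "msize T" and nc = "msize T"])
  qed
  then have "matrix_class T X \<otimes>\<^bsub>fin T\<^esub> matrix_class T Y =
      (\<Union>M\<in>matrix_class T X. \<Union>N\<in>matrix_class T Y. matrix_class T (sbr T X Y))"
    unfolding fin_superalgebra_simps(4) by (intro SUP_cong refl) simp
  then show ?thesis
    using in_matrix_class[OF X] in_matrix_class[OF Y] by auto
qed

lemma class_smult:
  assumes X: "X \<in> mats T"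
  shows "z \<odot>\<^bsub>fin T\<^esub> matrix_class T X = matrix_class T (z \<cdot>\<^sub>m X)"
proof -
  have "matrix_class T (z \<cdot>\<^sub>m M) = matrix_class T (z \<cdot>\<^sub>m X)" if "M \<in> matrix_class T X" for M
  proof -
    obtain S where S: "S \<in> scalar_ideal T" "M = S + X" using \<open>M \<in> _\<close> by (rule in_matrix_classE)
    have "z \<cdot>\<^sub>m M = z \<cdot>\<^sub>m S + z \<cdot>\<^sub>m X"
      using S X carrier_matD[OF scalar_ideal_carrier[OF S(1)]] by (intro eq_matI) (auto simp: algebra_simps)
    then show ?thesis
      using matrix_class_add_scalar[OF _ scalar_ideal_smult[OF S(1)], of "z \<cdot>\<^sub>m X" z] X by simp
  qed
  then have "z \<odot>\<^bsub>fin T\<^esub> matrix_class T X = (\<Union>M\<in>matrix_class T X. matrix_class T (z \<cdot>\<^sub>m X))"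
    unfolding fin_superalgebra_simps(5) by (intro SUP_cong refl) simp
  then show ?thesis using in_matrix_class[OF X] by auto
qed

lemma supertrace_scalar_mult:
  assumes X: "X \<in> matrix_set T" and S: "S \<in> scalar_ideal T"
  shows "str T (S * X) = 0" "str T (X * S) = 0"
proof -
  obtain c where c: "S = c \<cdot>\<^sub>m 1\<^sub>m (msize T)" using S by (rule scalar_idealE)
  have X': "X \<in> mats T" using X by (rule matrix_set_carrier)
  have "S * X = c \<cdot>\<^sub>m X" "X * S = c \<cdot>\<^sub>m X"
    using X' mult_smult_assoc_mat[OF one_carrier_mat X', of c] mult_smult_distrib[OF X' one_carrier_mat, of c]
    by (simp_all add: c)
  then show "str T (S * X) = 0" "str T (X * S) = 0"
    using X X' by (simp_all add: supertrace_smult[where n = "msize T"] supertrace_matrix_set)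
qed

text \<open>
  The form is well defined on cosets because scalar multiples of elements of the superalgebra have
  supertrace zero.
\<close>

lemma kappa_class:
  assumes X: "X \<in> matrix_set T" and Y: "Y \<in> matrix_set T"
  shows "kappa T (matrix_class T X) (matrix_class T Y) = str T (X * Y)"
proof -
  have car: "X \<in> mats T" "Y \<in> mats T"
    using X Y by (auto intro: matrix_set_carrier)
  have "str T (M * N) = str T (X * Y)"
    if "M \<in> matrix_class T X" "N \<in> matrix_class T Y" for M N
  proof -
    obtain S S' where S: "S \<in> scalar_ideal T" "M = S + X" "S' \<in> scalar_ideal T" "N = S' + Y"
      using \<open>M \<in> _\<close> \<open>N \<in> _\<close> in_matrix_classE by metis
    have "M * N = S * N + X * N"
      unfolding S(2) using car S scalar_ideal_carrier[OF S(1)] scalar_ideal_carrier[OF S(3)]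
      by (intro add_mult_distrib_mat[where nr = "msize T" and n = "msize T" and nc = "msize T"]) auto
    also have "X * N = X * S' + X * Y"
      unfolding S(4) using car scalar_ideal_carrier[OF S(3)]
      by (intro mult_add_distrib_mat[where nr = "msize T" and n = "msize T" and nc = "msize T"]) auto
    finally have "M * N = S * N + (X * S' + X * Y)" .
    have N: "N \<in> matrix_set T"
      using S Y by (simp add: matrix_set_add scalar_ideal_matrix_set)
    have prods: "S * N \<in> mats T" "X * S' \<in> mats T"
      "X * Y \<in> mats T"
      using car scalar_ideal_carrier[OF S(1)] scalar_ideal_carrier[OF S(3)] matrix_set_carrier[OF N] by auto
    from \<open>M * N = S * N + (X * S' + X * Y)\<close>
    have "str T (M * N) = str T (S * N + (X * S' + X * Y))"
      by (rule arg_cong)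
    also have "\<dots> = str T (S * N) + str T (X * S' + X * Y)"
      by (rule supertrace_add[OF prods(1) add_carrier_mat[OF prods(3)]])
    also have "str T (X * S' + X * Y) = str T (X * S') + str T (X * Y)"
      by (rule supertrace_add[OF prods(2,3)])
    finally have "str T (M * N) =
        str T (S * N) + (str T (X * S') + str T (X * Y))" .
    then show ?thesis
      by (simp add: supertrace_scalar_mult(1)[OF N S(1)] supertrace_scalar_mult(2)[OF X S(3)])
  qed
  then have "(\<lambda>(M, N). str T (M * N)) ` (matrix_class T X \<times> matrix_class T Y) =
      (\<lambda>_. str T (X * Y)) ` (matrix_class T X \<times> matrix_class T Y)"
    by (intro image_cong refl) (simp only: mem_Sigma_iff split_paired_all split)
  moreover have "matrix_class T X \<times> matrix_class T Y \<noteq> {}"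
    using in_matrix_class[OF car(1)] in_matrix_class[OF car(2)] by blast
  ultimately have "(\<lambda>(M, N). str T (M * N)) ` (matrix_class T X \<times> matrix_class T Y) = {str T (X * Y)}"
    by (simp only: image_constant_conv if_False)
  then show ?thesis by (simp add: kappa_def)
qed

text \<open>
  The supertranspose fixes scalar matrices and the sign in \<open>\<sigma>\<close> remains.
\<close>

lemma sigma_mat_scalar:
  assumes "S \<in> scalar_ideal T"
  shows "sigma_mat T S = - S"
proof -
  obtain c where c: "S = c \<cdot>\<^sub>m 1\<^sub>m (msize T)" "c = 0 \<or> \<not> orthosymplectic T \<and> size1 T = size2 T"
    using assms by (rule scalar_idealE)
  have eq: "dual_index T i = dual_index T j \<longleftrightarrow> i = j" if "i < msize T" "j < msize T" for i j
    using that dual_index_dual_index by metis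
  show ?thesis
  proof (cases "c = 0")
    case True
    have "S = 0 \<cdot>\<^sub>m S" by (auto simp: c True)
    then have zero: "sigma_mat T S = 0 \<cdot>\<^sub>m sigma_mat T S"
      using sigma_mat_smult[OF scalar_ideal_carrier[OF assms], of 0] by metis
    have car: "sigma_mat T S \<in> mats T"
      by (rule sigma_mat_carrier[OF scalar_ideal_carrier[OF assms]])
    have "sigma_mat T S $$ (i, j) = 0" if "i < msize T" "j < msize T" for i j
      by (subst zero) (use that car in simp)
    moreover have "S $$ (i, j) = 0" if "i < msize T" "j < msize T" for i j
      using that by (simp add: c True)
    ultimately show ?thesis
      using car scalar_ideal_carrier[OF assms] by (intro eq_matI) auto
  next
    case False
    then show ?thesis
      using c sigma_mat_eq_twist[OF _ scalar_ideal_carrier[OF assms]]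
      by (auto simp: twist_def eq intro!: eq_matI)
  qed
qed

lemma sigma_class:
  assumes X: "X \<in> mats T"
  shows "sigma_mat T ` matrix_class T X = matrix_class T (sigma_mat T X)"
proof -
  have "sigma_mat T ` matrix_class T X = (\<lambda>S. sigma_mat T (S + X)) ` scalar_ideal T"
    by (simp add: matrix_class_eq image_image)
  also have "\<dots> = (\<lambda>S. - S + sigma_mat T X) ` scalar_ideal T"
    using X by (intro image_cong) (simp_all add: sigma_mat_add sigma_mat_scalar)
  also have "\<dots> = (\<lambda>S. S + sigma_mat T X) ` (uminus ` scalar_ideal T)"
    by (simp add: image_image)
  also have "uminus ` scalar_ideal T = scalar_ideal T"
  proof
    show "uminus ` scalar_ideal T \<subseteq> scalar_ideal T" using minus_scalar_ideal by blast
    show "scalar_ideal T \<subseteq> uminus ` scalar_ideal T"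
    proof
      fix S assume "S \<in> scalar_ideal T"
      then show "S \<in> uminus ` scalar_ideal T"
        by (intro image_eqI[of _ _ "- S"] minus_scalar_ideal) auto
    qed
  qed
  finally show ?thesis by (simp add: matrix_class_eq)
qed

lemma abelian_group_fin_superalgebra: "abelian_group (fin_superalgebra T)"
proof -
  let ?G = "fin_superalgebra T"
  have classE: "\<exists>X\<in>matrix_set T. X \<in> mats T \<and> C = matrix_class T X" if "C \<in> carrier ?G" for C
    using that matrix_set_carrier by (auto simp: fin_superalgebra_simps(1))
  show ?thesis
  proof (rule abelian_groupI)
    fix C D assume "C \<in> carrier ?G" "D \<in> carrier ?G"
    then obtain X Y where XY: "X \<in> matrix_set T" "X \<in> mats T" "C = matrix_class T X"
      "Y \<in> matrix_set T" "Y \<in> mats T" "D = matrix_class T Y"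
      using classE by metis
    then show "C \<oplus>\<^bsub>?G\<^esub> D \<in> carrier ?G"
      by (simp add: class_add matrix_set_add fin_superalgebra_simps(1))
    show "C \<oplus>\<^bsub>?G\<^esub> D = D \<oplus>\<^bsub>?G\<^esub> C"
      using XY comm_add_mat[OF XY(2,5)] by (simp add: class_add)
    fix E assume "E \<in> carrier ?G"
    then obtain Z where Z: "Z \<in> mats T" "E = matrix_class T Z"
      using classE by metis
    show "C \<oplus>\<^bsub>?G\<^esub> D \<oplus>\<^bsub>?G\<^esub> E = C \<oplus>\<^bsub>?G\<^esub> (D \<oplus>\<^bsub>?G\<^esub> E)"
      using XY Z assoc_add_mat[OF XY(2,5) Z(1)] by (simp add: class_add)
  next
    show "\<zero>\<^bsub>?G\<^esub> \<in> carrier ?G"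
      by (simp add: class_zero fin_superalgebra_simps(1))
    fix C assume "C \<in> carrier ?G"
    then obtain X where X: "X \<in> matrix_set T" "X \<in> mats T" "C = matrix_class T X"
      using classE by metis
    show "\<zero>\<^bsub>?G\<^esub> \<oplus>\<^bsub>?G\<^esub> C = C"
      using X by (simp add: class_zero class_add left_add_zero_mat)
    have "- X \<in> matrix_set T" using matrix_set_smult[OF X(1), of "- 1"] by (simp only: uminus_mat_eq_smult)
    moreover have "- X + X = zmat T" using X(2) by (intro eq_matI) auto
    then have "matrix_class T (- X) \<oplus>\<^bsub>?G\<^esub> C = \<zero>\<^bsub>?G\<^esub>"
      using X by (simp add: class_add class_zero)
    ultimately show "\<exists>D\<in>carrier ?G. D \<oplus>\<^bsub>?G\<^esub> C = \<zero>\<^bsub>?G\<^esub>"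
      by (auto simp: fin_superalgebra_simps(1))
  qed
qed

section \<open>The affinization\<close>

text \<open>
  The coefficient function of \<open>X \<otimes> t\<^sup>a\<close>.
\<close>

definition single :: "affine_type \<Rightarrow> int \<Rightarrow> complex mat \<Rightarrow> int \<Rightarrow> complex mat set" where
  "single T a X = (\<lambda>b. if b = a then matrix_class T X else matrix_class T (zmat T))"

text \<open>
  The element \<open>Y \<otimes> 1 + r c + s d\<close>.
\<close>

definition toral :: "affine_type \<Rightarrow> complex mat \<Rightarrow> complex \<Rightarrow> complex \<Rightarrow> aff" where
  "toral T Y r s = (single T 0 Y, r, s)"

lemma affine_simps:
  "carrier (affine T \<zeta>) = {(f, r, s). (\<forall>a. f a \<in> fin_eigenspace T \<zeta> (nat (a mod int (sigma_order T)))) \<and>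
     finite {a. f a \<noteq> \<zero>\<^bsub>fin T\<^esub>}}"
  "\<zero>\<^bsub>affine T \<zeta>\<^esub> = (\<lambda>_. \<zero>\<^bsub>fin T\<^esub>, 0, 0)"
  "(f, r, s) \<oplus>\<^bsub>affine T \<zeta>\<^esub> (g, r', s') = (\<lambda>a. f a \<oplus>\<^bsub>fin T\<^esub> g a, r + r', s + s')"
  "z \<odot>\<^bsub>affine T \<zeta>\<^esub> (f, r, s) = (\<lambda>a. z \<odot>\<^bsub>fin T\<^esub> f a, z * r, z * s)"
  "(f, r, s) \<otimes>\<^bsub>affine T \<zeta>\<^esub> (g, r', s') =
    (\<lambda>b. (\<Oplus>\<^bsub>fin T\<^esub>a\<in>{a. f a \<noteq> \<zero>\<^bsub>fin T\<^esub>}. f a \<otimes>\<^bsub>fin T\<^esub> g (b - a))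
       \<oplus>\<^bsub>fin T\<^esub> ((s * of_int b) \<odot>\<^bsub>fin T\<^esub> g b)
       \<ominus>\<^bsub>fin T\<^esub> ((s' * of_int b) \<odot>\<^bsub>fin T\<^esub> f b),
     \<Sum>a\<in>{a. f a \<noteq> \<zero>\<^bsub>fin T\<^esub>}. of_int a * kappa T (f a) (g (- a)), 0)"
  by (simp_all add: affine_def affinization_def)

lemma affine_form_simp:
  "affine_form T (f, r, s) (g, r', s') =
     (\<Sum>a\<in>{a. f a \<noteq> \<zero>\<^bsub>fin T\<^esub>}. kappa T (f a) (g (- a))) + r * s' + s * r'"
  by (simp add: affine_form_def affinization_form_def)

lemma smult_one_mat: "(1 :: complex) \<cdot>\<^sub>m X = X"
  by (rule eq_matI) auto

lemma zero_smult_class: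
  assumes "X \<in> mats T"
  shows "0 \<odot>\<^bsub>fin T\<^esub> matrix_class T X = \<zero>\<^bsub>fin T\<^esub>"
proof -
  have "0 \<cdot>\<^sub>m X = zmat T" using assms by (intro eq_matI) auto
  then show ?thesis using assms by (simp add: class_smult class_zero)
qed

lemma smult_zero_class: "z \<odot>\<^bsub>fin T\<^esub> \<zero>\<^bsub>fin T\<^esub> = \<zero>\<^bsub>fin T\<^esub>"
proof -
  have "z \<cdot>\<^sub>m zmat T = zmat T" by auto
  then show ?thesis by (simp add: class_smult class_zero)
qed

lemma super_bracket_zero:
  assumes "X \<in> mats T"
  shows "super_bracket p (zmat T) X = zmat T"
    "super_bracket p X (zmat T) = zmat T"
  using super_bracket_scalar[OF assms scalar_ideal_zero] by auto

text \<open>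
  The assumption on \<open>s'\<close> and \<open>a\<close> excludes the term in which the derivation of the second factor acts on the
  first.
\<close>

lemma affine_bracket_single:
  assumes X: "X \<in> mats T"
    and g: "\<And>b. g b = matrix_class T (G b)" "\<And>b. G b \<in> mats T"
    and closed: "\<And>b. sbr T X (G b) \<in> matrix_set T"
    and s: "s' = 0 \<or> a = 0"
  shows "(single T a X, r, s) \<otimes>\<^bsub>affine T \<zeta>\<^esub> (g, r', s') =
    (\<lambda>b. matrix_class T (sbr T X (G (b - a)) + (s * of_int b) \<cdot>\<^sub>m G b),
     if matrix_class T X = \<zero>\<^bsub>fin T\<^esub> then 0 else of_int a * kappa T (matrix_class T X) (g (- a)), 0)"
proof -
  interpret G: abelian_group "fin_superalgebra T" by (rule abelian_group_fin_superalgebra)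
  let ?G = "fin_superalgebra T"
  let ?A = "{c. single T a X c \<noteq> \<zero>\<^bsub>?G\<^esub>}"
  have A: "?A = (if matrix_class T X = \<zero>\<^bsub>?G\<^esub> then {} else {a})"
    by (auto simp: single_def class_zero)
  have closed': "matrix_class T (sbr T X (G b)) \<in> carrier ?G" for b
    using closed by (simp add: fin_superalgebra_simps(1))
  have bracket: "matrix_class T X \<otimes>\<^bsub>?G\<^esub> g b = matrix_class T (sbr T X (G b))" for b
    using X g by (simp add: class_bracket)
  have sum: "(\<Oplus>\<^bsub>?G\<^esub>c\<in>?A. single T a X c \<otimes>\<^bsub>?G\<^esub> g (b - c)) = matrix_class T (sbr T X (G (b - a)))" for b
  proof (cases "matrix_class T X = \<zero>\<^bsub>?G\<^esub>")
    case True
    have "matrix_class T (sbr T X (G (b - a))) = \<zero>\<^bsub>?G\<^esub> \<otimes>\<^bsub>?G\<^esub> g (b - a)"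
      using bracket True by simp
    also have "\<dots> = \<zero>\<^bsub>?G\<^esub>"
      using g by (simp add: class_zero class_bracket super_bracket_zero)
    finally show ?thesis using True by (simp add: A)
  next
    case False
    have sum_a: "(\<Oplus>\<^bsub>?G\<^esub>c\<in>{a}. single T a X c \<otimes>\<^bsub>?G\<^esub> g (b - c)) = matrix_class T (sbr T X (G (b - a)))"
      using closed' by (subst G.finsum_insert) (auto simp: single_def bracket)
    have A_a: "?A = {a}" using False A by simp
    show ?thesis unfolding A_a by (rule sum_a)
  qed
  have last: "(s' * of_int b) \<odot>\<^bsub>?G\<^esub> single T a X b = \<zero>\<^bsub>?G\<^esub>" for b
    using s zero_smult_class[OF X] smult_zero_class
    by (auto simp: single_def class_zero[symmetric])
  have minus: "x \<ominus>\<^bsub>?G\<^esub> \<zero>\<^bsub>?G\<^esub> = x" if "x = matrix_class T M" "M \<in> mats T" for x M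
  proof -
    have neg: "\<ominus>\<^bsub>?G\<^esub> \<zero>\<^bsub>?G\<^esub> = \<zero>\<^bsub>?G\<^esub>"
      by (rule G.minus_equality) simp_all
    have "x \<ominus>\<^bsub>?G\<^esub> \<zero>\<^bsub>?G\<^esub> = x \<oplus>\<^bsub>?G\<^esub> \<zero>\<^bsub>?G\<^esub>" unfolding a_minus_def neg ..
    also have "\<dots> = x" using that by (simp add: class_zero class_add right_add_zero_mat)
    finally show ?thesis .
  qed
  have sum2: "matrix_class T (sbr T X (G (b - a))) \<oplus>\<^bsub>?G\<^esub> ((s * of_int b) \<odot>\<^bsub>?G\<^esub> g b) =
      matrix_class T (sbr T X (G (b - a)) + (s * of_int b) \<cdot>\<^sub>m G b)" for b
    using X g by (simp add: class_smult class_add)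
  have car: "sbr T X (G (b - a)) + (s * of_int b) \<cdot>\<^sub>m G b \<in> mats T" for b
    using X g by simp
  have first: "(\<Oplus>\<^bsub>?G\<^esub>c\<in>?A. single T a X c \<otimes>\<^bsub>?G\<^esub> g (b - c))
      \<oplus>\<^bsub>?G\<^esub> ((s * of_int b) \<odot>\<^bsub>?G\<^esub> g b) \<ominus>\<^bsub>?G\<^esub> ((s' * of_int b) \<odot>\<^bsub>?G\<^esub> single T a X b)
      = matrix_class T (sbr T X (G (b - a)) + (s * of_int b) \<cdot>\<^sub>m G b)" for b
    unfolding sum last sum2 by (rule minus[OF refl car])
  have second: "(\<Sum>c\<in>?A. of_int c * kappa T (single T a X c) (g (- c))) =
    (if matrix_class T X = \<zero>\<^bsub>?G\<^esub> then 0 else of_int a * kappa T (matrix_class T X) (g (- a)))"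
    unfolding A by (auto simp: single_def)
  show ?thesis unfolding affine_simps(5) first second ..
qed

lemma fin_eigenspace_class:
  assumes "X \<in> matrix_set T" "sigma_mat T X = \<zeta> ^ r \<cdot>\<^sub>m X"
  shows "matrix_class T X \<in> fin_eigenspace T \<zeta> r"
  using assms matrix_set_carrier[OF assms(1)]
  by (simp add: fin_eigenspace_def fin_superalgebra_simps(1) sigma_class class_smult)

lemma sigma_mat_zero: "sigma_mat T (zmat T) = zmat T"
  using sigma_mat_scalar[OF scalar_ideal_zero[of T]] by auto

lemma zero_fin_eigenspace: "matrix_class T (zmat T) \<in> fin_eigenspace T \<zeta> r"
  by (rule fin_eigenspace_class) (auto simp: sigma_mat_zero)

lemma single_carrier:
  assumes "X \<in> matrix_set T" "sigma_mat T X = \<zeta> ^ nat (a mod int (sigma_order T)) \<cdot>\<^sub>m X"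
  shows "(single T a X, r, s) \<in> carrier (affine T \<zeta>)"
proof -
  have "finite {b. single T a X b \<noteq> \<zero>\<^bsub>fin T\<^esub>}"
    by (rule finite_subset[of _ "{a}"]) (auto simp: single_def class_zero)
  then show ?thesis
    using fin_eigenspace_class[OF assms] zero_fin_eigenspace by (auto simp: affine_simps single_def)
qed

lemma fin_parity_homogeneous:
  "fin_parity T i = matrix_class T ` {X \<in> matrix_set T. homogeneous T i X}"
  by (simp add: fin_parity_def homogeneous_def)

lemma homogeneous_zero: "homogeneous T i (zmat T)"
  by (auto simp: homogeneous_def odd_part_def even_part_def)

lemma single_parity:
  assumes "(single T a X, r, s) \<in> carrier (affine T \<zeta>)" "X \<in> matrix_set T" "homogeneous T i X" "i = 0 \<or> r = 0 \<and> s = 0"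
  shows "(single T a X, r, s) \<in> affine_parity T \<zeta> i"
  using assms homogeneous_zero matrix_set_zero
  by (auto simp: affine_parity_def fin_parity_homogeneous single_def)

lemma affine_carrierE:
  assumes "(f, r, s) \<in> carrier (affine T \<zeta>)"
  obtains F where "\<And>b. f b = matrix_class T (F b)" "\<And>b. F b \<in> matrix_set T"
proof -
  have "\<exists>X. f b = matrix_class T X \<and> X \<in> matrix_set T" for b
  proof -
    have "f b \<in> matrix_class T ` matrix_set T"
      using assms by (auto simp: affine_simps fin_eigenspace_def fin_superalgebra_simps(1))
    then show ?thesis by blast
  qed
  then show thesis using that by metis
qed

section \<open>The Cartan subalgebra\<close>

lemma cartan_matsD:
  assumes "Y \<in> cartan_mats T"
  shows "Y \<in> matrix_set T" "Y \<in> mats T" "diagonal_mat Y" "sigma_mat T Y = Y"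
    "homogeneous T 0 Y"
proof -
  show "Y \<in> matrix_set T" "Y \<in> mats T" "diagonal_mat Y" "sigma_mat T Y = Y"
    using assms matrix_set_carrier by (auto simp: cartan_mats_def)
  then show "homogeneous T 0 Y"
    by (subst homogeneous_parts(1)) (auto simp: diagonal_mat_def)
qed

lemma cartan_mats_add: "Y \<in> cartan_mats T \<Longrightarrow> Y' \<in> cartan_mats T \<Longrightarrow> Y + Y' \<in> cartan_mats T"
  by (auto simp: cartan_mats_iff diagonal_mat_def)

lemma cartan_mats_smult: "Y \<in> cartan_mats T \<Longrightarrow> z \<cdot>\<^sub>m Y \<in> cartan_mats T"
  by (auto simp: cartan_mats_iff diagonal_mat_def)

lemma cartan_mats_zero: "zmat T \<in> cartan_mats T"
  by (auto simp: cartan_mats_iff diagonal_mat_def)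

lemma cartan_mats_mask: "Y \<in> cartan_mats T \<Longrightarrow> mask (size1 T) Q Y \<in> cartan_mats T"
  by (auto simp: cartan_mats_iff diagonal_mat_def mask_def)

text \<open>
  If \<open>\<sigma>\<close> fixes the coset of \<open>X\<close> then \<open>\<sigma> X = X + c\<close> for a scalar \<open>c\<close>, which is zero because \<open>X\<close> vanishes on
  the other block.
\<close>

lemma block_cartan_class:
  assumes T: "admissible T" and S: "S = {..<size1 T} \<or> S = {size1 T..<msize T}"
  shows "fin_eigenspace T \<zeta> 0 \<inter> block_diagonals T S = matrix_class T ` (cartan_mats T \<inter> block_ideal T S)"
proof (intro equalityI subsetI)
  fix C assume "C \<in> fin_eigenspace T \<zeta> 0 \<inter> block_diagonals T S"
  then obtain X where X: "C = matrix_class T X" "X \<in> block_ideal T S" "diagonal_mat X"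
    "sigma_mat T ` C = 1 \<odot>\<^bsub>fin T\<^esub> C"
    by (auto simp: fin_eigenspace_def block_diagonals_def)
  have X': "X \<in> matrix_set T" "X \<in> mats T"
    using X(2) matrix_set_carrier by (auto simp: block_ideal_def)
  have "matrix_class T (sigma_mat T X) = matrix_class T X"
    using X X' by (simp add: sigma_class class_smult smult_one_mat)
  then have "sigma_mat T X - X \<in> scalar_ideal T"
    using X' sigma_mat_carrier[OF X'(2)] by (simp add: matrix_class_eq_iff)
  then obtain c where c: "sigma_mat T X - X = c \<cdot>\<^sub>m 1\<^sub>m (msize T)" by (rule scalar_idealE)
  \<comment> \<open>an index of the other block\<close>
  define i where "i = (if S = {..<size1 T} then size1 T else 0)"
  have i: "i < msize T" "dual_index T i \<notin> S" "swap_index T i \<notin> S" "i \<notin> S"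
    using msize_pos[OF T] S by (auto simp: i_def)
  have "X $$ (b, b) = 0" if "b < msize T" "b \<notin> S" for b
    using X(2) that by (auto simp: block_ideal_def)
  then have "X $$ (i, i) = 0" "X $$ (dual_index T i, dual_index T i) = 0" "X $$ (swap_index T i, swap_index T i) = 0"
    using i by simp_all
  then have "sigma_mat T X $$ (i, i) = 0" "X $$ (i, i) = 0"
    using i X'(2) by (cases "orthosymplectic T"; auto simp: sigma_mat_eq_swap sigma_mat_eq_twist twist_def)+
  then have "c = 0"
    using arg_cong[OF c, of "\<lambda>M. M $$ (i, i)"] i X'(2) by simp
  have "sigma_mat T X = X"
  proof (rule eq_matI)
    fix a b assume "a < dim_row X" "b < dim_col X"
    then show "sigma_mat T X $$ (a, b) = X $$ (a, b)"
      using arg_cong[OF c, of "\<lambda>M. M $$ (a, b)"] X'(2) \<open>c = 0\<close> by auto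
  qed (use X' sigma_mat_carrier[OF X'(2)] in auto)
  then show "C \<in> matrix_class T ` (cartan_mats T \<inter> block_ideal T S)"
    using X X' by (auto simp: cartan_mats_def)
next
  fix C assume "C \<in> matrix_class T ` (cartan_mats T \<inter> block_ideal T S)"
  then obtain Y where Y: "C = matrix_class T Y" "Y \<in> cartan_mats T" "Y \<in> block_ideal T S" by auto
  have "sigma_mat T Y = \<zeta> ^ 0 \<cdot>\<^sub>m Y" using cartan_matsD[OF Y(2)] by auto
  then show "C \<in> fin_eigenspace T \<zeta> 0 \<inter> block_diagonals T S"
    using Y cartan_matsD[OF Y(2)] fin_eigenspace_class[of Y T \<zeta> 0] by (auto simp: block_diagonals_def)
qed

lemma toral_add:
  "Y \<in> mats T \<Longrightarrow> Y' \<in> mats T \<Longrightarrow>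
    toral T Y r s \<oplus>\<^bsub>affine T \<zeta>\<^esub> toral T Y' r' s' = toral T (Y + Y') (r + r') (s + s')"
  by (auto simp: toral_def single_def affine_simps class_add intro!: ext)

lemma toral_smult:
  assumes "Y \<in> mats T"
  shows "z \<odot>\<^bsub>affine T \<zeta>\<^esub> toral T Y r s = toral T (z \<cdot>\<^sub>m Y) (z * r) (z * s)"
proof -
  have "z \<cdot>\<^sub>m zmat T = zmat T" by auto
  then show ?thesis
    using assms by (auto simp: toral_def single_def affine_simps class_smult intro!: ext)
qed

text \<open>
  The two halves of the Cartan subalgebra are recombined by splitting a diagonal matrix into its blocks.
\<close>

lemma cartan_eq:
  assumes T: "admissible T"
  shows "cartan T \<zeta> = {toral T Y r s | Y r s. Y \<in> cartan_mats T}"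
proof -
  have partial: "partial_cartan T \<zeta> S = {toral T Y r s | Y r s. Y \<in> cartan_mats T \<and> Y \<in> block_ideal T S}"
    if "S = {..<size1 T} \<or> S = {size1 T..<msize T}" for S
    unfolding partial_cartan_def block_cartan_class[OF T that] toral_def single_def class_zero
    by fastforce
  show ?thesis
  proof (intro equalityI subsetI)
    fix h assume "h \<in> cartan T \<zeta>"
    then obtain Y r s Y' r' s' where "Y \<in> cartan_mats T" "Y' \<in> cartan_mats T"
      "h = toral T Y r s \<oplus>\<^bsub>affine T \<zeta>\<^esub> toral T Y' r' s'"
      unfolding cartan_def set_add_def' by (auto simp: partial)
    then show "h \<in> {toral T Y r s | Y r s. Y \<in> cartan_mats T}"
      using cartan_mats_add[of Y T Y'] cartan_matsD(2) by (auto simp: toral_add)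
  next
    fix h assume "h \<in> {toral T Y r s | Y r s. Y \<in> cartan_mats T}"
    then obtain Y r s where h: "h = toral T Y r s" "Y \<in> cartan_mats T" by auto
    define Y1 where "Y1 = mask (size1 T) (\<lambda>a b. a \<and> b) Y"
    define Y2 where "Y2 = mask (size1 T) (\<lambda>a b. \<not> a \<and> \<not> b) Y"
    have mem: "Y1 \<in> cartan_mats T" "Y2 \<in> cartan_mats T"
      unfolding Y1_def Y2_def by (rule cartan_mats_mask[OF h(2)])+
    have block: "Y1 \<in> block_ideal T {..<size1 T}" "Y2 \<in> block_ideal T {size1 T..<msize T}"
      using cartan_matsD(1)[OF mem(1)] cartan_matsD(1)[OF mem(2)] cartan_matsD(2)[OF h(2)]
      by (auto simp: block_ideal_def Y1_def Y2_def mask_def split: if_splits)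
    have "Y = Y1 + Y2"
      using cartan_matsD(2,3)[OF h(2)] by (intro eq_matI) (auto simp: Y1_def Y2_def mask_def diagonal_mat_def)
    then have "h = toral T Y1 r s \<oplus>\<^bsub>affine T \<zeta>\<^esub> toral T Y2 0 0"
      using mem cartan_matsD(2) by (simp add: h toral_add)
    moreover have "toral T Y1 r s \<in> partial_cartan T \<zeta> {..<size1 T}"
      using mem block by (subst partial) auto
    moreover have "toral T Y2 0 0 \<in> partial_cartan T \<zeta> {size1 T..<msize T}"
      using mem block by (subst partial) auto
    ultimately show "h \<in> cartan T \<zeta>"
      unfolding cartan_def set_add_def' by blast
  qed
qed

section \<open>The form on the Cartan subalgebra\<close>

lemma affine_form_toral:
  assumes "Y \<in> cartan_mats T" "Y' \<in> cartan_mats T"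
  shows "affine_form T (toral T Y r s) (toral T Y' r' s') = str T (Y * Y') + r * s' + s * r'"
proof -
  let ?G = "fin_superalgebra T"
  have A: "{a. single T 0 Y a \<noteq> \<zero>\<^bsub>?G\<^esub>} = (if matrix_class T Y = \<zero>\<^bsub>?G\<^esub> then {} else {0})"
    by (auto simp: single_def class_zero)
  have kappa: "kappa T (matrix_class T Y) (matrix_class T Y') = str T (Y * Y')"
    using assms cartan_matsD(1) by (simp add: kappa_class)
  have "str T (Y * Y') = 0" if "matrix_class T Y = \<zero>\<^bsub>?G\<^esub>"
  proof -
    have "kappa T (matrix_class T Y) (matrix_class T Y') = str T (zmat T * Y')"
      using that assms(2) cartan_matsD(1) by (simp add: class_zero kappa_class)
    also have "\<dots> = 0"
      using supertrace_scalar_mult(1)[OF cartan_matsD(1)[OF assms(2)] scalar_ideal_zero] .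
    finally show ?thesis using kappa by simp
  qed
  then have "(\<Sum>a\<in>{a. single T 0 Y a \<noteq> \<zero>\<^bsub>?G\<^esub>}. kappa T (single T 0 Y a) (single T 0 Y' (- a))) = str T (Y * Y')"
    unfolding A by (auto simp: single_def kappa)
  then show ?thesis by (simp add: toral_def affine_form_simp)
qed

lemma supertrace_zero_mult:
  "Y \<in> cartan_mats T \<Longrightarrow> str T (zmat T * Y) = 0"
  "Y \<in> cartan_mats T \<Longrightarrow> str T (Y * zmat T) = 0"
  using supertrace_scalar_mult[OF cartan_matsD(1) scalar_ideal_zero] by auto

text \<open>
  Pairing \<open>Y\<close> with its complex conjugate, negated on the second block, gives the sum of the squared
  absolute values.
\<close>

lemma cartan_form_nondegenerate:
  assumes Y: "Y \<in> cartan_mats T" and orth: "\<And>Y'. Y' \<in> cartan_mats T \<Longrightarrow> str T (Y * Y') = 0"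
  shows "Y = zmat T"
proof -
  let ?g = "\<lambda>i. if i < size1 T then 1 else - 1 :: complex"
  define V where "V = mat (msize T) (msize T) (\<lambda>(i, j). if i < size1 T then cnj (Y $$ (i, j)) else - cnj (Y $$ (i, j)))"
  have Y': "Y \<in> mats T" "diagonal_mat Y" using cartan_matsD[OF Y] by auto
  have V: "V \<in> cartan_mats T"
    using Y by (auto simp: cartan_mats_iff V_def diagonal_mat_def)
  have "0 = str T (Y * V)" using orth[OF V] by simp
  also have "\<dots> = (\<Sum>i<msize T. ?g i * (Y $$ (i, i) * V $$ (i, i)))"
    by (rule supertrace_mult_diagonal[OF Y'(1)]) (use cartan_matsD[OF V] in auto)
  also have "\<dots> = (\<Sum>i<msize T. of_real ((cmod (Y $$ (i, i)))\<^sup>2))"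
    by (intro sum.cong) (auto simp: V_def cnj_mult_cmod)
  finally have "(\<Sum>i<msize T. (cmod (Y $$ (i, i)))\<^sup>2) = 0"
    by (metis of_real_eq_0_iff of_real_sum)
  then have "Y $$ (i, i) = 0" if "i < msize T" for i
    using that by (simp add: sum_nonneg_eq_0_iff)
  then have "Y $$ (i, j) = 0" if "i < msize T" "j < msize T" for i j
    using that Y' by (cases "i = j") (auto simp: diagonal_mat_def)
  then show ?thesis using Y' by (intro eq_matI) auto
qed

lemma dual_vector_eq:
  assumes T: "admissible T" and Y: "Y \<in> cartan_mats T"
    and eq: "\<And>Y' r' s'. Y' \<in> cartan_mats T \<Longrightarrow>
      \<alpha> (toral T Y' r' s') = str T (Y * Y') + r * s' + s * r'"
  shows "dual_vector (affine_form T) (cartan T \<zeta>) \<alpha> = toral T Y r s"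
  unfolding dual_vector_def
proof (rule the_equality)
  show "toral T Y r s \<in> cartan T \<zeta> \<and> (\<forall>h\<in>cartan T \<zeta>. affine_form T (toral T Y r s) h = \<alpha> h)"
    using Y eq by (auto simp: cartan_eq[OF T] affine_form_toral)
next
  fix t assume t: "t \<in> cartan T \<zeta> \<and> (\<forall>h\<in>cartan T \<zeta>. affine_form T t h = \<alpha> h)"
  then obtain Y1 r1 s1 where t1: "t = toral T Y1 r1 s1" "Y1 \<in> cartan_mats T"
    by (auto simp: cartan_eq[OF T])
  have agree: "str T (Y1 * Y') + r1 * s' + s1 * r' = str T (Y * Y') + r * s' + s * r'"
    if "Y' \<in> cartan_mats T" for Y' r' s'
  proof -
    have "toral T Y' r' s' \<in> cartan T \<zeta>" using that by (auto simp: cartan_eq[OF T])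
    then have "affine_form T t (toral T Y' r' s') = \<alpha> (toral T Y' r' s')" using t by blast
    then show ?thesis using that t1 eq[OF that] by (simp add: affine_form_toral)
  qed
  have "r1 = r" "s1 = s"
    using agree[OF cartan_mats_zero, of 1 0] agree[OF cartan_mats_zero, of 0 1] t1 Y
    by (simp_all add: supertrace_zero_mult)
  have car: "Y1 \<in> mats T" "Y \<in> mats T"
    using t1 Y cartan_matsD(2) by auto
  define V where "V = Y1 + (- 1) \<cdot>\<^sub>m Y"
  have V: "V \<in> cartan_mats T" unfolding V_def by (intro cartan_mats_add cartan_mats_smult t1 Y)
  have "V = zmat T"
  proof (rule cartan_form_nondegenerate[OF V])
    fix Y' assume Y': "Y' \<in> cartan_mats T"
    have Y'car: "Y' \<in> mats T" "diagonal_mat Y'" using cartan_matsD[OF Y'] by auto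
    have Vcar: "V \<in> mats T" using V by (rule cartan_matsD)
    show "str T (V * Y') = 0"
      using agree[OF Y', of 0 0]
      unfolding supertrace_mult_diagonal[OF Vcar Y'car] supertrace_mult_diagonal[OF car(1) Y'car]
        supertrace_mult_diagonal[OF car(2) Y'car]
      using car by (simp add: V_def algebra_simps sum_subtractf)
  qed
  then have "V $$ (i, j) = 0" if "i < msize T" "j < msize T" for i j using that by simp
  then have "Y1 = Y" using car by (intro eq_matI) (auto simp: V_def)
  then show "t = toral T Y r s" using t1 \<open>r1 = r\<close> \<open>s1 = s\<close> by simp
qed

section \<open>Real roots\<close>

lemma toral_in_cartan: "admissible T \<Longrightarrow> Y \<in> cartan_mats T \<Longrightarrow> toral T Y r s \<in> cartan T \<zeta>"
  by (auto simp: cartan_eq)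

lemma delta_toral: "admissible T \<Longrightarrow> Y \<in> cartan_mats T \<Longrightarrow> delta T \<zeta> (toral T Y r s) = s"
  using toral_in_cartan[of T Y r s \<zeta>] by (simp add: delta_def toral_def)

text \<open>
  \<open>Y \<otimes> 1 + r c + s d\<close> is the vector of the Cartan subalgebra that corresponds to \<open>\<alpha>\<close> under the form.
\<close>

definition represents :: "affine_type \<Rightarrow> (aff \<Rightarrow> complex) \<Rightarrow> complex mat \<Rightarrow> complex \<Rightarrow> complex \<Rightarrow> bool" where
  "represents T \<alpha> Y r s \<longleftrightarrow> Y \<in> cartan_mats T \<and> (\<forall>Y'\<in>cartan_mats T. \<forall>r' s'.
     \<alpha> (toral T Y' r' s') = str T (Y * Y') + r * s' + s * r')"

lemma dual_vector_represents:
  assumes "admissible T" "represents T \<alpha> Y r s"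
  shows "dual_vector (affine_form T) (cartan T \<zeta>) \<alpha> = toral T Y r s"
  using assms by (intro dual_vector_eq) (auto simp: represents_def)

text \<open>
  If nothing represents \<open>\<alpha>\<close> then the defining description is unsatisfiable and yields a value that does not
  depend on \<open>\<alpha>\<close>. With this, values of the transferred form can be compared without constructing
  representing vectors.
\<close>

lemma dual_vector_undefined:
  assumes T: "admissible T" and "\<nexists>Y r s. represents T \<alpha> Y r s"
  shows "dual_vector (affine_form T) (cartan T \<zeta>) \<alpha> = (THE t. False)"
proof -
  have "\<not> (t \<in> cartan T \<zeta> \<and> (\<forall>h\<in>cartan T \<zeta>. affine_form T t h = \<alpha> h))" for t
  proof
    assume t: "t \<in> cartan T \<zeta> \<and> (\<forall>h\<in>cartan T \<zeta>. affine_form T t h = \<alpha> h)"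
    then obtain Y r s where Y: "t = toral T Y r s" "Y \<in> cartan_mats T" by (auto simp: cartan_eq[OF T])
    have "\<alpha> (toral T Y' r' s') = str T (Y * Y') + r * s' + s * r'"
      if Y': "Y' \<in> cartan_mats T" for Y' r' s'
    proof -
      have "affine_form T t (toral T Y' r' s') = \<alpha> (toral T Y' r' s')"
        using t toral_in_cartan[OF T Y'] by blast
      then show ?thesis using Y Y' by (simp add: affine_form_toral)
    qed
    then show False using assms(2) Y(2) unfolding represents_def by blast
  qed
  then have "(\<lambda>t. t \<in> cartan T \<zeta> \<and> (\<forall>h\<in>cartan T \<zeta>. affine_form T t h = \<alpha> h)) = (\<lambda>t. False)"
    by (intro ext) blast
  then show ?thesis by (simp only: dual_vector_def)
qed

text \<open>
  \<open>\<delta>\<close> is represented by \<open>c\<close>, so the shift only changes the central coordinate; vanishing of \<open>\<alpha>\<close> on \<open>c\<close>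
  means that the coordinate paired with it is zero.
\<close>

lemma dual_form_delta_shift:
  assumes T: "admissible T" and central: "\<alpha> (toral T (zmat T) 1 0) = 0"
  shows "dual_form (affine_form T) (cartan T \<zeta>) (delta_shift T \<zeta> \<alpha> m) (delta_shift T \<zeta> \<alpha> m)
    = dual_form (affine_form T) (cartan T \<zeta>) \<alpha> \<alpha>"
proof -
  have shift: "represents T (delta_shift T \<zeta> \<alpha> m) Y (r + of_int m) s \<longleftrightarrow> represents T \<alpha> Y r s" for Y r s
    using delta_toral[OF T] by (auto simp: represents_def delta_shift_def algebra_simps)
  show ?thesis
  proof (cases "\<exists>Y r s. represents T \<alpha> Y r s")
    case True
    then obtain Y r s where rep: "represents T \<alpha> Y r s" by blast
    then have Y: "Y \<in> cartan_mats T" by (simp add: represents_def)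
    have "s = 0"
      using rep central cartan_mats_zero[of T] Y by (simp add: represents_def supertrace_zero_mult)
    then show ?thesis
      unfolding dual_form_def dual_vector_represents[OF T rep]
        dual_vector_represents[OF T shift[THEN iffD2, OF rep]]
      using Y by (simp add: affine_form_toral)
  next
    case False
    moreover have "\<nexists>Y r s. represents T (delta_shift T \<zeta> \<alpha> m) Y r s"
    proof (intro notI, elim exE)
      fix Y r s assume "represents T (delta_shift T \<zeta> \<alpha> m) Y r s"
      then have "represents T \<alpha> Y (r - of_int m) s" using shift[of Y "r - of_int m" s] by simp
      then show False using False by blast
    qed
    ultimately show ?thesis by (simp add: dual_form_def dual_vector_undefined[OF T])
  qed
qed

lemma supertrace_smult_mult:
  assumes "Y \<in> cartan_mats T" "Y' \<in> cartan_mats T"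
  shows "str T (z \<cdot>\<^sub>m Y * Y') = z * str T (Y * Y')"
proof -
  have car: "Y \<in> mats T" "Y' \<in> mats T"
    using assms cartan_matsD(2) by auto
  then have "z \<cdot>\<^sub>m Y * Y' = z \<cdot>\<^sub>m (Y * Y')" by (rule mult_smult_assoc_mat)
  then show ?thesis using supertrace_smult[OF mult_carrier_mat[OF car], of "size1 T" z] by simp
qed

lemma represents_smult:
  assumes "represents T \<alpha> Y r s"
  shows "represents T (\<lambda>h. z * \<alpha> h) (z \<cdot>\<^sub>m Y) (z * r) (z * s)"
  using assms by (auto simp: represents_def cartan_mats_smult supertrace_smult_mult algebra_simps)

lemma dual_form_uminus:
  assumes T: "admissible T"
  shows "dual_form (affine_form T) (cartan T \<zeta>) (\<lambda>h. - \<alpha> h) (\<lambda>h. - \<alpha> h)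
    = dual_form (affine_form T) (cartan T \<zeta>) \<alpha> \<alpha>"
proof (cases "\<exists>Y r s. represents T \<alpha> Y r s")
  case True
  then obtain Y r s where rep: "represents T \<alpha> Y r s" by blast
  then have Y: "Y \<in> cartan_mats T" by (simp add: represents_def)
  have rep': "represents T (\<lambda>h. - \<alpha> h) ((- 1) \<cdot>\<^sub>m Y) (- r) (- s)"
    using represents_smult[OF rep, of "- 1"] by simp
  have neg: "(- 1) \<cdot>\<^sub>m Y \<in> cartan_mats T" using Y by (rule cartan_mats_smult)
  have car: "Y \<in> mats T" "(- 1) \<cdot>\<^sub>m Y \<in> mats T"
    using Y cartan_matsD(2) by auto
  have "(- 1) \<cdot>\<^sub>m Y * ((- 1) \<cdot>\<^sub>m Y) = (- 1) \<cdot>\<^sub>m ((- 1) \<cdot>\<^sub>m (Y * Y))"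
    using mult_smult_assoc_mat[OF car(1,2), of "- 1"] mult_smult_distrib[OF car(1,1), of "- 1"] by simp
  also have "\<dots> = Y * Y" using car by (intro eq_matI) auto
  finally show ?thesis
    unfolding dual_form_def dual_vector_represents[OF T rep] dual_vector_represents[OF T rep']
    using Y neg by (simp add: affine_form_toral)
next
  case False
  moreover have "\<nexists>Y r s. represents T (\<lambda>h. - \<alpha> h) Y r s"
    using represents_smult[of T "\<lambda>h. - \<alpha> h" _ _ _ "- 1"] False by auto
  ultimately show ?thesis by (simp add: dual_form_def dual_vector_undefined[OF T])
qed

lemma dual_space_toral:
  assumes T: "admissible T" and \<alpha>: "\<alpha> \<in> aff_dual T \<zeta>" and Y: "Y \<in> cartan_mats T"
  shows "\<alpha> (toral T Y r s) = \<alpha> (toral T Y 0 0) + r * \<alpha> (toral T (zmat T) 1 0)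
    + s * \<alpha> (toral T (zmat T) 0 1)"
proof -
  let ?O = "zmat T :: complex mat"
  note in_cartan = toral_in_cartan[OF T, of _ _ _ \<zeta>]
  have car: "Y \<in> mats T" using Y by (rule cartan_matsD)
  have O: "?O \<in> cartan_mats T" by (rule cartan_mats_zero)
  have add: "\<alpha> (h \<oplus>\<^bsub>affine T \<zeta>\<^esub> h') = \<alpha> h + \<alpha> h'" if "h \<in> cartan T \<zeta>" "h' \<in> cartan T \<zeta>" for h h'
    using \<alpha> that by (auto simp: dual_space_def)
  have smult: "\<alpha> (z \<odot>\<^bsub>affine T \<zeta>\<^esub> h) = z * \<alpha> h" if "h \<in> cartan T \<zeta>" for z h
    using \<alpha> that by (auto simp: dual_space_def)
  have scale: "z \<cdot>\<^sub>m ?O = ?O" for z by auto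
  have 1: "\<alpha> (toral T ?O r 0) = r * \<alpha> (toral T ?O 1 0)"
    using smult[OF in_cartan[OF O, of 1 0], of r] by (simp add: toral_smult scale)
  have 2: "\<alpha> (toral T ?O 0 s) = s * \<alpha> (toral T ?O 0 1)"
    using smult[OF in_cartan[OF O, of 0 1], of s] by (simp add: toral_smult scale)
  have 3: "\<alpha> (toral T ?O r s) = \<alpha> (toral T ?O r 0) + \<alpha> (toral T ?O 0 s)"
    using add[OF in_cartan[OF O, of r 0] in_cartan[OF O, of 0 s]] by (simp add: toral_add)
  have "\<alpha> (toral T Y r s) = \<alpha> (toral T Y 0 0) + \<alpha> (toral T ?O r s)"
    using add[OF in_cartan[OF Y, of 0 0] in_cartan[OF O, of r s]] car
    by (simp add: toral_add right_add_zero_mat)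
  then show ?thesis using 1 2 3 by simp
qed

lemma toral_bracket:
  assumes Y: "Y \<in> cartan_mats T" and f: "\<And>b. f b = matrix_class T (F b)" "\<And>b. F b \<in> matrix_set T"
  shows "toral T Y r s \<otimes>\<^bsub>affine T \<zeta>\<^esub> (f, r', s') =
    (\<lambda>b. matrix_class T (sbr T Y (F b) + (s * of_int b) \<cdot>\<^sub>m F b), 0, 0)"
  unfolding toral_def
proof (subst affine_bracket_single[where G = F and a = 0])
  show "F b \<in> mats T" for b by (rule matrix_set_carrier[OF f(2)])
  show "sbr T Y (F b) \<in> matrix_set T" for b by (rule cartan_mats_bracket[OF Y f(2)])
  show "(\<lambda>b. matrix_class T (sbr T Y (F (b - 0)) + (s * of_int b) \<cdot>\<^sub>m F b),
      if matrix_class T Y = \<zero>\<^bsub>fin T\<^esub> then 0 else of_int 0 * kappa T (matrix_class T Y) (f (- 0)), 0) =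
    (\<lambda>b. matrix_class T (sbr T Y (F b) + (s * of_int b) \<cdot>\<^sub>m F b), 0, 0)"
    by simp
qed (rule cartan_matsD(2)[OF Y] f(1) disjI2 refl)+

lemma root_space_iff:
  assumes T: "admissible T" and x: "(f, r', s') \<in> carrier (affine T \<zeta>)"
    and f: "\<And>b. f b = matrix_class T (F b)" "\<And>b. F b \<in> matrix_set T"
  shows "(f, r', s') \<in> aff_root_space T \<zeta> \<alpha> \<longleftrightarrow>
    (\<forall>Y\<in>cartan_mats T. \<forall>r s. let a = \<alpha> (toral T Y r s) in
      (\<forall>b. sbr T Y (F b) + (s * of_int b) \<cdot>\<^sub>m F b - a \<cdot>\<^sub>m F b \<in> scalar_ideal T) \<and> a * r' = 0 \<and> a * s' = 0)"
proof -
  have car: "F b \<in> mats T" for b by (rule matrix_set_carrier[OF f(2)])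
  have "toral T Y r s \<otimes>\<^bsub>affine T \<zeta>\<^esub> (f, r', s') = a \<odot>\<^bsub>affine T \<zeta>\<^esub> (f, r', s') \<longleftrightarrow>
      (\<forall>b. sbr T Y (F b) + (s * of_int b) \<cdot>\<^sub>m F b - a \<cdot>\<^sub>m F b \<in> scalar_ideal T) \<and> a * r' = 0 \<and> a * s' = 0"
    if Y: "Y \<in> cartan_mats T" for Y r s a
  proof -
    have "sbr T Y (F b) + (s * of_int b) \<cdot>\<^sub>m F b \<in> mats T" for b
      using car cartan_matsD(2)[OF Y] by simp
    then have "matrix_class T (sbr T Y (F b) + (s * of_int b) \<cdot>\<^sub>m F b) = a \<odot>\<^bsub>fin T\<^esub> f b \<longleftrightarrow>
        sbr T Y (F b) + (s * of_int b) \<cdot>\<^sub>m F b - a \<cdot>\<^sub>m F b \<in> scalar_ideal T" for b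
      using car by (simp add: f(1) class_smult matrix_class_eq_iff)
    then show ?thesis
      unfolding toral_bracket[OF Y f] affine_simps(4) by (auto simp: fun_eq_iff)
  qed
  note key = this
  have "(f, r', s') \<in> aff_root_space T \<zeta> \<alpha> \<longleftrightarrow>
      (\<forall>h\<in>cartan T \<zeta>. h \<otimes>\<^bsub>affine T \<zeta>\<^esub> (f, r', s') = \<alpha> h \<odot>\<^bsub>affine T \<zeta>\<^esub> (f, r', s'))"
    using x by (simp only: root_space_def mem_Collect_eq simp_thms)
  also have "\<dots> \<longleftrightarrow> (\<forall>Y\<in>cartan_mats T. \<forall>r s.
      toral T Y r s \<otimes>\<^bsub>affine T \<zeta>\<^esub> (f, r', s') = \<alpha> (toral T Y r s) \<odot>\<^bsub>affine T \<zeta>\<^esub> (f, r', s'))"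
    unfolding cartan_eq[OF T] by blast
  finally show ?thesis using key by (simp only: Let_def cong: ball_cong)
qed

lemma affine_zero:
  assumes T: "admissible T"
  shows "\<zero>\<^bsub>affine T \<zeta>\<^esub> \<in> aff_root_space T \<zeta> \<alpha>"
proof -
  let ?O = "zmat T :: complex mat"
  have carrier: "(\<lambda>_. \<zero>\<^bsub>fin T\<^esub>, 0, 0) \<in> carrier (affine T \<zeta>)"
    using zero_fin_eigenspace by (auto simp: affine_simps(1) class_zero)
  have zero: "sbr T Y ?O + z \<cdot>\<^sub>m ?O - w \<cdot>\<^sub>m ?O \<in> scalar_ideal T" if "Y \<in> cartan_mats T" for Y z w
  proof -
    have "sbr T Y ?O = ?O"
      by (rule super_bracket_zero(2)[OF cartan_matsD(2)[OF that]])
    then have "sbr T Y ?O + z \<cdot>\<^sub>m ?O - w \<cdot>\<^sub>m ?O = ?O" by (auto intro!: eq_matI)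
    then show ?thesis by simp
  qed
  show ?thesis
    unfolding affine_simps(2) root_space_iff[OF T carrier class_zero matrix_set_zero] Let_def
    using zero by (simp only: mult_zero_right) blast
qed

lemma cnj_root_power:
  assumes "primitive_root_of_unity (sigma_order T) \<zeta>"
  shows "cmod (\<zeta> ^ k) = 1" and "cnj (\<zeta> ^ nat (a mod int (sigma_order T))) = \<zeta> ^ nat (- a mod int (sigma_order T))"
proof -
  let ?N = "sigma_order T"
  have N: "0 < ?N" by (cases T) auto
  have root: "\<zeta> ^ ?N = 1" using assms by (simp add: primitive_root_of_unity_def)
  then have "cmod \<zeta> ^ ?N = 1" by (metis norm_one norm_power)
  then have "cmod \<zeta> = 1" using power_eq_imp_eq_base[of "cmod \<zeta>" ?N 1] N by simp
  then show norm: "cmod (\<zeta> ^ k) = 1" for k by (simp add: norm_power)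
  let ?k = "nat (a mod int ?N)" and ?k' = "nat (- a mod int ?N)"
  have "int (?k + ?k') = a mod int ?N + - a mod int ?N" using N by simp
  then have "int ?N dvd int (?k + ?k')"
    by (simp add: mod_add_eq dvd_eq_mod_eq_0)
  then have "?N dvd ?k + ?k'" by (simp only: int_dvd_int_iff)
  then obtain q where "?k + ?k' = ?N * q" by (auto elim: dvdE)
  then have "\<zeta> ^ ?k * \<zeta> ^ ?k' = 1" by (simp add: root power_mult flip: power_add)
  moreover have "\<zeta> ^ ?k * cnj (\<zeta> ^ ?k) = 1" using norm[of ?k] by (simp only: cnj_mult_cmod) simp
  ultimately have eq: "\<zeta> ^ ?k * cnj (\<zeta> ^ ?k) = \<zeta> ^ ?k * \<zeta> ^ ?k'" by (simp only:)
  have nz: "\<zeta> ^ ?k \<noteq> 0" using norm[of ?k] by (metis norm_zero zero_neq_one)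
  show "cnj (\<zeta> ^ ?k) = \<zeta> ^ ?k'" by (rule iffD1[OF mult_left_cancel[OF nz] eq])
qed

section \<open>Pairs of opposite root vectors\<close>

lemma roots_nonzero_vector:
  assumes T: "admissible T" and \<alpha>: "\<alpha> \<in> roots T \<zeta>"
  obtains x where "x \<in> aff_root_space T \<zeta> \<alpha>" "x \<noteq> \<zero>\<^bsub>affine T \<zeta>\<^esub>"
proof -
  have "aff_root_space T \<zeta> \<alpha> \<noteq> {\<zero>\<^bsub>affine T \<zeta>\<^esub>}"
    using \<alpha> by (simp add: roots_def root_set_def)
  then show thesis using that affine_zero[OF T, of \<zeta> \<alpha>] by blast
qed

lemma real_root_not_imaginary:
  assumes T: "admissible T" and \<alpha>: "\<alpha> \<in> real_roots T \<zeta>"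
  shows "\<not> represents T \<alpha> (zmat T) r 0"
proof
  assume "represents T \<alpha> (zmat T) r 0"
  moreover have "str T (zmat T) = 0"
    by (rule supertrace_zero_diagonal) simp
  ultimately have "dual_form (affine_form T) (cartan T \<zeta>) \<alpha> \<alpha> = 0"
    using cartan_mats_zero[of T]
    by (simp add: dual_form_def dual_vector_represents[OF T] affine_form_toral supertrace_zero_mult)
  then show False using \<alpha> by (simp add: real_roots_def)
qed

text \<open>
  The Cartan subalgebra acts separately on the coefficient of each power of \<open>t\<close> and commutes with
  \<open>c\<close> and \<open>d\<close>. So either some coefficient of the root vector is nonzero and is itself an eigenvector,
  or the root vector is a combination of \<open>c\<close> and \<open>d\<close> and the root is zero.
\<close>

lemma root_vector_component:
  assumes T: "admissible T" and \<alpha>: "\<alpha> \<in> aff_dual T \<zeta>"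
    and x: "x \<in> aff_root_space T \<zeta> \<alpha>" "x \<noteq> \<zero>\<^bsub>affine T \<zeta>\<^esub>"
  shows "\<alpha> (toral T (zmat T) 1 0) = 0"
    and "(\<forall>h\<in>cartan T \<zeta>. \<alpha> h = 0) \<or> (\<exists>a X. X \<in> matrix_set T \<and> X \<notin> scalar_ideal T \<and>
      matrix_class T X \<in> fin_eigenspace T \<zeta> (nat (a mod int (sigma_order T))) \<and>
      \<alpha> (toral T (zmat T) 0 1) = of_int a \<and>
      (\<forall>Y\<in>cartan_mats T. sbr T Y X - \<alpha> (toral T Y 0 0) \<cdot>\<^sub>m X \<in> scalar_ideal T))"
proof -
  let ?O = "zmat T :: complex mat"
  obtain f r' s' where x_eq: "x = (f, r', s')" by (cases x)
  have car_x: "(f, r', s') \<in> carrier (affine T \<zeta>)" using x x_eq by (simp add: root_space_def)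
  obtain F where f: "\<And>b. f b = matrix_class T (F b)" "\<And>b. F b \<in> matrix_set T"
    by (rule affine_carrierE[OF car_x]) (rule that)
  have car: "F b \<in> mats T" for b by (rule matrix_set_carrier[OF f(2)])
  have eigen: "sbr T Y (F b) + (s * of_int b) \<cdot>\<^sub>m F b - \<alpha> (toral T Y r s) \<cdot>\<^sub>m F b \<in> scalar_ideal T"
    "\<alpha> (toral T Y r s) * r' = 0" "\<alpha> (toral T Y r s) * s' = 0"
    if "Y \<in> cartan_mats T" for Y r s b
    using x(1) that unfolding x_eq root_space_iff[OF T car_x f] Let_def by blast+
  have mem: "F b \<in> scalar_ideal T \<longleftrightarrow> f b = \<zero>\<^bsub>fin T\<^esub>" for b
  proof -
    have "F b - ?O = F b" using car[of b] by (intro eq_matI) auto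
    then show ?thesis using matrix_class_eq_iff[OF car zero_carrier_mat, of b] by (simp add: f(1) class_zero)
  qed
  have zero_bracket: "sbr T ?O (F b) = ?O" for b
    by (rule super_bracket_zero(1)[OF car])
  have scaled: "(s * of_int b - \<alpha> (toral T ?O r s)) \<cdot>\<^sub>m F b \<in> scalar_ideal T" for b r s
  proof -
    have "?O + (s * of_int b) \<cdot>\<^sub>m F b - \<alpha> (toral T ?O r s) \<cdot>\<^sub>m F b = (s * of_int b - \<alpha> (toral T ?O r s)) \<cdot>\<^sub>m F b"
      using car[of b] by (intro eq_matI) (auto simp: algebra_simps)
    then show ?thesis using eigen(1)[OF cartan_mats_zero, of b s r] by (simp add: zero_bracket)
  qed
  have cancel: "z = 0" if "z \<cdot>\<^sub>m F b \<in> scalar_ideal T" "F b \<notin> scalar_ideal T" for z b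
  proof (rule ccontr)
    assume "z \<noteq> 0"
    have "inverse z \<cdot>\<^sub>m (z \<cdot>\<^sub>m F b) \<in> scalar_ideal T" by (rule scalar_ideal_smult[OF that(1)])
    moreover have "inverse z \<cdot>\<^sub>m (z \<cdot>\<^sub>m F b) = F b" using car[of b] \<open>z \<noteq> 0\<close> by (intro eq_matI) auto
    ultimately show False using that by simp
  qed
  show "\<alpha> (toral T ?O 1 0) = 0"
  proof (cases "\<exists>b. F b \<notin> scalar_ideal T")
    case True
    then obtain b where "F b \<notin> scalar_ideal T" by blast
    then show ?thesis using cancel[OF scaled[of 0 b 1]] by simp
  next
    case False
    then have "f = (\<lambda>_. \<zero>\<^bsub>fin T\<^esub>)" using mem by auto
    then have "r' \<noteq> 0 \<or> s' \<noteq> 0" using x(2) by (auto simp: x_eq affine_simps(2))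
    then show ?thesis using eigen(2,3)[OF cartan_mats_zero] by (metis mult_eq_0_iff)
  qed
  show "(\<forall>h\<in>cartan T \<zeta>. \<alpha> h = 0) \<or> (\<exists>a X. X \<in> matrix_set T \<and> X \<notin> scalar_ideal T \<and>
      matrix_class T X \<in> fin_eigenspace T \<zeta> (nat (a mod int (sigma_order T))) \<and>
      \<alpha> (toral T ?O 0 1) = of_int a \<and>
      (\<forall>Y\<in>cartan_mats T. sbr T Y X - \<alpha> (toral T Y 0 0) \<cdot>\<^sub>m X \<in> scalar_ideal T))"
  proof (cases "\<exists>b. F b \<notin> scalar_ideal T")
    case True
    then obtain b where b: "F b \<notin> scalar_ideal T" by blast
    have "\<alpha> (toral T ?O 0 1) = of_int b" using cancel[OF scaled[of 1 b 0] b] by simp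
    moreover have "sbr T Y (F b) - \<alpha> (toral T Y 0 0) \<cdot>\<^sub>m F b \<in> scalar_ideal T"
      if Y: "Y \<in> cartan_mats T" for Y
    proof -
      have "sbr T Y (F b) + (0 * of_int b) \<cdot>\<^sub>m F b = sbr T Y (F b)"
        using super_bracket_carrier[OF cartan_matsD(2)[OF Y] car[of b], of "size1 T"] car[of b] by (intro eq_matI) auto
      then show ?thesis using eigen(1)[OF Y, of b 0 0] by simp
    qed
    moreover have "matrix_class T (F b) \<in> fin_eigenspace T \<zeta> (nat (b mod int (sigma_order T)))"
    proof -
      have "f b \<in> fin_eigenspace T \<zeta> (nat (b mod int (sigma_order T)))"
        using car_x by (auto simp: affine_simps(1))
      then show ?thesis by (simp only: f(1))
    qed
    ultimately show ?thesis using b f(2) by blast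
  next
    case False
    then have "f = (\<lambda>_. \<zero>\<^bsub>fin T\<^esub>)" using mem by auto
    then have "r' \<noteq> 0 \<or> s' \<noteq> 0" using x(2) by (auto simp: x_eq affine_simps(2))
    then have "\<alpha> (toral T Y r s) = 0" if "Y \<in> cartan_mats T" for Y r s
      using eigen(2,3)[OF that] by (metis mult_eq_0_iff)
    then show ?thesis by (auto simp: cartan_eq[OF T])
  qed
qed

text \<open>
  The eigenvalue equations hold modulo scalar matrices. Evaluating the one for \<open>Y0\<close> on the diagonal shows that
  \<open>X\<close> has constant diagonal, which is removed by a scalar matrix of the ideal. With zero diagonal
  all the equations hold exactly.
\<close>

lemma fin_root_vector_of_class:
  assumes T: "admissible T" and X: "X \<in> matrix_set T" "X \<notin> scalar_ideal T"
    and eigen: "matrix_class T X \<in> fin_eigenspace T \<zeta> k"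
    and weight: "\<And>Y. Y \<in> cartan_mats T \<Longrightarrow> sbr T Y X - w Y \<cdot>\<^sub>m X \<in> scalar_ideal T"
    and Y0: "Y0 \<in> cartan_mats T" "w Y0 \<noteq> 0"
  obtains X' where "fin_root_vector T (\<zeta> ^ k) w X'" "X' \<noteq> zmat T"
proof -
  have n: "0 < msize T" using msize_pos[OF T] by simp
  have Xcar: "X \<in> mats T" by (rule matrix_set_carrier[OF X(1)])
  have br: "(sbr T Y M - z \<cdot>\<^sub>m M) $$ (i, j) = (Y $$ (i, i) - Y $$ (j, j)) * M $$ (i, j) - z * M $$ (i, j)"
    if "Y \<in> cartan_mats T" "M \<in> mats T" "i < msize T" "j < msize T" for Y M i j z
    using super_bracket_diagonal(1)[OF cartan_matsD(2,3)[OF that(1)] that(2-4)] that by simp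
  obtain c where c: "sbr T Y0 X - w Y0 \<cdot>\<^sub>m X = c \<cdot>\<^sub>m 1\<^sub>m (msize T)"
    "c = 0 \<or> \<not> orthosymplectic T \<and> size1 T = size2 T"
    using weight[OF Y0(1)] by (rule scalar_idealE)
  define S where "S = (c / w Y0) \<cdot>\<^sub>m 1\<^sub>m (msize T)"
  have S: "S \<in> scalar_ideal T" unfolding S_def by (rule scalar_idealI) (use c(2) in auto)
  define X' where "X' = S + X"
  have X': "X' \<in> matrix_set T" unfolding X'_def by (intro matrix_set_add scalar_ideal_matrix_set S X)
  have car: "X' \<in> mats T" by (rule matrix_set_carrier[OF X'])
  have "- (w Y0 * X $$ (i, i)) = c" if "i < msize T" for i
    using br[OF Y0(1) Xcar that that, of "w Y0"] arg_cong[OF c(1), of "\<lambda>M. M $$ (i, i)"] that by simp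
  then have "c / w Y0 = - X $$ (i, i)" if "i < msize T" for i
    using that Y0(2) by (metis minus_divide_left nonzero_mult_div_cancel_left)
  then have diag: "X' $$ (i, i) = 0" if "i < msize T" for i
    using that Xcar by (simp add: X'_def S_def)
  have scalar_zero: "M = zmat T" if M: "M \<in> scalar_ideal T" "\<And>i. i < msize T \<Longrightarrow> M $$ (i, i) = 0" for M
  proof -
    obtain d where d: "M = d \<cdot>\<^sub>m 1\<^sub>m (msize T)" using M(1) by (rule scalar_idealE)
    then have "d = 0" using M(2)[OF n] n by simp
    then show ?thesis using d by (auto intro!: eq_matI)
  qed
  have same_class: "matrix_class T X' = matrix_class T X"
    unfolding X'_def by (rule matrix_class_add_scalar[OF Xcar S])
  have "sbr T Y X' - w Y \<cdot>\<^sub>m X' = zmat T" if Y: "Y \<in> cartan_mats T" for Y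
  proof (rule scalar_zero)
    have brcar: "sbr T Y X \<in> mats T"
      using cartan_matsD(2)[OF Y] Xcar by simp
    have brS: "sbr T Y S = zmat T"
      by (rule super_bracket_scalar(2)[OF cartan_matsD(2)[OF Y] S])
    have "sbr T Y X' = sbr T Y X"
      unfolding X'_def super_bracket_add(2)[OF scalar_ideal_carrier[OF S] Xcar cartan_matsD(2)[OF Y]] brS
      using brcar by (rule left_add_zero_mat)
    then have "sbr T Y X' - w Y \<cdot>\<^sub>m X' = (sbr T Y X - w Y \<cdot>\<^sub>m X) + (- w Y) \<cdot>\<^sub>m S"
      unfolding X'_def using brcar Xcar carrier_matD[OF scalar_ideal_carrier[OF S]]
      by (intro eq_matI) (auto simp: algebra_simps)
    then show "sbr T Y X' - w Y \<cdot>\<^sub>m X' \<in> scalar_ideal T"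
      using scalar_ideal_add[OF weight[OF Y] scalar_ideal_smult[OF S]] by simp
    show "(sbr T Y X' - w Y \<cdot>\<^sub>m X') $$ (i, i) = 0" if "i < msize T" for i
      using br[OF Y car that that] diag[OF that] by simp
  qed
  then have weights: "(Y $$ (i, i) - Y $$ (j, j)) * X' $$ (i, j) = w Y * X' $$ (i, j)"
    if "Y \<in> cartan_mats T" "i < msize T" "j < msize T" for Y i j
    using br[OF that(1) car that(2,3), of "w Y"] that by simp
  have sigcar: "sigma_mat T X' \<in> mats T" by (rule sigma_mat_carrier[OF car])
  have "sigma_mat T X' - \<zeta> ^ k \<cdot>\<^sub>m X' = zmat T"
  proof (rule scalar_zero)
    have "sigma_mat T ` matrix_class T X' = (\<zeta> ^ k) \<odot>\<^bsub>fin T\<^esub> matrix_class T X'"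
      using eigen same_class by (simp add: fin_eigenspace_def)
    then show "sigma_mat T X' - \<zeta> ^ k \<cdot>\<^sub>m X' \<in> scalar_ideal T"
      using car sigcar by (simp add: sigma_class class_smult matrix_class_eq_iff)
    show "(sigma_mat T X' - \<zeta> ^ k \<cdot>\<^sub>m X') $$ (i, i) = 0" if "i < msize T" for i
      using that car diag sigcar
      by (cases "orthosymplectic T") (auto simp: sigma_mat_eq_swap sigma_mat_eq_twist twist_def)
  qed
  then have "(sigma_mat T X' - \<zeta> ^ k \<cdot>\<^sub>m X') $$ (i, j) = 0" if "i < msize T" "j < msize T" for i j
    using that by simp
  then have sigma: "sigma_mat T X' = \<zeta> ^ k \<cdot>\<^sub>m X'"
    using car sigcar by (intro eq_matI) auto
  have "X' \<noteq> zmat T"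
  proof
    assume "X' = zmat T"
    then have "matrix_class T X = matrix_class T (zmat T)" using same_class by simp
    then have "X - zmat T \<in> scalar_ideal T" using Xcar by (simp add: matrix_class_eq_iff)
    moreover have "X - zmat T = X" using Xcar by (intro eq_matI) auto
    ultimately show False using X(2) by simp
  qed
  then show thesis
    using that X' sigma diag weights unfolding fin_root_vector_def by blast
qed

lemma fin_root_vector_root_space:
  assumes T: "admissible T" and \<alpha>: "\<alpha> \<in> aff_dual T \<zeta>"
    and Z: "fin_root_vector T (\<zeta> ^ nat (a mod int (sigma_order T))) (\<lambda>Y. \<alpha> (toral T Y 0 0)) Z"
    and hom: "homogeneous T i Z"
    and central: "\<alpha> (toral T (zmat T) 1 0) = 0"
    and degree: "\<alpha> (toral T (zmat T) 0 1) = of_int a"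
  shows "(single T a Z, 0, 0) \<in> aff_root_space T \<zeta> \<alpha>"
    and "(single T a Z, 0, 0) \<in> affine_parity T \<zeta> i"
proof -
  let ?O = "zmat T :: complex mat"
  have Z': "Z \<in> matrix_set T" "sigma_mat T Z = \<zeta> ^ nat (a mod int (sigma_order T)) \<cdot>\<^sub>m Z"
    using Z by (auto simp: fin_root_vector_def)
  have car: "Z \<in> mats T" by (rule matrix_set_carrier[OF Z'(1)])
  have carrier: "(single T a Z, 0, 0) \<in> carrier (affine T \<zeta>)" by (rule single_carrier[OF Z'])
  show "(single T a Z, 0, 0) \<in> affine_parity T \<zeta> i"
    by (rule single_parity[OF carrier Z'(1) hom]) simp
  define F where "F b = (if b = a then Z else ?O)" for b
  have F: "single T a Z b = matrix_class T (F b)" "F b \<in> matrix_set T" for b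
    using Z' by (auto simp: single_def F_def)
  have "sbr T Y (F b) + (s * of_int b) \<cdot>\<^sub>m F b - \<alpha> (toral T Y r s) \<cdot>\<^sub>m F b \<in> scalar_ideal T"
    if Y: "Y \<in> cartan_mats T" for Y r s b
  proof -
    have "sbr T Y (F b) + (s * of_int b) \<cdot>\<^sub>m F b - \<alpha> (toral T Y r s) \<cdot>\<^sub>m F b = ?O"
    proof (rule eq_matI)
      fix i j assume "i < dim_row ?O" "j < dim_col ?O"
      then have ij: "i < msize T" "j < msize T" by auto
      have Fcar: "F b \<in> mats T" by (rule matrix_set_carrier[OF F(2)])
      have br: "sbr T Y (F b) \<in> mats T"
        using cartan_matsD(2)[OF Y] Fcar by simp
      have index: "sbr T Y (F b) $$ (i, j) = (Y $$ (i, i) - Y $$ (j, j)) * F b $$ (i, j)"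
        by (rule super_bracket_diagonal(1)[OF cartan_matsD(2,3)[OF Y] Fcar ij])
      have "(sbr T Y (F b) + (s * of_int b) \<cdot>\<^sub>m F b - \<alpha> (toral T Y r s) \<cdot>\<^sub>m F b) $$ (i, j)
        = (Y $$ (i, i) - Y $$ (j, j)) * F b $$ (i, j) + (s * of_int b) * F b $$ (i, j) - \<alpha> (toral T Y r s) * F b $$ (i, j)"
        using ij Fcar carrier_matD[OF br] index by simp
      also have "\<dots> = 0"
      proof (cases "b = a")
        case True
        have "(Y $$ (i, i) - Y $$ (j, j)) * Z $$ (i, j) = \<alpha> (toral T Y 0 0) * Z $$ (i, j)"
          using Z Y ij by (auto simp: fin_root_vector_def)
        moreover have "\<alpha> (toral T Y r s) = \<alpha> (toral T Y 0 0) + s * of_int a"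
          using dual_space_toral[OF T \<alpha> Y, of r s] central degree by simp
        ultimately show ?thesis using True by (simp add: F_def algebra_simps)
      qed (use ij in \<open>simp add: F_def\<close>)
      finally show "(sbr T Y (F b) + (s * of_int b) \<cdot>\<^sub>m F b - \<alpha> (toral T Y r s) \<cdot>\<^sub>m F b) $$ (i, j) = ?O $$ (i, j)"
        using ij by simp
    qed (use matrix_set_carrier[OF F(2)[of b]] in auto)
    then show ?thesis by simp
  qed
  then show "(single T a Z, 0, 0) \<in> aff_root_space T \<zeta> \<alpha>"
    unfolding root_space_iff[OF T carrier F] Let_def by simp
qed

text \<open>
  \<open>\<alpha>\<close> does not vanish on the finite part of the Cartan subalgebra: otherwise it would be a multiple of
  \<open>\<delta>\<close>, which is isotropic. So \<open>fin_root_pair\<close> applies to a coefficient of a root vector. The bracket of the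
  resulting pair is, up to a scalar and a multiple of \<open>c\<close>, the vector representing \<open>\<alpha>\<close>, on which
  \<open>\<alpha>\<close> has a nonzero value because \<open>(\<alpha>, \<alpha>) \<noteq> 0\<close>.
\<close>

lemma real_root_pair:
  assumes T: "admissible T" and \<zeta>: "primitive_root_of_unity (sigma_order T) \<zeta>" and \<alpha>: "\<alpha> \<in> real_roots T \<zeta>"
  obtains x y i where "i \<in> {0, 1}"
    "x \<in> aff_root_space T \<zeta> \<alpha>" "x \<in> affine_parity T \<zeta> i" "x \<noteq> \<zero>\<^bsub>affine T \<zeta>\<^esub>"
    "y \<in> aff_root_space T \<zeta> (\<lambda>h. - \<alpha> h)" "y \<in> affine_parity T \<zeta> i" "y \<noteq> \<zero>\<^bsub>affine T \<zeta>\<^esub>"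
    "x \<otimes>\<^bsub>affine T \<zeta>\<^esub> y \<in> cartan T \<zeta>" "\<alpha> (x \<otimes>\<^bsub>affine T \<zeta>\<^esub> y) \<noteq> 0" "delta T \<zeta> (x \<otimes>\<^bsub>affine T \<zeta>\<^esub> y) = 0"
    "(\<lambda>h. - \<alpha> h) \<in> real_roots T \<zeta>" "\<alpha> (toral T (zmat T) 1 0) = 0"
proof -
  let ?O = "zmat T :: complex mat"
  let ?L = "affine T \<zeta>" and ?H = "cartan T \<zeta>" and ?N = "int (sigma_order T)"
  have root: "\<alpha> \<in> roots T \<zeta>" and dual: "\<alpha> \<in> dual_space ?L ?H"
    using \<alpha> by (auto simp: real_roots_def roots_def root_set_def)
  obtain v where v: "v \<in> root_space ?L ?H \<alpha>" "v \<noteq> \<zero>\<^bsub>?L\<^esub>"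
    by (rule roots_nonzero_vector[OF T root])
  have central: "\<alpha> (toral T ?O 1 0) = 0" by (rule root_vector_component(1)[OF T dual v])
  have nonzero_on_H: "\<not> (\<forall>h\<in>?H. \<alpha> h = 0)"
  proof
    assume "\<forall>h\<in>?H. \<alpha> h = 0"
    then have "represents T \<alpha> ?O 0 0"
      using cartan_mats_zero toral_in_cartan[OF T] by (simp add: represents_def supertrace_zero_mult)
    then show False using real_root_not_imaginary[OF T \<alpha>] by blast
  qed
  have "\<exists>a X. X \<in> matrix_set T \<and> X \<notin> scalar_ideal T \<and>
      matrix_class T X \<in> fin_eigenspace T \<zeta> (nat (a mod ?N)) \<and> \<alpha> (toral T ?O 0 1) = of_int a \<and>
      (\<forall>Y\<in>cartan_mats T. sbr T Y X - \<alpha> (toral T Y 0 0) \<cdot>\<^sub>m X \<in> scalar_ideal T)"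
    by (rule disjE[OF root_vector_component(2)[OF T dual v]]) (erule notE[OF nonzero_on_H], assumption)
  then obtain a X where X: "X \<in> matrix_set T" "X \<notin> scalar_ideal T"
      "matrix_class T X \<in> fin_eigenspace T \<zeta> (nat (a mod ?N))"
    and degree: "\<alpha> (toral T ?O 0 1) = of_int a"
    and weight: "\<forall>Y\<in>cartan_mats T. sbr T Y X - \<alpha> (toral T Y 0 0) \<cdot>\<^sub>m X \<in> scalar_ideal T"
    by (elim exE conjE) (rule that)
  have toral_value: "\<alpha> (toral T Y r s) = \<alpha> (toral T Y 0 0) + s * of_int a" if "Y \<in> cartan_mats T" for Y r s
    using dual_space_toral[OF T dual that, of r s] central degree by simp
  have "\<exists>Y\<in>cartan_mats T. \<alpha> (toral T Y 0 0) \<noteq> 0"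
  proof (rule ccontr)
    assume "\<not> ?thesis"
    then have "\<alpha> (toral T Y r s) = s * of_int a" if "Y \<in> cartan_mats T" for Y r s
      using toral_value[OF that, of r s] that by simp
    then have "represents T \<alpha> ?O (of_int a) 0"
      using cartan_mats_zero by (simp add: represents_def supertrace_zero_mult)
    then show False using real_root_not_imaginary[OF T \<alpha>] by blast
  qed
  then obtain Y0 where Y0: "Y0 \<in> cartan_mats T" "\<alpha> (toral T Y0 0 0) \<noteq> 0" by blast
  obtain X' where X': "fin_root_vector T (\<zeta> ^ nat (a mod ?N)) (\<lambda>Y. \<alpha> (toral T Y 0 0)) X'" "X' \<noteq> ?O"
    by (rule fin_root_vector_of_class[OF T X, of "\<lambda>Y. \<alpha> (toral T Y 0 0)" Y0]) (use weight Y0 in auto)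
  obtain Z Z' i where Z: "fin_root_vector T (\<zeta> ^ nat (a mod ?N)) (\<lambda>Y. \<alpha> (toral T Y 0 0)) Z"
      "fin_root_vector T (cnj (\<zeta> ^ nat (a mod ?N))) (\<lambda>Y. - \<alpha> (toral T Y 0 0)) Z'"
    and i: "i \<in> {0, 1}" "homogeneous T i Z" "homogeneous T i Z'"
    and W: "sbr T Z Z' \<in> cartan_mats T" and nz: "str T (Z * Z') \<noteq> 0"
    and pairing: "\<And>Y. Y \<in> cartan_mats T \<Longrightarrow>
      str T (sbr T Z Z' * Y) = \<alpha> (toral T Y 0 0) * str T (Z * Z')"
    by (rule fin_root_pair[OF X'(1) cnj_root_power(1)[OF \<zeta>] X'(2)]) blast
  define x where "x = (single T a Z, 0 :: complex, 0 :: complex)"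
  define y where "y = (single T (- a) Z', 0 :: complex, 0 :: complex)"
  define W' where "W' = sbr T Z Z'"
  define \<kappa> where "\<kappa> = str T (Z * Z')"
  have Zset: "Z \<in> matrix_set T" "Z' \<in> matrix_set T" using Z by (auto simp: fin_root_vector_def)
  have Zcar: "Z \<in> mats T" "Z' \<in> mats T"
    using Zset by (auto intro: matrix_set_carrier)
  have x: "x \<in> root_space ?L ?H \<alpha>" "x \<in> affine_parity T \<zeta> i"
    unfolding x_def by (rule fin_root_vector_root_space[OF T dual Z(1) i(2) central degree])+
  have dual': "(\<lambda>h. - \<alpha> h) \<in> dual_space ?L ?H"
    using dual by (auto simp: dual_space_def)
  have y: "y \<in> root_space ?L ?H (\<lambda>h. - \<alpha> h)" "y \<in> affine_parity T \<zeta> i"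
    unfolding y_def
    by (rule fin_root_vector_root_space[OF T dual' _ i(3)];
        use Z(2) central degree in \<open>simp add: cnj_root_power(2)[OF \<zeta>] del: complex_cnj_power\<close>)+
  have kappa: "kappa T (matrix_class T Z) (matrix_class T Z') = \<kappa>"
    unfolding \<kappa>_def by (rule kappa_class[OF Zset])
  have Znz: "matrix_class T Z \<noteq> \<zero>\<^bsub>fin T\<^esub>"
  proof
    assume "matrix_class T Z = \<zero>\<^bsub>fin T\<^esub>"
    then have "\<kappa> = str T (?O * Z')"
      using kappa Zset by (simp add: class_zero kappa_class)
    then show False using nz supertrace_scalar_mult(1)[OF Zset(2) scalar_ideal_zero] by (simp add: \<kappa>_def)
  qed
  have Z'nz: "matrix_class T Z' \<noteq> \<zero>\<^bsub>fin T\<^esub>"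
  proof
    assume "matrix_class T Z' = \<zero>\<^bsub>fin T\<^esub>"
    then have "\<kappa> = str T (Z * ?O)"
      using kappa Zset by (simp add: class_zero kappa_class)
    then show False using nz supertrace_scalar_mult(2)[OF Zset(1) scalar_ideal_zero] by (simp add: \<kappa>_def)
  qed
  have xnz: "x \<noteq> \<zero>\<^bsub>?L\<^esub>"
  proof
    assume "x = \<zero>\<^bsub>?L\<^esub>"
    then have "single T a Z a = \<zero>\<^bsub>fin T\<^esub>" by (simp add: x_def affine_simps(2))
    then show False using Znz by (simp add: single_def)
  qed
  have ynz: "y \<noteq> \<zero>\<^bsub>?L\<^esub>"
  proof
    assume "y = \<zero>\<^bsub>?L\<^esub>"
    then have "single T (- a) Z' (- a) = \<zero>\<^bsub>fin T\<^esub>" by (simp add: y_def affine_simps(2))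
    then show False using Z'nz by (simp add: single_def)
  qed
  have bracket: "x \<otimes>\<^bsub>?L\<^esub> y = toral T W' (of_int a * \<kappa>) 0"
  proof -
    define G where "G b = (if b = - a then Z' else ?O)" for b
    have G: "single T (- a) Z' b = matrix_class T (G b)" "G b \<in> mats T" for b
      using Zcar by (auto simp: single_def G_def)
    have closed: "sbr T Z (G b) \<in> matrix_set T" for b
      using cartan_matsD(1)[OF W] super_bracket_zero(2)[OF Zcar(1)] by (auto simp: G_def)
    have "x \<otimes>\<^bsub>?L\<^esub> y = (\<lambda>b. matrix_class T (sbr T Z (G (b - a)) + (0 * of_int b) \<cdot>\<^sub>m G b),
       if matrix_class T Z = \<zero>\<^bsub>fin T\<^esub> then 0
       else of_int a * kappa T (matrix_class T Z) (single T (- a) Z' (- a)), 0)"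
      unfolding x_def y_def by (rule affine_bracket_single[OF Zcar(1) G closed]) simp
    moreover have "single T (- a) Z' (- a) = matrix_class T Z'" by (simp add: single_def)
    moreover have "sbr T Z (G (b - a)) + (0 * of_int b) \<cdot>\<^sub>m G b = (if b = 0 then W' else ?O)" for b
    proof -
      have "(0 * of_int b) \<cdot>\<^sub>m G b = ?O" using G(2)[of b] by (intro eq_matI) auto
      moreover have "sbr T Z (G (b - a)) = (if b = 0 then W' else ?O)"
        using super_bracket_zero(2)[OF Zcar(1)] by (auto simp: G_def W'_def)
      ultimately show ?thesis
        using cartan_matsD(2)[OF W] by (simp add: W'_def right_add_zero_mat)
    qed
    ultimately show ?thesis
      using Znz kappa by (simp add: toral_def single_def fun_eq_iff)
  qed
  have W': "W' \<in> cartan_mats T" using W by (simp add: W'_def)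
  have in_H: "x \<otimes>\<^bsub>?L\<^esub> y \<in> ?H" unfolding bracket by (rule toral_in_cartan[OF T W'])
  have rep: "represents T \<alpha> (inverse \<kappa> \<cdot>\<^sub>m W') (of_int a) 0"
    unfolding represents_def
  proof (intro conjI ballI allI)
    fix Y r s assume Y: "Y \<in> cartan_mats T"
    have "str T (inverse \<kappa> \<cdot>\<^sub>m W' * Y) = inverse \<kappa> * (\<alpha> (toral T Y 0 0) * \<kappa>)"
      using supertrace_smult_mult[OF W' Y, of "inverse \<kappa>"] pairing[OF Y] by (simp only: W'_def \<kappa>_def)
    also have "\<dots> = \<alpha> (toral T Y 0 0)" using nz by (simp add: \<kappa>_def)
    finally show "\<alpha> (toral T Y r s) = str T (inverse \<kappa> \<cdot>\<^sub>m W' * Y) + of_int a * s + 0 * r"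
      using toral_value[OF Y, of r s] by simp
  qed (rule cartan_mats_smult[OF W'])
  have "dual_form (affine_form T) ?H \<alpha> \<alpha> = str T (inverse \<kappa> \<cdot>\<^sub>m W' * (inverse \<kappa> \<cdot>\<^sub>m W'))"
    unfolding dual_form_def dual_vector_represents[OF T rep]
    using affine_form_toral[OF cartan_mats_smult[OF W'] cartan_mats_smult[OF W'], of "inverse \<kappa>" "of_int a" 0] by simp
  also have "\<dots> = inverse \<kappa> * (\<alpha> (toral T (inverse \<kappa> \<cdot>\<^sub>m W') 0 0) * \<kappa>)"
    using supertrace_smult_mult[OF W' cartan_mats_smult[OF W']] pairing[OF cartan_mats_smult[OF W']]
    by (simp add: W'_def \<kappa>_def)
  also have "\<alpha> (toral T (inverse \<kappa> \<cdot>\<^sub>m W') 0 0) = inverse \<kappa> * \<alpha> (toral T W' 0 0)"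
  proof -
    have "\<alpha> (inverse \<kappa> \<odot>\<^bsub>?L\<^esub> toral T W' 0 0) = inverse \<kappa> * \<alpha> (toral T W' 0 0)"
      using dual toral_in_cartan[OF T W', of 0 0 \<zeta>] by (auto simp: dual_space_def)
    then show ?thesis using cartan_matsD(2)[OF W'] by (simp add: toral_smult)
  qed
  finally have "\<alpha> (toral T W' 0 0) \<noteq> 0"
    using \<alpha> by (auto simp: real_roots_def)
  then have nonzero: "\<alpha> (x \<otimes>\<^bsub>?L\<^esub> y) \<noteq> 0" unfolding bracket using toral_value[OF W', of "of_int a * \<kappa>" 0] by simp
  have "(\<lambda>h. - \<alpha> h) \<in> roots T \<zeta>"
    using dual' y(1) ynz by (auto simp: roots_def root_set_def)
  then have neg: "(\<lambda>h. - \<alpha> h) \<in> real_roots T \<zeta>"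
    using \<alpha> dual_form_uminus[OF T, of \<zeta> \<alpha>] by (simp add: real_roots_def)
  have "delta T \<zeta> (x \<otimes>\<^bsub>?L\<^esub> y) = 0" unfolding bracket by (rule delta_toral[OF T W'])
  then show thesis
    using that[OF i(1) x xnz y ynz in_H nonzero _ neg central] by blast
qed

lemma real_root_string:
  assumes T: "admissible T" and \<zeta>: "primitive_root_of_unity (sigma_order T) \<zeta>" and \<alpha>: "\<alpha> \<in> real_roots T \<zeta>"
    and "delta_shift T \<zeta> \<alpha> m \<in> roots T \<zeta>"
  shows "delta_shift T \<zeta> \<alpha> m \<in> real_roots T \<zeta>"
proof -
  have "\<alpha> (toral T (zmat T) 1 0) = 0"
    by (rule real_root_pair[OF T \<zeta> \<alpha>])
  then show ?thesis
    using assms dual_form_delta_shift[OF T, of \<alpha> \<zeta> m] by (simp add: real_roots_def)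
qed

section \<open>Reflections of the support\<close>

lemma cartan_even:
  assumes T: "admissible T" and h: "h \<in> cartan T \<zeta>"
  shows "h \<in> affine_parity T \<zeta> 0" "h \<in> carrier (affine T \<zeta>)"
proof -
  obtain Y r s where Y: "h = toral T Y r s" "Y \<in> cartan_mats T" using h by (auto simp: cartan_eq[OF T])
  have "sigma_mat T Y = \<zeta> ^ nat (0 mod int (sigma_order T)) \<cdot>\<^sub>m Y"
    using cartan_matsD(4)[OF Y(2)] by (simp add: smult_one_mat)
  then have carrier: "(single T 0 Y, r, s) \<in> carrier (affine T \<zeta>)"
    by (rule single_carrier[OF cartan_matsD(1)[OF Y(2)]])
  then show "h \<in> carrier (affine T \<zeta>)" by (simp add: Y toral_def)
  show "h \<in> affine_parity T \<zeta> 0"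
    unfolding Y(1) toral_def by (rule single_parity[OF carrier cartan_matsD(1,5)[OF Y(2)]]) simp
qed

locale affine_module =
  fixes T :: affine_type and \<zeta> :: complex
    and scl :: "complex \<Rightarrow> 'v \<Rightarrow> 'v::ab_group_add" and act :: "aff \<Rightarrow> 'v \<Rightarrow> 'v"
  assumes T: "admissible T" and \<zeta>: "primitive_root_of_unity (sigma_order T) \<zeta>"
    and module: "weight_module T \<zeta> scl act"
begin

abbreviation "supp \<equiv> weight_support T \<zeta> scl act"
abbreviation "weights \<equiv> weight_space (cartan T \<zeta>) scl act"

sublocale vs: vector_space scl
  using module by (simp add: weight_module_def lie_module_def)

lemma act_linear: "x \<in> carrier (affine T \<zeta>) \<Longrightarrow> Vector_Spaces.linear scl scl (act x)"
  using module by (simp add: weight_module_def lie_module_def)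

lemma act_smult: "x \<in> carrier (affine T \<zeta>) \<Longrightarrow> act (z \<odot>\<^bsub>affine T \<zeta>\<^esub> x) v = scl z (act x v)"
  using module by (simp add: weight_module_def lie_module_def)

lemma act_bracket:
  "i \<in> {0, 1} \<Longrightarrow> j \<in> {0, 1} \<Longrightarrow> x \<in> affine_parity T \<zeta> i \<Longrightarrow> y \<in> affine_parity T \<zeta> j \<Longrightarrow>
    act (x \<otimes>\<^bsub>affine T \<zeta>\<^esub> y) v = act x (act y v) - scl ((- 1) ^ (i * j)) (act y (act x v))"
  using module by (simp only: weight_module_def lie_module_def)

lemma root_vector_weight:
  assumes x: "x \<in> aff_root_space T \<zeta> \<alpha>" "x \<in> affine_parity T \<zeta> i" and i: "i \<in> {0, 1}"
    and v: "v \<in> weights \<mu>"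
  shows "act x v \<in> weights (\<lambda>h. \<mu> h + \<alpha> h)"
  unfolding weight_space_def
proof (intro CollectI ballI)
  fix h assume h: "h \<in> cartan T \<zeta>"
  have x': "x \<in> carrier (affine T \<zeta>)" "h \<otimes>\<^bsub>affine T \<zeta>\<^esub> x = \<alpha> h \<odot>\<^bsub>affine T \<zeta>\<^esub> x"
    using x h by (auto simp: root_space_def)
  interpret act: Vector_Spaces.linear scl scl "act x" by (rule act_linear[OF x'(1)])
  have "act h (act x v) - act x (act h v) = act (h \<otimes>\<^bsub>affine T \<zeta>\<^esub> x) v"
    using act_bracket[OF _ i cartan_even(1)[OF T h] x(2), of v] by simp
  also have "\<dots> = scl (\<alpha> h) (act x v)" using x' by (simp add: act_smult)
  finally have "act h (act x v) = scl (\<alpha> h) (act x v) + act x (act h v)" by (simp add: algebra_simps)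
  also have "act h v = scl (\<mu> h) v" using v h by (simp add: weight_space_def)
  finally show "act h (act x v) = scl (\<mu> h + \<alpha> h) (act x v)"
    by (simp add: act.scale vs.scale_left_distrib add.commute)
qed

lemma weights_scale:
  assumes "v \<in> weights \<mu>"
  shows "scl z v \<in> weights \<mu>"
  unfolding weight_space_def
proof (intro CollectI ballI)
  fix h assume h: "h \<in> cartan T \<zeta>"
  interpret act: Vector_Spaces.linear scl scl "act h" by (rule act_linear[OF cartan_even(2)[OF T h]])
  show "act h (scl z v) = scl (\<mu> h) (scl z v)"
    using assms h by (simp add: weight_space_def act.scale mult.commute)
qed

lemma funpow_scaled:
  assumes "Vector_Spaces.linear scl scl g"
  shows "((\<lambda>v. scl z (g v)) ^^ n) v = scl (z ^ n) ((g ^^ n) v)"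
proof -
  interpret g: Vector_Spaces.linear scl scl g by fact
  show ?thesis by (induction n) (simp_all add: g.scale)
qed

lemma linear_scaled:
  assumes "Vector_Spaces.linear scl scl g"
  shows "Vector_Spaces.linear scl scl (\<lambda>v. scl z (g v))"
proof -
  interpret g: Vector_Spaces.linear scl scl g by fact
  show ?thesis by unfold_locales (simp_all add: g.add g.scale vs.scale_right_distrib mult.commute)
qed

lemma linear_square:
  assumes "Vector_Spaces.linear scl scl g"
  shows "Vector_Spaces.linear scl scl (\<lambda>v. g (g v))"
proof -
  interpret g: Vector_Spaces.linear scl scl g by fact
  show ?thesis by unfold_locales (simp_all add: g.add g.scale)
qed

lemma funpow_square: "((\<lambda>v. g (g v)) ^^ n) v = (g ^^ (2 * n)) v"
  by (induction n) simp_all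

lemma nilpotent_scaled_square:
  assumes g: "Vector_Spaces.linear scl scl g" and nil: "\<And>v. \<exists>n. (g ^^ n) v = 0"
  shows "\<exists>n. ((\<lambda>v. scl z (g v)) ^^ n) v = 0" "\<exists>n. ((\<lambda>v. scl z (g (g v))) ^^ n) v = 0"
proof -
  interpret g: Vector_Spaces.linear scl scl g by fact
  obtain n where n: "(g ^^ n) v = 0" using nil by blast
  then have "((\<lambda>v. scl z (g v)) ^^ n) v = 0" by (simp add: funpow_scaled[OF g])
  then show "\<exists>n. ((\<lambda>v. scl z (g v)) ^^ n) v = 0" ..
  have "(g ^^ k) 0 = 0" for k by (induction k) (simp_all add: g.zero)
  then have "(g ^^ (2 * n)) v = 0" using n by (simp add: mult_2 funpow_add)
  then have "((\<lambda>v. scl z (g (g v))) ^^ n) v = 0"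
    by (simp add: funpow_scaled[OF linear_square[OF g]] funpow_square)
  then show "\<exists>n. ((\<lambda>v. scl z (g (g v))) ^^ n) v = 0" ..
qed

text \<open>
  If \<open>x\<close> and \<open>y\<close> are even, they are part of an \<open>sl\<^sub>2\<close>-triple. If they are odd, they generate \<open>osp(1|2)\<close>, and
  their squares act, up to scalars, as an \<open>sl\<^sub>2\<close>-triple for the root \<open>2\<alpha>\<close>, which defines the same reflection.
\<close>

lemma support_reflection:
  assumes i: "i \<in> {0, 1}"
    and x: "x \<in> aff_root_space T \<zeta> \<alpha>" "x \<in> affine_parity T \<zeta> i"
    and y: "y \<in> aff_root_space T \<zeta> (\<lambda>h. - \<alpha> h)" "y \<in> affine_parity T \<zeta> i"
    and h: "x \<otimes>\<^bsub>affine T \<zeta>\<^esub> y \<in> cartan T \<zeta>" "\<alpha> (x \<otimes>\<^bsub>affine T \<zeta>\<^esub> y) \<noteq> 0"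
    and nil: "\<And>v. \<exists>n. (act x ^^ n) v = 0" "\<And>v. \<exists>n. (act y ^^ n) v = 0"
    and \<alpha>: "\<alpha> \<in> aff_dual T \<zeta>" and \<mu>: "\<mu> \<in> supp"
  shows "(\<lambda>k. \<mu> k - 2 * \<mu> (x \<otimes>\<^bsub>affine T \<zeta>\<^esub> y) / \<alpha> (x \<otimes>\<^bsub>affine T \<zeta>\<^esub> y) * \<alpha> k) \<in> supp"
proof -
  define h0 where "h0 = x \<otimes>\<^bsub>affine T \<zeta>\<^esub> y"
  define c where "c = \<alpha> h0"
  have c: "c \<noteq> 0" and h0: "h0 \<in> cartan T \<zeta>" using h by (simp_all add: c_def h0_def)
  have lin: "Vector_Spaces.linear scl scl (act x)" "Vector_Spaces.linear scl scl (act y)"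
    using x y by (auto simp: root_space_def intro: act_linear)
  interpret X: Vector_Spaces.linear scl scl "act x" by fact
  interpret Y: Vector_Spaces.linear scl scl "act y" by fact
  have Xw: "act x v \<in> weights (\<lambda>k. \<nu> k + z * \<alpha> k)" if "v \<in> weights (\<lambda>k. \<nu> k + (z - 1) * \<alpha> k)" for v \<nu> z
    using root_vector_weight[OF x i that] by (simp add: algebra_simps)
  have Yw: "act y v \<in> weights (\<lambda>k. \<nu> k + z * \<alpha> k)" if "v \<in> weights (\<lambda>k. \<nu> k + (z + 1) * \<alpha> k)" for v \<nu> z
    using root_vector_weight[OF y i that] by (simp add: algebra_simps)
  have h0w: "act h0 v = scl (\<nu> h0) v" if "v \<in> weights \<nu>" for v \<nu>
    using that h0 by (simp add: weight_space_def)
  obtain v where v: "v \<in> weights \<mu>" "v \<noteq> 0"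
  proof -
    have "0 \<in> weights \<mu>"
      using vs.scale_zero_left weights_scale[of _ \<mu> 0] \<mu>
      by (auto simp: weight_space_def intro!: module_hom.zero[of scl scl] dest: act_linear[OF cartan_even(2)[OF T]] simp: linear_def Vector_Spaces.linear_def)
    then show thesis using that \<mu> by (auto simp: weight_support_def)
  qed
  have \<mu>_dual: "\<mu> \<in> aff_dual T \<zeta>" using \<mu> by (simp add: weight_support_def)
  have suppI: "(\<lambda>k. \<mu> k + z * \<alpha> k) \<in> supp" if "u \<in> weights (\<lambda>k. \<mu> k + z * \<alpha> k)" "u \<noteq> 0" for u z
  proof -
    have "(\<lambda>k. \<mu> k + z * \<alpha> k) \<in> aff_dual T \<zeta>"
      using \<mu>_dual \<alpha> by (auto simp: dual_space_def algebra_simps)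
    then show ?thesis using that by (auto simp: weight_support_def)
  qed
  from i have "i = 0 \<or> i = 1" by auto
  then have "\<exists>z. z = - 2 * \<mu> h0 / c \<and> (\<exists>u\<in>weights (\<lambda>k. \<mu> k + z * \<alpha> k). u \<noteq> 0)"
  proof
    assume i0: "i = 0"
    define V where "V k = weights (\<lambda>h. \<mu> h + of_int k * \<alpha> h)" for k
    have comm: "act x (act y u) = act y (act x u) + act h0 u" for u
      using act_bracket[OF i i x(2) y(2), of u] by (simp add: i0 h0_def)
    \<comment> \<open>the factor \<open>2 / c\<close> normalises \<open>\<alpha>\<close> to have value 2 on the coroot\<close>
    have "\<exists>d::int. 2 * \<mu> h0 / c = of_int d \<and> (\<exists>u\<in>V (- d). u \<noteq> 0)"
    proof (rule sl2_reflect[OF vs.vector_space_axioms lin(1) linear_scaled[OF lin(2), of "2 / c"]])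
      show "act x u \<in> V (k + 1)" if "u \<in> V k" for u k
        using that Xw[of u \<mu> "of_int (k + 1)"] by (simp add: V_def)
      show "scl (2 / c) (act y u) \<in> V (k - 1)" if "u \<in> V k" for u k
        using that Yw[of u \<mu> "of_int (k - 1)"] by (simp add: V_def weights_scale)
      show "act x (scl (2 / c) (act y u)) = scl (2 / c) (act y (act x u)) + scl (2 * \<mu> h0 / c + 2 * of_int k) u"
        if "u \<in> V k" for u k
      proof -
        have "act h0 u = scl (\<mu> h0 + of_int k * c) u"
          using h0w that by (simp add: V_def c_def)
        moreover have "2 / c * (\<mu> h0 + of_int k * c) = 2 * \<mu> h0 / c + 2 * of_int k"
          using c by (simp add: field_simps)
        ultimately show ?thesis by (simp add: X.scale comm vs.scale_right_distrib)
      qed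
      show "v \<in> V 0" using v by (simp add: V_def)
    qed (use nil v(2) nilpotent_scaled_square(1)[OF lin(2)] in auto)
    then obtain d :: int and u where "2 * \<mu> h0 / c = of_int d" "u \<in> V (- d)" "u \<noteq> 0" by blast
    then show ?thesis by (intro exI[of _ "- of_int d"]) (auto simp: V_def)
  next
    assume i1: "i = 1"
    define V where "V k = weights (\<lambda>h. \<mu> h + (2 * of_int k) * \<alpha> h)" for k
    have anti: "act x (act y u) = act h0 u - act y (act x u)" for u
      using act_bracket[OF i i x(2) y(2), of u] by (simp add: i1 h0_def)
    have "\<exists>d::int. \<mu> h0 / c = of_int d \<and> (\<exists>u\<in>V (- d). u \<noteq> 0)"
    proof (rule sl2_reflect[OF vs.vector_space_axioms linear_square[OF lin(1)]
          \<comment> \<open>\<open>[x\<^sup>2, y\<^sup>2] = - c h\<close> on weight vectors, and \<open>2\<alpha>\<close> must have value 2 on the coroot\<close>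
          linear_scaled[OF linear_square[OF lin(2)], of "- 1 / c\<^sup>2"]])
      show "act x (act x u) \<in> V (k + 1)" if "u \<in> V k" for u k
        using that Xw[of u \<mu> "2 * of_int k + 1"] Xw[of "act x u" \<mu> "2 * of_int k + 2"] by (simp add: V_def algebra_simps)
      show "scl (- 1 / c\<^sup>2) (act y (act y u)) \<in> V (k - 1)" if "u \<in> V k" for u k
      proof -
        have "act y (act y u) \<in> V (k - 1)"
          using that Yw[of u \<mu> "2 * of_int k - 1"] Yw[of "act y u" \<mu> "2 * of_int k - 2"]
          by (simp add: V_def algebra_simps)
        then show ?thesis unfolding V_def by (rule weights_scale)
      qed
      show "act x (act x (scl (- 1 / c\<^sup>2) (act y (act y u)))) =
          scl (- 1 / c\<^sup>2) (act y (act y (act x (act x u)))) + scl (\<mu> h0 / c + 2 * of_int k) u"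
        if u: "u \<in> V k" for u k
      proof -
        define q where "q = \<mu> h0 + 2 * of_int k * c"
        have hu: "act h0 w = scl q w" if "w \<in> V k" for w
          using h0w that by (simp add: V_def c_def q_def)
        have "act x u \<in> weights (\<lambda>h. \<mu> h + (2 * of_int k + 1) * \<alpha> h)"
          using u Xw[of u \<mu> "2 * of_int k + 1"] by (simp add: V_def)
        then have hX: "act h0 (act x u) = scl (q + c) (act x u)"
          using h0w by (simp add: c_def q_def algebra_simps)
        have "act y u \<in> weights (\<lambda>h. \<mu> h + (2 * of_int k - 1) * \<alpha> h)"
          using u Yw[of u \<mu> "2 * of_int k - 1"] by (simp add: V_def)
        then have hY: "act h0 (act y u) = scl (q - c) (act y u)"
          using h0w by (simp add: c_def q_def algebra_simps)
        have YX: "act y (act x w) = scl q w - act x (act y w)" if "w \<in> V k" for w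
          using anti[of w] hu[OF that] by simp
        have XYV: "act x (act y u) \<in> V k"
          using u Yw[of u \<mu> "2 * of_int k - 1"] Xw[of "act y u" \<mu> "2 * of_int k"] by (simp add: V_def)
        have YXV: "act y (act x u) \<in> V k"
          using u Xw[of u \<mu> "2 * of_int k + 1"] Yw[of "act x u" \<mu> "2 * of_int k"] by (simp add: V_def)
        let ?A = "act x (act y u)" and ?B = "act y (act x u)"
        have AB: "?A = scl q u - ?B" using anti[of u] hu[OF u] by simp
        have "act x (act x (act y (act y u))) = act x (scl (q - c) (act y u) - act y ?A)"
          using anti[of "act y u"] hY by simp
        also have "\<dots> = scl (q - c) ?A - act x (act y ?A)"
          by (simp add: X.diff X.scale)
        also have "act x (act y ?A) = scl q ?A - act y (act x ?A)"
          using YX[OF XYV] by simp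
        also have "scl (q - c) ?A - (scl q ?A - act y (act x ?A)) = act y (act x ?A) - scl c ?A"
          by (simp add: vs.scale_left_diff_distrib)
        also have "act y (act x ?A) = scl q ?B - act y (act x ?B)"
          unfolding AB by (simp add: X.diff X.scale Y.diff Y.scale)
        finally have XXYY: "act x (act x (act y (act y u))) = scl q ?B - act y (act x ?B) - scl c ?A" .
        have "act y (act y (act x (act x u))) = act y (scl (q + c) (act x u) - act x ?B)"
        proof -
          have "act y (act x (act x u)) = scl (q + c) (act x u) - act x ?B"
            using anti[of "act x u"] hX by simp
          then show ?thesis by simp
        qed
        also have "\<dots> = scl (q + c) ?B - act y (act x ?B)"
          by (simp add: Y.diff Y.scale)
        finally have YYXX: "act y (act y (act x (act x u))) = scl (q + c) ?B - act y (act x ?B)" .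
        have "act x (act x (act y (act y u))) = act y (act y (act x (act x u))) - scl c (?A + ?B)"
          unfolding XXYY YYXX by (simp add: vs.scale_left_distrib vs.scale_right_distrib)
        also have "?A + ?B = scl q u" using AB by simp
        finally have key: "act x (act x (act y (act y u))) = act y (act y (act x (act x u))) - scl (c * q) u" by simp
        have "act x (act x (scl (- 1 / c\<^sup>2) (act y (act y u)))) = scl (- 1 / c\<^sup>2) (act x (act x (act y (act y u))))"
          by (simp only: X.scale)
        also have "\<dots> = scl (- 1 / c\<^sup>2) (act y (act y (act x (act x u)))) - scl (- 1 / c\<^sup>2 * (c * q)) u"
          unfolding key by (simp add: vs.scale_right_diff_distrib)
        also have "- 1 / c\<^sup>2 * (c * q) = - (\<mu> h0 / c + 2 * of_int k)"
          using c by (simp add: q_def field_simps power2_eq_square)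
        finally show ?thesis by (simp only: vs.scale_minus_left diff_minus_eq_add)
      qed
      show "v \<in> V 0" using v by (simp add: V_def)
      show "\<exists>n. ((\<lambda>v. act x (act x v)) ^^ n) u = 0" for u
        using nilpotent_scaled_square(2)[OF lin(1) nil(1), of 1] by simp
      show "\<exists>n. ((\<lambda>v. scl (- 1 / c\<^sup>2) (act y (act y v))) ^^ n) u = 0" for u
        by (rule nilpotent_scaled_square(2)[OF lin(2) nil(2)])
    qed (use v(2) in simp)
    then obtain d :: int and u where "\<mu> h0 / c = of_int d" "u \<in> V (- d)" "u \<noteq> 0" by blast
    moreover from this have "2 * \<mu> h0 / c = 2 * of_int d" by (metis times_divide_eq_right)
    ultimately show ?thesis by (intro exI[of _ "- 2 * of_int d"]) (auto simp: V_def)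
  qed
  then have "(\<lambda>k. \<mu> k + (- 2 * \<mu> h0 / c) * \<alpha> k) \<in> supp" using suppI by blast
  then show ?thesis by (simp add: h0_def c_def)
qed

end

section \<open>Modules with shadow\<close>

lemma subset_int_span: "\<alpha> \<in> A \<Longrightarrow> \<alpha> \<in> int_span A"
  unfolding int_span_def by (rule CollectI, intro exI[of _ "{\<alpha>}"] exI[of _ "\<lambda>_. 1"]) simp

locale shadow_module = affine_module +
  assumes shadow: "has_shadow T \<zeta> scl act" and supp_nonempty: "supp \<noteq> {}"
begin

lemma shadow_sets:
  "real_roots T \<zeta> = R_in T \<zeta> act \<union> R_ln T \<zeta> act"
  "R_ln T \<zeta> act = B_set T \<zeta> scl act \<inter> real_roots T \<zeta>"
  "R_in T \<zeta> act = C_set T \<zeta> scl act \<inter> real_roots T \<zeta>"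
  using shadow unfolding has_shadow_def by - (elim conjE, assumption)+

lemma in_iff:
  assumes "\<alpha> \<in> real_roots T \<zeta>"
  shows "\<alpha> \<in> R_in T \<zeta> act \<longleftrightarrow> (\<forall>\<mu>\<in>supp. (\<lambda>h. \<alpha> h + \<mu> h) \<in> supp)"
proof -
  have "\<alpha> \<in> int_span (roots T \<zeta>)"
    using assms by (intro subset_int_span) (simp add: real_roots_def)
  moreover have "\<alpha> \<in> R_in T \<zeta> act \<longleftrightarrow> \<alpha> \<in> C_set T \<zeta> scl act"
    using shadow_sets(3) assms by blast
  ultimately show ?thesis by (simp add: C_set_def)
qed

text \<open>
  Repeating the translation by \<open>N\<alpha>\<close> produces an infinite ray in the direction of \<open>\<alpha>\<close>, so \<open>\<alpha>\<close> cannot be in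
  \<open>R\<^sup>l\<^sup>n\<close>.
\<close>

lemma multiple_in:
  assumes \<alpha>: "\<alpha> \<in> real_roots T \<zeta>" and N: "N \<ge> (1::int)"
    and mult: "\<forall>\<mu>\<in>supp. (\<lambda>h. \<mu> h + of_int N * \<alpha> h) \<in> supp"
  shows "\<alpha> \<in> R_in T \<zeta> act"
proof (rule ccontr)
  assume "\<alpha> \<notin> R_in T \<zeta> act"
  then have "\<alpha> \<in> R_ln T \<zeta> act" using \<alpha> shadow_sets(1) by blast
  then have B: "\<alpha> \<in> B_set T \<zeta> scl act" using shadow_sets(2) by blast
  obtain \<mu> where \<mu>: "\<mu> \<in> supp" using supp_nonempty by blast
  have chain: "(\<lambda>h. \<mu> h + of_int (int k * N) * \<alpha> h) \<in> supp" for k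
  proof (induction k)
    case (Suc k)
    from mult[rule_format, OF this] show ?case by (simp add: algebra_simps)
  qed (use \<mu> in simp)
  define J where "J = {j::int. j > 0 \<and> (\<lambda>h. \<mu> h + of_int j * \<alpha> h) \<in> supp}"
  have "finite J" using B \<mu> by (simp add: B_set_def J_def)
  moreover have "range (\<lambda>k. int (Suc k) * N) \<subseteq> J"
  proof
    fix j assume "j \<in> range (\<lambda>k. int (Suc k) * N)"
    then obtain k where j: "j = int (Suc k) * N" by blast
    moreover have "j > 0" using N j by simp
    ultimately show "j \<in> J" using chain[of "Suc k"] by (simp only: J_def mem_Collect_eq)
  qed
  moreover have "inj (\<lambda>k. int (Suc k) * N)" using N by (intro injI) simp
  ultimately have "finite (UNIV :: nat set)" using finite_subset finite_imageD by blast
  then show False by simp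
qed

lemma in_or_ln:
  assumes "\<alpha> \<in> real_roots T \<zeta>" "\<alpha> \<notin> R_in T \<zeta> act"
  shows "\<alpha> \<in> R_ln T \<zeta> act"
  using assms shadow_sets(1) by blast

lemma reflection:
  assumes \<alpha>: "\<alpha> \<in> real_roots T \<zeta>" "\<alpha> \<notin> R_in T \<zeta> act" "(\<lambda>h. - \<alpha> h) \<notin> R_in T \<zeta> act"
  obtains h where "\<alpha> h \<noteq> 0" "delta T \<zeta> h = 0" "\<And>\<mu>. \<mu> \<in> supp \<Longrightarrow> (\<lambda>k. \<mu> k - 2 * \<mu> h / \<alpha> h * \<alpha> k) \<in> supp"
proof -
  obtain x y i where i: "i \<in> {0, 1}"
    and x: "x \<in> aff_root_space T \<zeta> \<alpha>" "x \<in> affine_parity T \<zeta> i" "x \<noteq> \<zero>\<^bsub>affine T \<zeta>\<^esub>"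
    and y: "y \<in> aff_root_space T \<zeta> (\<lambda>h. - \<alpha> h)" "y \<in> affine_parity T \<zeta> i" "y \<noteq> \<zero>\<^bsub>affine T \<zeta>\<^esub>"
    and h: "x \<otimes>\<^bsub>affine T \<zeta>\<^esub> y \<in> cartan T \<zeta>" "\<alpha> (x \<otimes>\<^bsub>affine T \<zeta>\<^esub> y) \<noteq> 0" "delta T \<zeta> (x \<otimes>\<^bsub>affine T \<zeta>\<^esub> y) = 0"
    and neg: "(\<lambda>h. - \<alpha> h) \<in> real_roots T \<zeta>"
    by (rule real_root_pair[OF T \<zeta> \<alpha>(1)]) (rule that)
  have "\<exists>n. (act x ^^ n) v = 0" "\<exists>n. (act y ^^ n) v = 0" for v
    using in_or_ln[OF \<alpha>(1,2)] in_or_ln[OF neg \<alpha>(3)] x y by (auto simp: R_ln_def)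
  moreover have "\<alpha> \<in> aff_dual T \<zeta>"
    using \<alpha>(1) by (simp add: real_roots_def roots_def root_set_def)
  ultimately show thesis
    using support_reflection[OF i x(1,2) y(1,2) h(1,2)] that[OF h(2,3)] by blast
qed

text \<open>
  The reflection \<open>r\<close> in \<open>\<beta> + a\<delta>\<close> acts on weights as an involution that preserves the support, so it conjugates
  translations of the support into translations.
\<close>

lemma string_cone:
  assumes \<beta>: "\<beta> \<in> real_roots T \<zeta>"
  defines "c \<equiv> \<lambda>n x. \<forall>\<mu>\<in>supp. (\<lambda>h. \<mu> h + (of_int n * \<beta> h + of_int x * delta T \<zeta> h)) \<in> supp"
    and "A \<equiv> {a. delta_shift T \<zeta> \<beta> a \<in> roots T \<zeta>}"
  shows "reflective_cone c A"
    and "\<And>a. a \<in> A \<Longrightarrow> c 1 a \<longleftrightarrow> delta_shift T \<zeta> \<beta> a \<in> R_in T \<zeta> act"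
    and "\<And>a. a \<in> A \<Longrightarrow> c (- 1) (- a) \<longleftrightarrow> (\<lambda>h. - delta_shift T \<zeta> \<beta> a h) \<in> R_in T \<zeta> act"
    and "\<And>a. a \<in> A \<Longrightarrow> delta_shift T \<zeta> \<beta> a \<in> real_roots T \<zeta> \<and> (\<lambda>h. - delta_shift T \<zeta> \<beta> a h) \<in> real_roots T \<zeta>"
proof -
  let ?d = "delta T \<zeta>"
  have real: "delta_shift T \<zeta> \<beta> a \<in> real_roots T \<zeta>" if "a \<in> A" for a
    using real_root_string[OF T \<zeta> \<beta>] that by (simp add: A_def)
  have real_neg: "(\<lambda>h. - delta_shift T \<zeta> \<beta> a h) \<in> real_roots T \<zeta>" if "a \<in> A" for a
    by (rule real_root_pair[OF T \<zeta> real[OF that]])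
  show "\<And>a. a \<in> A \<Longrightarrow> delta_shift T \<zeta> \<beta> a \<in> real_roots T \<zeta> \<and> (\<lambda>h. - delta_shift T \<zeta> \<beta> a h) \<in> real_roots T \<zeta>"
    using real real_neg by blast
  have multiple: "c N (N * a) \<longleftrightarrow> (\<forall>\<mu>\<in>supp. (\<lambda>h. \<mu> h + of_int N * delta_shift T \<zeta> \<beta> a h) \<in> supp)" for N a
    by (simp add: c_def delta_shift_def algebra_simps)
  have multiple_neg: "c (- N) (- (N * a)) \<longleftrightarrow> (\<forall>\<mu>\<in>supp. (\<lambda>h. \<mu> h + of_int N * - delta_shift T \<zeta> \<beta> a h) \<in> supp)" for N a
    by (simp add: c_def delta_shift_def algebra_simps)
  show in_pos: "c 1 a \<longleftrightarrow> delta_shift T \<zeta> \<beta> a \<in> R_in T \<zeta> act" if "a \<in> A" for a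
    using multiple[of 1 a] in_iff[OF real[OF that]] by (simp add: add.commute)
  show in_neg: "c (- 1) (- a) \<longleftrightarrow> (\<lambda>h. - delta_shift T \<zeta> \<beta> a h) \<in> R_in T \<zeta> act" if "a \<in> A" for a
    using multiple_neg[of 1 a] in_iff[OF real_neg[OF that]] by (simp add: add.commute)
  show "reflective_cone c A"
  proof
    fix n x n' x' assume c1: "c n x" and c2: "c n' x'"
    show "c (n + n') (x + x')"
      unfolding c_def
    proof
      fix \<mu> assume "\<mu> \<in> supp"
      from c2[unfolded c_def, rule_format, OF c1[unfolded c_def, rule_format, OF this]]
      show "(\<lambda>h. \<mu> h + (of_int (n + n') * \<beta> h + of_int (x + x') * ?d h)) \<in> supp"
        by (simp add: algebra_simps)
    qed
  next
    show "c 0 0" by (simp add: c_def)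
  next
    show "c 1 a" if "a \<in> A" "1 \<le> N" "c N (N * a)" for a N
      using multiple_in[OF real[OF that(1)] that(2)] that(3) in_pos[OF that(1)] by (simp add: multiple)
  next
    show "c (- 1) (- a)" if "a \<in> A" "1 \<le> N" "c (- N) (- (N * a))" for a N
      using multiple_in[OF real_neg[OF that(1)] that(2)] that(3) in_neg[OF that(1)] by (simp only: multiple_neg)
  next
    fix a n x assume a: "a \<in> A" "\<not> c 1 a" "\<not> c (- 1) (- a)" "c n x"
    define \<gamma> where "\<gamma> = delta_shift T \<zeta> \<beta> a"
    obtain h where h: "\<gamma> h \<noteq> 0" "?d h = 0"
      and refl: "\<And>\<mu>. \<mu> \<in> supp \<Longrightarrow> (\<lambda>k. \<mu> k - 2 * \<mu> h / \<gamma> h * \<gamma> k) \<in> supp"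
      using reflection[of \<gamma>] real[OF a(1)] in_pos[OF a(1)] in_neg[OF a(1)] a unfolding \<gamma>_def by blast
    have \<beta>h: "\<beta> h = \<gamma> h" using h(2) by (simp add: \<gamma>_def delta_shift_def)
    show "c (- n) (x - 2 * n * a)"
      unfolding c_def
    proof
      fix \<mu> assume \<mu>: "\<mu> \<in> supp"
      \<comment> \<open>apply the reflection, the given translation, and the reflection again\<close>
      define z where "z = 2 * \<mu> h / \<gamma> h"
      define \<nu> where "\<nu> = (\<lambda>k. \<mu> k - z * \<gamma> k + (of_int n * \<beta> k + of_int x * ?d k))"
      have "\<nu> \<in> supp"
        using a(4)[unfolded c_def, rule_format, OF refl[OF \<mu>]] by (simp only: \<nu>_def z_def)
      then have "(\<lambda>k. \<nu> k - 2 * \<nu> h / \<gamma> h * \<gamma> k) \<in> supp" by (rule refl)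
      moreover have coeff: "2 * \<nu> h / \<gamma> h = - z + 2 * of_int n"
        using h by (simp add: \<nu>_def \<beta>h z_def field_simps)
      have "(\<lambda>k. \<nu> k - 2 * \<nu> h / \<gamma> h * \<gamma> k) = (\<lambda>k. \<mu> k + (of_int (- n) * \<beta> k + of_int (x - 2 * n * a) * ?d k))"
        unfolding coeff by (rule ext) (simp add: \<nu>_def \<gamma>_def delta_shift_def algebra_simps)
      ultimately show "(\<lambda>k. \<mu> k + (of_int (- n) * \<beta> k + of_int (x - 2 * n * a) * ?d k)) \<in> supp"
        by (simp only:)
    qed
  qed
qed

end

theorem theorem4p8:
  fixes T :: affine_type and \<zeta> :: complex
    and scl :: "complex \<Rightarrow> 'v \<Rightarrow> 'v::ab_group_add" and act :: "aff \<Rightarrow> 'v \<Rightarrow> 'v"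
    and \<beta> :: "aff \<Rightarrow> complex"
  assumes "admissible T"
    and "primitive_root_of_unity (sigma_order T) \<zeta>"
    and "weight_module T \<zeta> scl act"
    and "has_shadow T \<zeta> scl act"
    and "\<beta> \<in> real_roots T \<zeta>"
  shows
    "delta_string T \<zeta> \<beta> UNIV \<inter> roots T \<zeta> \<subseteq> R_ln T \<zeta> act \<or>
     delta_string T \<zeta> \<beta> UNIV \<inter> roots T \<zeta> \<subseteq> R_in T \<zeta> act \<or>
     (\<exists>m::int. \<exists>t\<in>{0, 1, -1::int}. \<exists>\<gamma>. \<gamma> = delta_shift T \<zeta> \<beta> m \<and>
        delta_string T \<zeta> \<gamma> {1..} \<inter> roots T \<zeta> \<subseteq> R_in T \<zeta> act \<and>
        delta_string T \<zeta> \<gamma> {..0} \<inter> roots T \<zeta> \<subseteq> R_ln T \<zeta> act \<and>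
        delta_string T \<zeta> (\<lambda>h. - \<gamma> h) {t..} \<inter> roots T \<zeta> \<subseteq> R_in T \<zeta> act \<and>
        delta_string T \<zeta> (\<lambda>h. - \<gamma> h) {..t - 1} \<inter> roots T \<zeta> \<subseteq> R_ln T \<zeta> act) \<or>
     (\<exists>m::int. \<exists>t\<in>{0, 1, -1::int}. \<exists>\<eta>. \<eta> = delta_shift T \<zeta> \<beta> m \<and>
        delta_string T \<zeta> \<eta> {..-1} \<inter> roots T \<zeta> \<subseteq> R_in T \<zeta> act \<and>
        delta_string T \<zeta> \<eta> {0..} \<inter> roots T \<zeta> \<subseteq> R_ln T \<zeta> act \<and>
        delta_string T \<zeta> (\<lambda>h. - \<eta> h) {..-t} \<inter> roots T \<zeta> \<subseteq> R_in T \<zeta> act \<and>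
        delta_string T \<zeta> (\<lambda>h. - \<eta> h) {1 - t..} \<inter> roots T \<zeta> \<subseteq> R_ln T \<zeta> act)"
    (is "?ln \<or> ?in \<or> (\<exists>m. \<exists>t\<in>_. ?iii m t) \<or> (\<exists>m. \<exists>t\<in>_. ?iv m t)")
proof (cases "weight_support T \<zeta> scl act = {}")
  case True
  have "delta_string T \<zeta> \<beta> UNIV \<inter> roots T \<zeta> \<subseteq> B_set T \<zeta> scl act \<inter> real_roots T \<zeta>"
  proof
    fix \<alpha> assume \<alpha>: "\<alpha> \<in> delta_string T \<zeta> \<beta> UNIV \<inter> roots T \<zeta>"
    then have "\<alpha> \<in> real_roots T \<zeta>"
      using real_root_string[OF assms(1,2,5)] by (auto simp: delta_string_def)
    moreover have "\<alpha> \<in> B_set T \<zeta> scl act"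
      using True \<alpha> subset_int_span[of \<alpha> "roots T \<zeta>"] by (simp add: B_set_def)
    ultimately show "\<alpha> \<in> B_set T \<zeta> scl act \<inter> real_roots T \<zeta>" by blast
  qed
  moreover have "R_ln T \<zeta> act = B_set T \<zeta> scl act \<inter> real_roots T \<zeta>"
    using assms(4) unfolding has_shadow_def by (elim conjE)
  ultimately show ?thesis by (simp only: simp_thms)
next
  case False
  interpret shadow_module T \<zeta> scl act
    using assms(1-4) False by unfold_locales
  define c :: "int \<Rightarrow> int \<Rightarrow> bool" where
    "c n x \<longleftrightarrow> (\<forall>\<mu>\<in>supp. (\<lambda>h. \<mu> h + (of_int n * \<beta> h + of_int x * delta T \<zeta> h)) \<in> supp)" for n x
  define A where "A = {a. delta_shift T \<zeta> \<beta> a \<in> roots T \<zeta>}"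
  note cone = string_cone[OF assms(5), folded c_def A_def]
  interpret reflective_cone c A by (rule cone(1))
  have ln: "delta_shift T \<zeta> \<beta> a \<in> R_ln T \<zeta> act" if "a \<in> A" "\<not> c 1 a" for a
    using in_or_ln cone(2,4) that by blast
  have ln_neg: "(\<lambda>h. - delta_shift T \<zeta> \<beta> a h) \<in> R_ln T \<zeta> act" if "a \<in> A" "\<not> c (- 1) (- a)" for a
    using in_or_ln cone(3,4) that by blast
  have string: "delta_string T \<zeta> (delta_shift T \<zeta> \<beta> m) J \<inter> roots T \<zeta> \<subseteq> R"
    if "\<And>a. a \<in> A \<Longrightarrow> a - m \<in> J \<Longrightarrow> delta_shift T \<zeta> \<beta> a \<in> R" for m J R
  proof
    fix \<alpha> assume "\<alpha> \<in> delta_string T \<zeta> (delta_shift T \<zeta> \<beta> m) J \<inter> roots T \<zeta>"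
    then obtain j where j: "j \<in> J" "\<alpha> = delta_shift T \<zeta> (delta_shift T \<zeta> \<beta> m) j" "\<alpha> \<in> roots T \<zeta>"
      by (auto simp: delta_string_def)
    then have "\<alpha> = delta_shift T \<zeta> \<beta> (m + j)" by (simp add: delta_shift_def algebra_simps)
    then show "\<alpha> \<in> R" using that[of "m + j"] j by (simp add: A_def)
  qed
  have neg_real: "(\<lambda>h. - \<beta> h) \<in> real_roots T \<zeta>"
    by (rule real_root_pair[OF assms(1,2,5)])
  \<comment> \<open>a root in the opposite string is the negative of a root of the form \<open>\<beta> + a\<delta>\<close>\<close>
  have string_neg: "delta_string T \<zeta> (\<lambda>h. - delta_shift T \<zeta> \<beta> m h) J \<inter> roots T \<zeta> \<subseteq> R"
    if "\<And>a. a \<in> A \<Longrightarrow> m - a \<in> J \<Longrightarrow> (\<lambda>h. - delta_shift T \<zeta> \<beta> a h) \<in> R" for m J R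
  proof
    fix \<alpha> assume "\<alpha> \<in> delta_string T \<zeta> (\<lambda>h. - delta_shift T \<zeta> \<beta> m h) J \<inter> roots T \<zeta>"
    then obtain j where j: "j \<in> J" "\<alpha> = delta_shift T \<zeta> (\<lambda>h. - delta_shift T \<zeta> \<beta> m h) j" "\<alpha> \<in> roots T \<zeta>"
      by (auto simp: delta_string_def)
    have "\<alpha> = delta_shift T \<zeta> (\<lambda>h. - \<beta> h) (j - m)"
      using j(2) by (simp add: delta_shift_def algebra_simps)
    then have "\<alpha> \<in> real_roots T \<zeta>"
      using real_root_string[OF assms(1,2) neg_real] j(3) by simp
    then have "(\<lambda>h. - \<alpha> h) \<in> real_roots T \<zeta>"
      by (rule real_root_pair[OF assms(1,2)])
    moreover have neg: "(\<lambda>h. - \<alpha> h) = delta_shift T \<zeta> \<beta> (m - j)"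
      using j(2) by (simp add: delta_shift_def algebra_simps)
    ultimately have "m - j \<in> A" by (simp add: A_def real_roots_def)
    moreover have "\<alpha> = (\<lambda>h. - delta_shift T \<zeta> \<beta> (m - j) h)"
      unfolding neg[symmetric] by simp
    ultimately show "\<alpha> \<in> R" using that[of "m - j"] j(1) by simp
  qed
  have whole: "delta_string T \<zeta> \<beta> UNIV \<inter> roots T \<zeta> \<subseteq> R" if "\<And>a. a \<in> A \<Longrightarrow> delta_shift T \<zeta> \<beta> a \<in> R" for R
    using that by (auto simp: delta_string_def A_def)
  show ?thesis
  proof (rule threshold_alternatives)
    assume "\<forall>a\<in>A. \<not> c 1 a"
    then have ?ln using ln by (intro whole) blast
    then show ?thesis by (rule disjI1)
  next
    assume "\<forall>a\<in>A. c 1 a"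
    then have ?in using cone(2) by (intro whole) blast
    then show ?thesis by (rule disjI2[OF disjI1])
  next
    fix m t :: int
    assume t: "t \<in> {0, 1, -1}" and mt: "\<forall>j\<in>A. (j \<ge> m + 1 \<longrightarrow> c 1 j) \<and> (j \<le> m \<longrightarrow> \<not> c 1 j) \<and>
        (- j \<ge> - m + t \<longrightarrow> c (- 1) (- j)) \<and> (- j \<le> - m + t - 1 \<longrightarrow> \<not> c (- 1) (- j))"
    have "?iii m t"
    proof (intro exI conjI refl)
      show "delta_string T \<zeta> (delta_shift T \<zeta> \<beta> m) {1..} \<inter> roots T \<zeta> \<subseteq> R_in T \<zeta> act"
        by (rule string) (use mt cone(2) in auto)
      show "delta_string T \<zeta> (delta_shift T \<zeta> \<beta> m) {..0} \<inter> roots T \<zeta> \<subseteq> R_ln T \<zeta> act"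
        by (rule string) (use mt ln in auto)
      show "delta_string T \<zeta> (\<lambda>h. - delta_shift T \<zeta> \<beta> m h) {t..} \<inter> roots T \<zeta> \<subseteq> R_in T \<zeta> act"
        by (rule string_neg) (use mt cone(3) in auto)
      show "delta_string T \<zeta> (\<lambda>h. - delta_shift T \<zeta> \<beta> m h) {..t - 1} \<inter> roots T \<zeta> \<subseteq> R_ln T \<zeta> act"
        by (rule string_neg) (use mt ln_neg in auto)
    qed (rule refl)
    then show ?thesis using t by blast
  next
    fix m t :: int
    assume t: "t \<in> {0, 1, -1}" and mt: "\<forall>j\<in>A. (j \<le> m - 1 \<longrightarrow> c 1 j) \<and> (j \<ge> m \<longrightarrow> \<not> c 1 j) \<and>
        (- j \<le> - m - t \<longrightarrow> c (- 1) (- j)) \<and> (- j \<ge> - m + 1 - t \<longrightarrow> \<not> c (- 1) (- j))"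
    have "?iv m t"
    proof (intro exI conjI refl)
      show "delta_string T \<zeta> (delta_shift T \<zeta> \<beta> m) {..-1} \<inter> roots T \<zeta> \<subseteq> R_in T \<zeta> act"
        by (rule string) (use mt cone(2) in auto)
      show "delta_string T \<zeta> (delta_shift T \<zeta> \<beta> m) {0..} \<inter> roots T \<zeta> \<subseteq> R_ln T \<zeta> act"
        by (rule string) (use mt ln in auto)
      show "delta_string T \<zeta> (\<lambda>h. - delta_shift T \<zeta> \<beta> m h) {..-t} \<inter> roots T \<zeta> \<subseteq> R_in T \<zeta> act"
        by (rule string_neg) (use mt cone(3) in auto)
      show "delta_string T \<zeta> (\<lambda>h. - delta_shift T \<zeta> \<beta> m h) {1 - t..} \<inter> roots T \<zeta> \<subseteq> R_ln T \<zeta> act"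
        by (rule string_neg) (use mt ln_neg in auto)
    qed (rule refl)
    then show ?thesis using t by blast
  qed
qed

end
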